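(* In the setting of the context, for $\lambda\in\mathbb C\setminus(\sigma_1\cup\sigma_2)$ and $f\in L^2(\mathcal T)$, \[(\mathcal L-\lambda I)^{-1}f=\sum_{e}\int_0^1R_e(x,t,\lambda)f_e(t)\,dt,\] where the sum is over all edges $e$ of $\mathcal T$, $f_e$ is the restriction of $f$ to $e$ (in the coordinate $t\in[0,1]$ of $e$ with its $R$-endpoint at $0$), and the sum converges in $L^2(\mathcal T)$.
   Context: $\mathcal T$ is the infinite biregular tree (vertex classes $\mathcal V_R,\mathcal V_B$ with degrees $\delta_R+1$, $\delta_B+1$, integers $\delta_B,\delta_R\ge1$), each edge identified with $[0,1]$; $\mathcal L$ is $-d^2/dx^2$ on $L^2(\mathcal T)=\bigoplus_eL^2(e)$ with domain the functions continuous on $\mathcal T$, $C^1$ on edges with absolutely continuous derivative, second derivative in $L^2$, and $\sum_{e\sim v}\partial_\nu f_e(v)=0$ at every vertex (outward derivatives). With $\omega=\sqrt\lambda$: $c=\cos\omega$, $c'=-\omega\sin\omega$, $s=\sin\omega/\omega$; $T_0(\lambda)=J_RM_0J_BM_0$ with $M_0=\begin{pmatrix}c&s\\c'&c\end{pmatrix}$, $J_B=\operatorname{diag}(1,1/\delta_B)$, $J_R=\operatorname{diag}(1,1/\delta_R)$; $\sigma_1=\{\lambda:T_0(\lambda)$ has an eigenvalue of modulus $(\delta_B\delta_R)^{-1/2}\}$; on $\mathbb C\setminus\sigma_1$, $\mu^-(\lambda)$ is the analytic eigenvalue of $T_0(\lambda)$ with $|\mu^-|<(\delta_B\delta_R)^{-1/2}$.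 For an edge $e=\{r,b\}$ ($r\in\mathcal V_R$) identified with $[0,1]$, $r\leftrightarrow0$: let $\mathcal T_0^e$ be the union of nonbacktracking rays with vertex sequence $r,b,\dots$, with coordinate $x\in[0,\infty)$ = distance from $r$, and $\mathcal T_1^e$ the union of nonbacktracking rays $b,r,\dots$ with coordinate $x=1-\text{dist}(\cdot,b)\in(-\infty,1]$; these cover $\mathcal T$. On $[0,1]$ set $V(x,\lambda)=sc(1+\tfrac1{\delta_B})\cos(\omega x)+[\mu^--c^2-\tfrac{sc'}{\delta_B}]\tfrac{\sin(\omega x)}{\omega}$, $U(x,\lambda)=-sc(1+\tfrac1{\delta_R})\cos(\omega(1-x))-[\mu^--c^2-\tfrac{sc'}{\delta_R}]\tfrac{\sin(\omega(1-x))}{\omega}$; $V$ is extended to $\mathcal T_0^e$ and $U$ to $\mathcal T_1^e$ as functions of $x$ solving $-y''=\lambda y$ between integers, continuous, with $y'(x^+)=y'(x^-)/\delta_R$ (even $x>0$), $y'(x^+)=y'(x^-)/\delta_B$ (odd $x>0$) for $V$, and $y'(x^-)=y'(x^+)/\delta_R$ (even $x<1$), $y'(x^-)=y'(x^+)/\delta_B$ (odd $x<1$) for $U$. $W(\lambda)=UV'-U'V$ on $(0,1)$, and $\sigma_2=\{\lambda\in\mathbb C\setminus\sigma_1:W(\lambda)=0\}$. The kernel is $R_e(x,t,\lambda)=-U(x,\lambda)V(t,\lambda)/W(\lambda)$ for points with coordinate $x\le t$, and $R_e(x,t,\lambda)=-U(t,\lambda)V(x,\lambda)/W(\lambda)$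 for points with coordinate $x\ge t$, where $t\in[0,1]$. *)

theory Defs
  imports "HOL-Analysis.Analysis"
begin

definition nbwalk :: "('v \<Rightarrow> 'v \<Rightarrow> bool) \<Rightarrow> 'v list \<Rightarrow> bool" where
  "nbwalk E p \<longleftrightarrow> p \<noteq> [] \<and> (\<forall>i. Suc i < length p \<longrightarrow> E (p!i) (p!Suc i))
      \<and> (\<forall>i. i + 2 < length p \<longrightarrow> p!i \<noteq> p!(i+2))"

text \<open>The infinite biregular tree: vertex set = the type, colour classes red (V_R) and
  not red (V_B), simple graph, bipartite w.r.t. the colouring, red vertices of degree
  dR+1, blue ones of degree dB+1, and a tree (between any two vertices there is
  exactly one nonbacktracking walk, i.e. connected and acyclic).\<close>
definition biregular_tree :: "('v \<Rightarrow> 'v \<Rightarrow> bool) \<Rightarrow> ('v \<Rightarrow> bool) \<Rightarrow> nat \<Rightarrow> nat \<Rightarrow> bool" where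
  "biregular_tree E red dR dB \<longleftrightarrow> dR \<ge> 1 \<and> dB \<ge> 1
     \<and> (\<forall>u v. E u v \<longrightarrow> E v u)
     \<and> (\<forall>u v. E u v \<longrightarrow> red u \<noteq> red v)
     \<and> (\<forall>v. finite {w. E v w} \<and> card {w. E v w} = (if red v then dR + 1 else dB + 1))
     \<and> (\<forall>u v. \<exists>!p. nbwalk E p \<and> hd p = u \<and> last p = v)"

text \<open>Edges are identified with pairs (r,b), r red, b blue, adjacent; the edge is
  identified with [0,1] with r at 0 and b at 1.\<close>
definition edges :: "('v \<Rightarrow> 'v \<Rightarrow> bool) \<Rightarrow> ('v \<Rightarrow> bool) \<Rightarrow> ('v \<times> 'v) set" where
  "edges E red = {(r, b). red r \<and> E r b}"

definition vdist :: "('v \<Rightarrow> 'v \<Rightarrow> bool) \<Rightarrow> 'v \<Rightarrow> 'v \<Rightarrow> nat" where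
  "vdist E u v = (THE n. \<exists>p. nbwalk E p \<and> hd p = u \<and> last p = v \<and> length p = Suc n)"

definition pdist :: "('v \<Rightarrow> 'v \<Rightarrow> bool) \<Rightarrow> 'v \<Rightarrow> 'v \<times> 'v \<Rightarrow> real \<Rightarrow> real" where
  "pdist E v e' s = min (real (vdist E v (fst e')) + s) (real (vdist E v (snd e')) + 1 - s)"

text \<open>The coordinate x of the point (e',s) relative to the edge e=(r,b): distance from r
  on T_0^e (the side of b, including e), and 1 - distance from b on T_1^e (side of r).
  On e itself both agree.\<close>
definition xcoord :: "('v \<Rightarrow> 'v \<Rightarrow> bool) \<Rightarrow> 'v \<times> 'v \<Rightarrow> 'v \<times> 'v \<Rightarrow> real \<Rightarrow> real" where
  "xcoord E e e' s = (let a = pdist E (fst e) e' s; bb = pdist E (snd e) e' s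
                      in if bb < a then a else 1 - bb)"

text \<open>A function on T is represented edgewise: g e t is the value at coordinate t of edge e.\<close>
type_synonym 'v qfun = "'v \<times> 'v \<Rightarrow> real \<Rightarrow> complex"

text \<open>Squared L^2 norm (as an extended nonnegative real, so it is always defined).\<close>
definition L2sq :: "('v \<Rightarrow> 'v \<Rightarrow> bool) \<Rightarrow> ('v \<Rightarrow> bool) \<Rightarrow> 'v qfun \<Rightarrow> ennreal" where
  "L2sq E red g = (\<Sum>\<^sub>\<infinity>e\<in>edges E red.
      \<integral>\<^sup>+ t. ennreal ((cmod (g e t))\<^sup>2) * indicator {0..1} t \<partial>lborel)"

definition in_L2 :: "('v \<Rightarrow> 'v \<Rightarrow> bool) \<Rightarrow> ('v \<Rightarrow> bool) \<Rightarrow> 'v qfun \<Rightarrow> bool" where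
  "in_L2 E red g \<longleftrightarrow> (\<forall>e\<in>edges E red. set_borel_measurable lborel {0..1} (g e))
                       \<and> L2sq E red g < \<infinity>"

definition L2_has_sum :: "('v \<Rightarrow> 'v \<Rightarrow> bool) \<Rightarrow> ('v \<Rightarrow> bool) \<Rightarrow> ('v \<times> 'v \<Rightarrow> 'v qfun) \<Rightarrow> 'v qfun \<Rightarrow> bool" where
  "L2_has_sum E red h g \<longleftrightarrow> (\<forall>\<epsilon>>0. \<exists>F0. finite F0 \<and> F0 \<subseteq> edges E red \<and>
      (\<forall>F. finite F \<and> F0 \<subseteq> F \<and> F \<subseteq> edges E red \<longrightarrow>
          L2sq E red (\<lambda>e' t. g e' t - (\<Sum>e\<in>F. h e e' t)) < ennreal \<epsilon>))"

text \<open>Domain of the operator L, with g1 the first and g2 the second derivative on each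
  edge: g continuous on T (equal values at shared vertices), each g_e is C^1 on [0,1]
  with absolutely continuous derivative g1_e (g1_e is the integral of g2_e), g and g2
  in L^2(T), Kirchhoff condition (sum of outward derivatives = 0) at every vertex.\<close>
definition in_domL :: "('v \<Rightarrow> 'v \<Rightarrow> bool) \<Rightarrow> ('v \<Rightarrow> bool) \<Rightarrow> 'v qfun \<Rightarrow> 'v qfun \<Rightarrow> 'v qfun \<Rightarrow> bool" where
  "in_domL E red g g1 g2 \<longleftrightarrow>
     (\<forall>e\<in>edges E red. \<forall>e'\<in>edges E red. fst e = fst e' \<longrightarrow> g e 0 = g e' 0)
   \<and> (\<forall>e\<in>edges E red. \<forall>e'\<in>edges E red. snd e = snd e' \<longrightarrow> g e 1 = g e' 1)
   \<and> (\<forall>e\<in>edges E red. \<forall>t\<in>{0..1}. (g e has_vector_derivative g1 e t) (at t within {0..1}))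
   \<and> (\<forall>e\<in>edges E red. continuous_on {0..1} (g1 e))
   \<and> (\<forall>e\<in>edges E red. set_integrable lborel {0..1} (g2 e)
        \<and> (\<forall>x\<in>{0..1}. g1 e x = g1 e 0 + (LINT t:{0..x}|lborel. g2 e t)))
   \<and> in_L2 E red g \<and> in_L2 E red g2
   \<and> (\<forall>v. red v \<longrightarrow> (\<Sum>b\<in>{b. E v b}. g1 (v, b) 0) = 0)
   \<and> (\<forall>v. \<not> red v \<longrightarrow> (\<Sum>r\<in>{r. E v r}. - g1 (r, v) 1) = 0)"

definition solves_res :: "('v \<Rightarrow> 'v \<Rightarrow> bool) \<Rightarrow> ('v \<Rightarrow> bool) \<Rightarrow> complex \<Rightarrow> 'v qfun \<Rightarrow> 'v qfun \<Rightarrow> bool" where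
  "solves_res E red lam f g \<longleftrightarrow> (\<exists>g1 g2. in_domL E red g g1 g2 \<and>
      (\<forall>e\<in>edges E red. AE t in lborel. t \<in> {0..1} \<longrightarrow> - g2 e t - lam * g e t = f e t))"

definition om :: "complex \<Rightarrow> complex" where "om lam = csqrt lam"

text \<open>sin(omega y)/omega, with its continuous value y at omega = 0.\<close>
definition sinw :: "complex \<Rightarrow> real \<Rightarrow> complex" where
  "sinw lam y = (if om lam = 0 then of_real y else sin (om lam * of_real y) / om lam)"
definition cosw :: "complex \<Rightarrow> real \<Rightarrow> complex" where
  "cosw lam y = cos (om lam * of_real y)"

definition cc :: "complex \<Rightarrow> complex" where "cc lam = cos (om lam)"
definition cc' :: "complex \<Rightarrow> complex" where "cc' lam = - om lam * sin (om lam)"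
definition ss :: "complex \<Rightarrow> complex" where "ss lam = sinw lam 1"

definition mat2 :: "complex \<Rightarrow> complex \<Rightarrow> complex \<Rightarrow> complex \<Rightarrow> complex^2^2" where
  "mat2 a b c d = (\<chi> i j. if i = 1 then (if j = 1 then a else b) else (if j = 1 then c else d))"

definition M0 :: "complex \<Rightarrow> complex^2^2" where "M0 lam = mat2 (cc lam) (ss lam) (cc' lam) (cc lam)"
definition Jd :: "nat \<Rightarrow> complex^2^2" where "Jd d = mat2 1 0 0 (1 / of_nat d)"

definition T0 :: "nat \<Rightarrow> nat \<Rightarrow> complex \<Rightarrow> complex^2^2" where
  "T0 dR dB lam = Jd dR ** M0 lam ** Jd dB ** M0 lam"

definition is_eigenvalue :: "complex^2^2 \<Rightarrow> complex \<Rightarrow> bool" where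
  "is_eigenvalue A \<mu> \<longleftrightarrow> (\<exists>v. v \<noteq> 0 \<and> A *v v = \<mu> *s v)"

definition sigma1 :: "nat \<Rightarrow> nat \<Rightarrow> complex set" where
  "sigma1 dR dB = {lam. \<exists>\<mu>. is_eigenvalue (T0 dR dB lam) \<mu> \<and> cmod \<mu> = 1 / sqrt (real (dB * dR))}"

definition mu_minus :: "nat \<Rightarrow> nat \<Rightarrow> complex \<Rightarrow> complex" where
  "mu_minus dR dB lam = (THE \<mu>. is_eigenvalue (T0 dR dB lam) \<mu> \<and> cmod \<mu> < 1 / sqrt (real (dB * dR)))"

text \<open>Piecewise solution of -y'' = lambda y on [0,oo): on [n,n+1] it is
  a_n cos(omega(y-n)) + b_n sin(omega(y-n))/omega; it is continuous and the derivative
  jumps y'(n+) = y'(n-)/d1 at odd n and y'(n+) = y'(n-)/d2 at even n > 0.\<close>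
fun solcoef :: "complex \<Rightarrow> nat \<Rightarrow> nat \<Rightarrow> complex \<Rightarrow> complex \<Rightarrow> nat \<Rightarrow> complex \<times> complex" where
  "solcoef lam d1 d2 a0 b0 0 = (a0, b0)"
| "solcoef lam d1 d2 a0 b0 (Suc n) =
     (let (a, b) = solcoef lam d1 d2 a0 b0 n
      in (a * cc lam + b * ss lam,
          (a * cc' lam + b * cc lam) / of_nat (if odd (Suc n) then d1 else d2)))"

definition sol :: "complex \<Rightarrow> nat \<Rightarrow> nat \<Rightarrow> complex \<Rightarrow> complex \<Rightarrow> real \<Rightarrow> complex" where
  "sol lam d1 d2 a0 b0 y = (let n = nat \<lfloor>y\<rfloor>; (a, b) = solcoef lam d1 d2 a0 b0 n
                           in a * cosw lam (y - real n) + b * sinw lam (y - real n))"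

text \<open>V on T_0^e, as a function of x in [0,oo).\<close>
definition Vf :: "nat \<Rightarrow> nat \<Rightarrow> complex \<Rightarrow> real \<Rightarrow> complex" where
  "Vf dR dB lam x = sol lam dB dR
      (ss lam * cc lam * (1 + 1 / of_nat dB))
      (mu_minus dR dB lam - (cc lam)\<^sup>2 - ss lam * cc' lam / of_nat dB) x"

text \<open>U on T_1^e, as a function of x in (-oo,1] (written in the variable 1 - x).\<close>
definition Uf :: "nat \<Rightarrow> nat \<Rightarrow> complex \<Rightarrow> real \<Rightarrow> complex" where
  "Uf dR dB lam x = sol lam dR dB
      (- ss lam * cc lam * (1 + 1 / of_nat dR))
      (- (mu_minus dR dB lam - (cc lam)\<^sup>2 - ss lam * cc' lam / of_nat dR)) (1 - x)"

text \<open>Wronskian U V' - U' V (constant on (0,1)), evaluated at x = 1/2.\<close>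
definition Wr :: "nat \<Rightarrow> nat \<Rightarrow> complex \<Rightarrow> complex" where
  "Wr dR dB lam = Uf dR dB lam (1/2) * vector_derivative (Vf dR dB lam) (at (1/2))
               - vector_derivative (Uf dR dB lam) (at (1/2)) * Vf dR dB lam (1/2)"

definition sigma2 :: "nat \<Rightarrow> nat \<Rightarrow> complex set" where
  "sigma2 dR dB = {lam. lam \<notin> sigma1 dR dB \<and> Wr dR dB lam = 0}"

definition Rker :: "nat \<Rightarrow> nat \<Rightarrow> complex \<Rightarrow> real \<Rightarrow> real \<Rightarrow> complex" where
  "Rker dR dB lam x t = (if x \<le> t then - Uf dR dB lam x * Vf dR dB lam t / Wr dR dB lam
                        else - Uf dR dB lam t * Vf dR dB lam x / Wr dR dB lam)"

definition Rterm :: "('v \<Rightarrow> 'v \<Rightarrow> bool) \<Rightarrow> nat \<Rightarrow> nat \<Rightarrow> complex \<Rightarrow> 'v qfun \<Rightarrow> 'v \<times> 'v \<Rightarrow> 'v qfun" where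
  "Rterm E dR dB lam f e e' s = (LINT t:{0..1}|lborel. Rker dR dB lam (xcoord E e e' s) t * f e t)"

end

theory Submission
  imports Defs
begin

text \<open>
  For a source edge \<open>e\<close> the kernel is a multiple of \<open>V\<close> on one side of \<open>e\<close> and of \<open>U\<close> on the
  other, so the term of \<open>e\<close> is a Kirchhoff solution of the homogeneous equation off \<open>e\<close>, while on
  \<open>e\<close> variation of constants produces \<open>f\<close>. On every other edge it is a combination of
  \<open>cos(\<omega>t)\<close> and \<open>sin(\<omega>t)/\<omega>\<close> whose coefficients at distance \<open>n\<close> are
  \<open>O(\<theta>\<^sup>n)\<close> with \<open>\<theta> = |\<mu>\<^sup>-|\<^bsup>1/2\<^esup> < (\<delta>\<^sub>B\<delta>\<^sub>R)\<^bsup>-1/4\<^esup>\<close>. Spheres of radius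
  \<open>n\<close> have about \<open>(\<delta>\<^sub>B\<delta>\<^sub>R)\<^bsup>n/2\<^esup>\<close> points, so a Schur test with constant
  weights does not suffice; with the weight \<open>(\<delta>\<^sub>B\<delta>\<^sub>R)\<^bsup>-|v|/4\<^esup>\<close>, \<open>|v|\<close> being the distance
  from a fixed root, a sphere of radius \<open>n\<close> only costs a factor
  \<open>O(n (\<delta>\<^sub>B\<delta>\<^sub>R)\<^bsup>n/4\<^esup>)\<close>. Hence the kernel is bounded on \<open>L\<^sup>2\<close> and the series converges
  unconditionally.

  For uniqueness, average a homogeneous \<open>L\<^sup>2\<close> solution over the edges at equal distance from a
  given edge, on each of its two sides. The averages are governed by the transfer matrix, and
  square summability forces them into the eigenspace of \<open>\<mu>\<^sup>-\<close>. On the given edge the solution is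
  therefore a multiple of \<open>V\<close> and of \<open>U\<close>, and it vanishes because \<open>W \<noteq> 0\<close>.
\<close>


section \<open>Distances in the tree\<close>

text \<open>The two eigenvalues of the transfer matrix have product \<open>1 / (dR * dB)\<close>, so
  the circle in the definition of \<open>sigma1\<close> is where their moduli agree. Off
  \<open>sigma1\<close> exactly one of them lies strictly inside, and this strict inequality is used
  twice: as \<open>theta * kap < 1\<close> it makes the weighted Schur sums converge, and as growth
  of the other eigenvalue it excludes a second mode in L2, because level \<open>2 * k\<close> of a
  half tree has \<open>(dR * dB) ^ k\<close> edges that share the average. The terms of the series
  are not differentiated or glued as functions. Each is encoded by its vertex values and its
  derivatives along outgoing edges (\<open>Val\<close>, \<open>OD\<close>); on every edge it is the
  combination of \<open>cosw\<close> and \<open>sinw\<close> with these coefficients, up to a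
  Duhamel integral on the source edge. Continuity and the Kirchhoff condition become identities
  between absolutely summable families of numbers, which pass to the sum, and the sum of the series
  is defined through its summed coefficients.\<close>

lemma nbwalk_single [simp]: "nbwalk E [x]"
  by (simp add: nbwalk_def)

text \<open>Trades the index conditions for a recursion at the head, the form in which walks are
  extended and shortened below.\<close>

lemma nbwalk_Cons2:
  "nbwalk E (x # y # p) \<longleftrightarrow> E x y \<and> nbwalk E (y # p) \<and> (p \<noteq> [] \<longrightarrow> hd p \<noteq> x)"
proof
  assume n: "nbwalk E (x # y # p)"
  have "E x y" using n unfolding nbwalk_def by (auto dest: spec[of _ 0])
  moreover have "nbwalk E (y # p)"
    unfolding nbwalk_def
  proof (intro conjI allI impI)
    fix i
    assume "Suc i < length (y # p)"
    then show "E ((y # p) ! i) ((y # p) ! Suc i)"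
      using n[unfolded nbwalk_def, THEN conjunct2, THEN conjunct1, rule_format, of "Suc i"] by simp
  next
    fix i
    assume "i + 2 < length (y # p)"
    then show "(y # p) ! i \<noteq> (y # p) ! (i + 2)"
      using n[unfolded nbwalk_def, THEN conjunct2, THEN conjunct2, rule_format, of "Suc i"] by simp
  qed simp
  moreover have "p \<noteq> [] \<longrightarrow> hd p \<noteq> x"
    using n[unfolded nbwalk_def, THEN conjunct2, THEN conjunct2, rule_format, of 0]
    by (auto simp: hd_conv_nth numeral_2_eq_2)
  ultimately show "E x y \<and> nbwalk E (y # p) \<and> (p \<noteq> [] \<longrightarrow> hd p \<noteq> x)" by blast
next
  assume n: "E x y \<and> nbwalk E (y # p) \<and> (p \<noteq> [] \<longrightarrow> hd p \<noteq> x)"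
  show "nbwalk E (x # y # p)"
    unfolding nbwalk_def
  proof (intro conjI allI impI)
    fix i
    assume "Suc i < length (x # y # p)"
    then show "E ((x # y # p) ! i) ((x # y # p) ! Suc i)"
      using n by (cases i) (auto simp: nbwalk_def)
  next
    fix i
    assume "i + 2 < length (x # y # p)"
    then show "(x # y # p) ! i \<noteq> (x # y # p) ! (i + 2)"
      using n by (cases i) (auto simp: nbwalk_def hd_conv_nth numeral_2_eq_2)
  qed simp
qed

lemma nbwalk_rev:
  assumes "\<And>u v. E u v \<Longrightarrow> E v u" and n: "nbwalk E p"
  shows "nbwalk E (rev p)"
  unfolding nbwalk_def
proof (intro conjI allI impI)
  show "rev p \<noteq> []" using n by (simp add: nbwalk_def)
  fix i
  assume i: "Suc i < length (rev p)"
  then have "E (p ! (length p - Suc (Suc i))) (p ! Suc (length p - Suc (Suc i)))"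
    using n by (simp add: nbwalk_def)
  then show "E (rev p ! i) (rev p ! Suc i)"
    using i assms(1) by (simp add: rev_nth Suc_diff_Suc)
next
  fix i
  assume i: "i + 2 < length (rev p)"
  then have "p ! (length p - Suc (i + 2)) \<noteq> p ! (length p - Suc (i + 2) + 2)"
    using n by (simp add: nbwalk_def)
  moreover have "length p - Suc (i + 2) + 2 = length p - Suc i" using i by simp
  ultimately show "rev p ! i \<noteq> rev p ! (i + 2)"
    using i by (simp add: rev_nth)
qed

section \<open>Distances, parents and the two halves left by removing an edge\<close>

locale biregular =
  fixes E :: "'v \<Rightarrow> 'v \<Rightarrow> bool" and red :: "'v \<Rightarrow> bool" and dR dB :: nat
  assumes tree: "biregular_tree E red dR dB"
begin

definition br :: "'v \<Rightarrow> nat" where "br v = (if red v then dR else dB)"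

lemma dR_pos: "dR \<ge> 1" and dB_pos: "dB \<ge> 1"
  using tree by (auto simp: biregular_tree_def)

lemma br_pos: "br v \<ge> 1"
  using dR_pos dB_pos by (simp add: br_def)

lemma adj_sym: "E u v \<Longrightarrow> E v u"
  using tree by (auto simp: biregular_tree_def)

lemma adj_colour: "E u v \<Longrightarrow> red u \<longleftrightarrow> \<not> red v"
  using tree unfolding biregular_tree_def by blast

lemma finite_nbrs [simp]: "finite {w. E v w}"
  using tree unfolding biregular_tree_def by blast

lemma card_nbrs: "card {w. E v w} = br v + 1"
  using tree unfolding biregular_tree_def br_def by simp

lemma nbwalk_exists: "\<exists>p. nbwalk E (u # p) \<and> last (u # p) = v"
proof -
  obtain p where "nbwalk E p" "hd p = u" "last p = v"
    using tree unfolding biregular_tree_def by blast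
  moreover from this have "p = u # tl p"
    by (metis hd_Cons_tl nbwalk_def)
  ultimately show ?thesis by metis
qed

lemma nbwalk_unique:
  "nbwalk E p \<Longrightarrow> nbwalk E q \<Longrightarrow> hd p = hd q \<Longrightarrow> last p = last q \<Longrightarrow> p = q"
  using tree unfolding biregular_tree_def by blast

text \<open>Walks between two vertices are unique, so the length of any nonbacktracking walk is the
  distance; no minimum is involved.\<close>

lemma vdist_eq:
  assumes "nbwalk E (u # p)"
  shows "vdist E u (last (u # p)) = length p"
  unfolding vdist_def
proof (rule the_equality)
  show "\<exists>q. nbwalk E q \<and> hd q = u \<and> last q = last (u # p) \<and> length q = Suc (length p)"
    using assms by (intro exI[of _ "u # p"]) simp
  fix n assume "\<exists>q. nbwalk E q \<and> hd q = u \<and> last q = last (u # p) \<and> length q = Suc n"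
  then obtain q where "nbwalk E q" "hd q = u" "last q = last (u # p)" "length q = Suc n" by blast
  with nbwalk_unique[OF this(1) assms] show "n = length p" by simp
qed

lemma vdist_sym: "vdist E u v = vdist E v u"
proof -
  obtain p where p: "nbwalk E (u # p)" "last (u # p) = v" using nbwalk_exists by blast
  have "nbwalk E (rev (u # p))" using nbwalk_rev p(1) adj_sym by blast
  moreover have "rev (u # p) = v # tl (rev (u # p))"
    using p(2) by (metis hd_Cons_tl hd_rev list.distinct(1) rev_is_Nil_conv)
  ultimately obtain q where q: "rev (u # p) = v # q" "nbwalk E (v # q)" by metis
  have "last (v # q) = u" unfolding q(1)[symmetric] by (simp add: last_rev)
  moreover have "length q = length p" using arg_cong[OF q(1), of length] by simp
  ultimately show ?thesis using vdist_eq[OF p(1)] vdist_eq[OF q(2)] p(2) by simp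
qed

lemma vdist_self [simp]: "vdist E v v = 0"
  using vdist_eq[of v "[]"] by simp

lemma vdist_0D: "vdist E u v = 0 \<Longrightarrow> u = v"
  by (metis last_ConsL length_0_conv nbwalk_exists vdist_eq)

text \<open>The walk from \<open>x\<close> to \<open>o'\<close> either continues with
  \<open>y\<close>, and dropping \<open>x\<close> shortens it by one, or it does not, and putting
  \<open>y\<close> in front keeps it nonbacktracking.\<close>

lemma vdist_adj:
  assumes "E x y"
  shows "vdist E o' y = Suc (vdist E o' x) \<or> vdist E o' x = Suc (vdist E o' y)"
proof -
  obtain p where p: "nbwalk E (x # p)" "last (x # p) = o'" using nbwalk_exists by blast
  have dx: "vdist E o' x = length p" using vdist_eq[OF p(1)] p(2) vdist_sym by simp
  show ?thesis
  proof (cases "p \<noteq> [] \<and> hd p = y")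
    case True
    then obtain q where q: "p = y # q" by (metis hd_Cons_tl)
    then have "nbwalk E (y # q)" using p(1) by (simp add: nbwalk_Cons2)
    from vdist_eq[OF this] have "vdist E o' y = length q" using p(2) q vdist_sym by simp
    then show ?thesis using dx q by simp
  next
    case False
    then have "nbwalk E (y # x # p)"
      using p(1) assms adj_sym by (auto simp: nbwalk_Cons2)
    from vdist_eq[OF this] have "vdist E o' y = Suc (length p)" using p(2) vdist_sym by simp
    then show ?thesis using dx by simp
  qed
qed

lemma vdist_adj': "E x y \<Longrightarrow> vdist E y v = Suc (vdist E x v) \<or> vdist E x v = Suc (vdist E y v)"
  using vdist_adj[of x y v] by (simp add: vdist_sym)

lemma adj_vdist: "E x y \<Longrightarrow> vdist E x y = 1"
  using vdist_adj[of x y x] by simp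

lemma parent_exists:
  assumes "v \<noteq> o'"
  shows "\<exists>w. E v w \<and> vdist E o' v = Suc (vdist E o' w)"
proof -
  obtain p where p: "nbwalk E (v # p)" "last (v # p) = o'" using nbwalk_exists by blast
  with assms obtain w q where q: "p = w # q" by (cases p) auto
  have w: "E v w" "nbwalk E (w # q)" using p(1) q by (auto simp: nbwalk_Cons2)
  show ?thesis
    using vdist_eq[OF p(1)] vdist_eq[OF w(2)] p(2) q w vdist_sym by (intro exI[of _ w]) auto
qed

text \<open>Two neighbours nearer to the root would give two nonbacktracking walks from
  \<open>v\<close> to \<open>o'\<close>. The walk from such a neighbour cannot return to
  \<open>v\<close> at once, since \<open>v\<close> would then be the nearer of the two.\<close>

lemma parent_unique:
  assumes "E v w" "vdist E o' v = Suc (vdist E o' w)"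
    and "E v w'" "vdist E o' v = Suc (vdist E o' w')"
  shows "w = w'"
proof -
  have walk: "\<exists>q. nbwalk E (v # w # q) \<and> last (v # w # q) = o'"
    if w: "E v w" "vdist E o' v = Suc (vdist E o' w)" for w
  proof -
    obtain q where q: "nbwalk E (w # q)" "last (w # q) = o'" using nbwalk_exists by blast
    have dw: "vdist E o' w = length q" using vdist_eq[OF q(1)] q(2) vdist_sym by simp
    have "\<not> (q \<noteq> [] \<and> hd q = v)"
    proof
      assume "q \<noteq> [] \<and> hd q = v"
      then obtain q' where q': "q = v # q'" by (metis hd_Cons_tl)
      then have "nbwalk E (v # q')" using q(1) by (simp add: nbwalk_Cons2)
      from vdist_eq[OF this] have "vdist E o' v = length q'" using q(2) q' vdist_sym by simp
      with dw q' w(2) show False by simp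
    qed
    then show ?thesis using q w(1) by (intro exI[of _ q]) (auto simp: nbwalk_Cons2)
  qed
  obtain q q' where "nbwalk E (v # w # q)" "last (v # w # q) = o'"
    "nbwalk E (v # w' # q')" "last (v # w' # q') = o'"
    using walk assms by meson
  then have "v # w # q = v # w' # q'" by (intro nbwalk_unique) auto
  then show ?thesis by simp
qed

lemma card_children:
  assumes "v \<noteq> o'"
  shows "card {w. E v w \<and> vdist E o' w = Suc (vdist E o' v)} = br v"
proof -
  obtain p where p: "E v p" "vdist E o' v = Suc (vdist E o' p)"
    using parent_exists[OF assms] by blast
  have "{w. E v w \<and> vdist E o' w = Suc (vdist E o' v)} = {w. E v w} - {p}"
  proof (intro subset_antisym subsetI)
    fix w assume "w \<in> {w. E v w \<and> vdist E o' w = Suc (vdist E o' v)}"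
    then show "w \<in> {w. E v w} - {p}" using p(2) by auto
  next
    fix w assume w: "w \<in> {w. E v w} - {p}"
    then have "vdist E o' w = Suc (vdist E o' v)"
      using vdist_adj[of v w o'] parent_unique[OF p, of w] by blast
    then show "w \<in> {w. E v w \<and> vdist E o' w = Suc (vdist E o' v)}" using w by simp
  qed
  then show ?thesis using card_nbrs[of v] p by simp
qed

lemma red_iff_even: "red v \<longleftrightarrow> (red u \<longleftrightarrow> even (vdist E u v))"
proof (induction "vdist E u v" arbitrary: v)
  case 0
  then have "u = v" using vdist_0D by simp
  then show ?case by simp
next
  case (Suc n)
  then have "v \<noteq> u" by auto
  then obtain w where w: "E v w" "vdist E u v = Suc (vdist E u w)"
    using parent_exists by blast
  with Suc(1)[of w] Suc(2) adj_colour[OF w(1)] show ?case by auto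
qed

text \<open>If \<open>x\<close> were not \<open>b\<close>, its neighbour \<open>z\<close> on the way
  to \<open>b\<close> would be farther from \<open>r\<close> than \<open>x\<close>. The distances of
  \<open>z\<close> to \<open>r\<close> and to \<open>b\<close> would then differ by three, although
  \<open>r\<close> and \<open>b\<close> are adjacent.\<close>

lemma side_cross:
  assumes e: "E r b" and xy: "E x y"
    and x: "vdist E r x = Suc (vdist E b x)" and y: "vdist E b y = Suc (vdist E r y)"
  shows "x = b \<and> y = r"
proof -
  have d: "vdist E r x = Suc (vdist E r y)" "vdist E b y = Suc (vdist E b x)"
    using vdist_adj[OF xy, of r] vdist_adj[OF xy, of b] x y by linarith+
  have "x = b"
  proof (rule ccontr)
    assume "x \<noteq> b"
    then obtain z where z: "E x z" "vdist E b x = Suc (vdist E b z)"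
      using parent_exists by blast
    have "vdist E b z \<noteq> vdist E b y" using z(2) d(2) by linarith
    then have "z \<noteq> y" by blast
    then have "vdist E r z = Suc (vdist E r x)"
      using parent_unique[OF xy d(1) z(1)] vdist_adj[OF z(1), of r] by blast
    then show False using x z(2) vdist_adj'[OF e, of z] by linarith
  qed
  moreover from this have "vdist E r y = 0" using x d vdist_self[of b] by simp
  then have "y = r" using vdist_0D by blast
  ultimately show ?thesis by simp
qed

end


section \<open>The Schur test on the edges\<close>

lemma sum_UNION_le:
  fixes f :: "'a \<Rightarrow> real"
  assumes "finite I" "\<And>i. i \<in> I \<Longrightarrow> finite (A i)" "\<And>x. f x \<ge> 0"
  shows "sum f (\<Union>i\<in>I. A i) \<le> (\<Sum>i\<in>I. sum f (A i))"
  using assms(1,2)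
proof (induction I rule: finite_induct)
  case (insert i I)
  have "sum f (A i \<union> (\<Union>j\<in>I. A j)) \<le> sum f (A i) + sum f (\<Union>j\<in>I. A j)"
    using insert assms(3) by (subst sum.union_inter[symmetric]) (auto intro!: sum_nonneg)
  then show ?case using insert by simp
qed simp

text \<open>The weighted Schur test. Since \<open>A\<close> is symmetric, the single inequality
  \<open>A_weight\<close> bounds both row sums and column sums; \<open>w\<close> is merely positive,
  so it may decay.\<close>

locale schur_kernel =
  fixes I :: "'a set" and A :: "'a \<Rightarrow> 'a \<Rightarrow> real" and w :: "'a \<Rightarrow> real" and M :: real
  assumes A_nonneg: "A x y \<ge> 0" and A_sym: "A x y = A y x" and w_pos: "w x > 0"
    and A_weight: "x \<in> I \<Longrightarrow> finite F \<Longrightarrow> F \<subseteq> I \<Longrightarrow> (\<Sum>y\<in>F. A x y * w y) \<le> M * w x"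
    and M_nonneg: "M \<ge> 0"
begin

text \<open>Cauchy-Schwarz with \<open>A x y\<close> split as
  \<open>sqrt (A x y * w y) * sqrt (A x y / w y)\<close>. The first factor costs
  \<open>M * w x\<close>; after exchanging the sums \<open>A_weight\<close> applies again and the
  weights cancel, hence the square of \<open>M\<close>.\<close>

lemma schur_finite:
  assumes F: "finite F" "F \<subseteq> I" and H: "finite H" "H \<subseteq> I"
  shows "(\<Sum>x\<in>F. (\<Sum>y\<in>H. A x y * \<psi> y)\<^sup>2) \<le> M\<^sup>2 * (\<Sum>y\<in>H. (\<psi> y)\<^sup>2)"
proof -
  have cs: "(\<Sum>y\<in>H. A x y * \<psi> y)\<^sup>2 \<le> M * w x * (\<Sum>y\<in>H. A x y * (\<psi> y)\<^sup>2 / w y)" if "x \<in> I" for x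
  proof -
    have "(\<Sum>y\<in>H. A x y * \<psi> y)\<^sup>2 = (\<Sum>y\<in>H. sqrt (A x y * w y) * (sqrt (A x y / w y) * \<psi> y))\<^sup>2"
    proof (intro arg_cong[where f = "\<lambda>z. z\<^sup>2"] sum.cong refl)
      fix y
      have "sqrt (A x y * w y) * sqrt (A x y / w y) = A x y"
        using A_nonneg[of x y] w_pos[of y] by (simp flip: real_sqrt_mult)
      then show "A x y * \<psi> y = sqrt (A x y * w y) * (sqrt (A x y / w y) * \<psi> y)"
        by (simp flip: mult.assoc)
    qed
    also have "\<dots> \<le> (\<Sum>y\<in>H. (sqrt (A x y * w y))\<^sup>2) * (\<Sum>y\<in>H. (sqrt (A x y / w y) * \<psi> y)\<^sup>2)"
      by (rule Cauchy_Schwarz_ineq_sum)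
    also have "\<dots> = (\<Sum>y\<in>H. A x y * w y) * (\<Sum>y\<in>H. A x y * (\<psi> y)\<^sup>2 / w y)"
      using A_nonneg w_pos by (simp add: power_mult_distrib less_imp_le)
    also have "\<dots> \<le> M * w x * (\<Sum>y\<in>H. A x y * (\<psi> y)\<^sup>2 / w y)"
      using A_weight[OF that H] A_nonneg w_pos
      by (intro mult_right_mono sum_nonneg) (auto simp: less_imp_le)
    finally show ?thesis .
  qed
  have "(\<Sum>x\<in>F. (\<Sum>y\<in>H. A x y * \<psi> y)\<^sup>2) \<le> (\<Sum>x\<in>F. M * w x * (\<Sum>y\<in>H. A x y * (\<psi> y)\<^sup>2 / w y))"
    using cs F by (intro sum_mono) auto
  also have "\<dots> = M * (\<Sum>y\<in>H. ((\<psi> y)\<^sup>2 / w y) * (\<Sum>x\<in>F. A y x * w x))"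
    unfolding sum_distrib_left
    by (subst sum.swap) (intro sum.cong refl, simp add: A_sym algebra_simps)
  also have "\<dots> \<le> M * (\<Sum>y\<in>H. ((\<psi> y)\<^sup>2 / w y) * (M * w y))"
    using M_nonneg w_pos H F by (intro mult_left_mono sum_mono A_weight) (auto simp: less_imp_le)
  also have "\<dots> = M\<^sup>2 * (\<Sum>y\<in>H. (\<psi> y)\<^sup>2)"
  proof -
    have "((\<psi> y)\<^sup>2 / w y) * (M * w y) = M * (\<psi> y)\<^sup>2" for y using w_pos[of y] by simp
    then show ?thesis by (simp add: power2_eq_square sum_distrib_left mult.assoc)
  qed
  finally show ?thesis .
qed

lemma schur_summable:
  assumes "x \<in> I" "J \<subseteq> I" "\<And>y. \<psi> y \<ge> 0" and s: "(\<lambda>y. (\<psi> y)\<^sup>2) summable_on J"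
  shows "(\<lambda>y. A x y * \<psi> y) summable_on J"
proof (rule nonneg_bdd_above_summable_on)
  have le: "(\<Sum>y\<in>H. A x y * \<psi> y) \<le> sqrt (M\<^sup>2 * infsum (\<lambda>y. (\<psi> y)\<^sup>2) J)"
    if H: "finite H" "H \<subseteq> J" for H
  proof (rule real_le_rsqrt)
    have "(\<Sum>y\<in>H. A x y * \<psi> y)\<^sup>2 \<le> M\<^sup>2 * (\<Sum>y\<in>H. (\<psi> y)\<^sup>2)"
      using schur_finite[of "{x}" H \<psi>] H assms by auto
    also have "\<dots> \<le> M\<^sup>2 * infsum (\<lambda>y. (\<psi> y)\<^sup>2) J"
      using H s by (intro mult_left_mono finite_sum_le_infsum) auto
    finally show "(\<Sum>y\<in>H. A x y * \<psi> y)\<^sup>2 \<le> M\<^sup>2 * infsum (\<lambda>y. (\<psi> y)\<^sup>2) J" .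
  qed
  show "bdd_above (sum (\<lambda>y. A x y * \<psi> y) ` {F. F \<subseteq> J \<and> finite F})"
    using le by (intro bdd_aboveI[of _ "sqrt (M\<^sup>2 * infsum (\<lambda>y. (\<psi> y)\<^sup>2) J)"]) auto
qed (use A_nonneg assms in auto)

text \<open>The inner set \<open>J\<close> is free because the test is applied to the edges outside
  a finite set, where the right-hand side is a small tail.\<close>

lemma schur_infinite:
  assumes F: "finite F" "F \<subseteq> I" and J: "J \<subseteq> I" and \<psi>: "\<And>y. \<psi> y \<ge> 0"
    and s: "(\<lambda>y. (\<psi> y)\<^sup>2) summable_on J"
  shows "(\<Sum>x\<in>F. (\<Sum>\<^sub>\<infinity>y\<in>J. A x y * \<psi> y)\<^sup>2) \<le> M\<^sup>2 * (\<Sum>\<^sub>\<infinity>y\<in>J. (\<psi> y)\<^sup>2)"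
proof (rule tendsto_upperbound)
  show "((\<lambda>H. \<Sum>x\<in>F. (\<Sum>y\<in>H. A x y * \<psi> y)\<^sup>2) \<longlongrightarrow> (\<Sum>x\<in>F. (\<Sum>\<^sub>\<infinity>y\<in>J. A x y * \<psi> y)\<^sup>2))
      (finite_subsets_at_top J)"
    using F J \<psi> s by (intro tendsto_sum tendsto_power infsum_tendsto schur_summable) auto
  show "\<forall>\<^sub>F H in finite_subsets_at_top J.
      (\<Sum>x\<in>F. (\<Sum>y\<in>H. A x y * \<psi> y)\<^sup>2) \<le> M\<^sup>2 * (\<Sum>\<^sub>\<infinity>y\<in>J. (\<psi> y)\<^sup>2)"
  proof (rule eventually_finite_subsets_at_top_weakI)
    fix H assume H: "finite H" "H \<subseteq> J"
    have "(\<Sum>x\<in>F. (\<Sum>y\<in>H. A x y * \<psi> y)\<^sup>2) \<le> M\<^sup>2 * (\<Sum>y\<in>H. (\<psi> y)\<^sup>2)"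
      using H J F by (intro schur_finite) auto
    also have "\<dots> \<le> M\<^sup>2 * infsum (\<lambda>y. (\<psi> y)\<^sup>2) J"
      using H s by (intro mult_left_mono finite_sum_le_infsum) auto
    finally show "(\<Sum>x\<in>F. (\<Sum>y\<in>H. A x y * \<psi> y)\<^sup>2) \<le> M\<^sup>2 * infsum (\<lambda>y. (\<psi> y)\<^sup>2) J" .
  qed
qed simp

end

context biregular
begin

section \<open>Weighted counting of vertices on spheres\<close>

definition kap :: real where "kap = sqrt (sqrt (real (dR * dB)))"

text \<open>Two steps away from the root multiply the number of vertices by \<open>kap ^ 4\<close>
  and divide the weight by \<open>kap ^ 2\<close>: the weight is the inverse square root of the
  growth.\<close>

definition wt :: "'v \<Rightarrow> 'v \<Rightarrow> real" where "wt o' x = (1 / kap) ^ vdist E o' x"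

text \<open>End points of the nonbacktracking walks that begin with the step from \<open>u\<close>
  to \<open>v\<close> and go on for \<open>n\<close> steps; \<open>u\<close> is carried along to
  forbid turning back.\<close>

primrec reach :: "nat \<Rightarrow> 'v \<Rightarrow> 'v \<Rightarrow> 'v set" where
  "reach 0 u v = {v}"
| "reach (Suc n) u v = (\<Union>w\<in>{w. E v w \<and> w \<noteq> u}. reach n v w)"

lemma kap_ge1: "kap \<ge> 1"
proof -
  have "dR * dB \<ge> 1" using dR_pos dB_pos by simp
  then have "real (dR * dB) \<ge> 1" by linarith
  then show ?thesis by (simp add: kap_def)
qed

lemma kap_sq: "E v w \<Longrightarrow> sqrt (br v) * sqrt (br w) = kap\<^sup>2"
  using adj_colour[of v w] by (auto simp: kap_def br_def real_sqrt_mult power_mult_distrib mult.commute)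

lemma wt_pos: "wt o' x > 0"
  using kap_ge1 by (simp add: wt_def)

lemma wt_child: "vdist E o' y = Suc (vdist E o' x) \<Longrightarrow> wt o' x = kap * wt o' y"
  using kap_ge1 by (simp add: wt_def)

lemma finite_nbrs' [simp]: "finite {w. E v w \<and> P w}"
  by (rule finite_subset[OF _ finite_nbrs[of v]]) auto

lemma card_nbrs_but: "E u v \<Longrightarrow> card {w. E v w \<and> w \<noteq> u} = br v"
proof -
  assume "E u v"
  then have "u \<in> {w. E v w}" using adj_sym by simp
  moreover have "{w. E v w \<and> w \<noteq> u} = {w. E v w} - {u}" by auto
  ultimately show ?thesis using card_nbrs[of v] by simp
qed

lemma finite_reach [simp]: "finite (reach n u v)"
  by (induction n arbitrary: u v) auto

lemma reach_walk: "nbwalk E (u # v # p) \<Longrightarrow> last (v # p) \<in> reach (length p) u v"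
proof (induction p arbitrary: u v)
  case (Cons w p)
  then have "E v w" "w \<noteq> u" "nbwalk E (v # w # p)" by (auto simp: nbwalk_Cons2)
  with Cons.IH[of v w] show ?case by auto
qed simp

lemma sphere_subset: "{x. vdist E v x = Suc n} \<subseteq> (\<Union>w\<in>{w. E v w}. reach n v w)"
proof
  fix x assume x: "x \<in> {x. vdist E v x = Suc n}"
  obtain p where p: "nbwalk E (v # p)" "last (v # p) = x" using nbwalk_exists by blast
  have "length p = Suc n" using vdist_eq[OF p(1)] p(2) x by simp
  then obtain w q where q: "p = w # q" "length q = n" by (cases p) auto
  then show "x \<in> (\<Union>w\<in>{w. E v w}. reach n v w)"
    using p reach_walk[of v w q] by (auto simp: nbwalk_Cons2)
qed

lemma finite_sphere: "finite {x. vdist E v x = n}"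
proof (cases n)
  case 0
  have "{x. vdist E v x = 0} \<subseteq> {v}" using vdist_0D by auto
  then show ?thesis using 0 finite_subset by auto
next
  case (Suc m)
  show ?thesis unfolding Suc by (rule finite_subset[OF sphere_subset]) auto
qed

lemma reach_Suc_le:
  "sum (wt o') (reach (Suc n) u v) \<le> (\<Sum>w\<in>{w. E v w \<and> w \<noteq> u}. sum (wt o') (reach n v w))"
  unfolding reach.simps by (rule sum_UNION_le) (auto simp: less_imp_le[OF wt_pos])

lemma child_weight:
  assumes "E v w" "vdist E o' w = Suc (vdist E o' v)"
  shows "kap ^ n * sqrt (br w) * wt o' w = kap ^ Suc n * wt o' v / sqrt (br v)"
proof -
  have "sqrt (br v) > 0" using br_pos[of v] by simp
  then have "sqrt (br w) = kap\<^sup>2 / sqrt (br v)"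
    using kap_sq[OF assms(1)] by (simp add: field_simps)
  then show ?thesis using wt_child[OF assms(2)] kap_ge1
    by (simp add: power2_eq_square)
qed

text \<open>Walks away from the root. The factor \<open>sqrt (br v)\<close> compensates for the
  alternating degrees: by \<open>child_weight\<close> each of the \<open>br v\<close> children
  contributes \<open>kap ^ Suc n * wt o' v / sqrt (br v)\<close>, so the bound reproduces itself
  without loss.\<close>

lemma reach_down:
  assumes "E u v" "vdist E o' v = Suc (vdist E o' u)"
  shows "sum (wt o') (reach n u v) \<le> kap ^ n * sqrt (br v) * wt o' v"
  using assms
proof (induction n arbitrary: u v)
  case 0
  have "sqrt (br v) \<ge> 1" using br_pos[of v] by simp
  then show ?case using wt_pos[of o' v] by simp
next
  case (Suc n)
  have child: "vdist E o' w = Suc (vdist E o' v)" if "E v w" "w \<noteq> u" for w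
    using parent_unique[of v u o' w] Suc.prems adj_sym that vdist_adj[of v w o'] by blast
  have "sum (wt o') (reach (Suc n) u v) \<le> (\<Sum>w\<in>{w. E v w \<and> w \<noteq> u}. sum (wt o') (reach n v w))"
    by (rule reach_Suc_le)
  also have "\<dots> \<le> (\<Sum>w\<in>{w. E v w \<and> w \<noteq> u}. kap ^ Suc n * wt o' v / sqrt (br v))"
    using Suc.IH child child_weight[of v _ o' n] by (intro sum_mono) force
  also have "\<dots> = kap ^ Suc n * sqrt (br v) * wt o' v"
  proof -
    have "real (br v) / sqrt (br v) = sqrt (br v)"
      using br_pos[of v] by (simp add: real_div_sqrt)
    then have "real (br v) * (kap ^ Suc n * wt o' v / sqrt (br v)) = kap ^ Suc n * sqrt (br v) * wt o' v"
      by (metis mult.commute mult.left_commute times_divide_eq_right)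
    then show ?thesis using card_nbrs_but[OF Suc.prems(1)] by simp
  qed
  finally show ?case .
qed

lemma sqrt_br_le: "sqrt (br v) \<le> real (dR + dB)"
proof -
  have "sqrt (real (br v)) \<le> real (br v)"
    using br_pos[of v] by (intro real_le_lsqrt) (auto simp: power2_eq_square)
  then show ?thesis by (auto simp: br_def split: if_splits)
qed

text \<open>Walks that start towards the root. At every vertex at most one continuation climbs
  further, and the others descend and obey \<open>reach_down\<close>. The weight gained by climbing
  replaces the steps spent on it, so each turning level costs the same, and adding these costs
  yields the factor \<open>Suc n\<close>.\<close>

lemma reach_up:
  assumes "E u v" "vdist E o' u = Suc (vdist E o' v)"
  shows "sum (wt o') (reach n u v) \<le> real (Suc n) * kap ^ n * real (dR + dB) * wt o' v"
  using assms
proof (induction n arbitrary: u v)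
  case 0
  have "real (dR + dB) \<ge> 1" using dR_pos by simp
  then show ?case using wt_pos[of o' v] by simp
next
  case (Suc n)
  define \<gamma> where "\<gamma> = real (dR + dB)"
  define C where "C = {w. E v w \<and> w \<noteq> u}"
  define D where "D = {w. E v w \<and> w \<noteq> u \<and> vdist E o' w = Suc (vdist E o' v)}"
  define P where "P = {w. E v w \<and> w \<noteq> u \<and> vdist E o' v = Suc (vdist E o' w)}"
  have fin: "finite D" "finite P" "finite C" by (auto simp: D_def P_def C_def)
  have C: "C = D \<union> P" unfolding C_def D_def P_def using vdist_adj[of v _ o'] by blast
  have DP: "D \<inter> P = {}" unfolding D_def P_def using n_not_Suc_n by force
  have "sum (wt o') (reach (Suc n) u v) \<le> (\<Sum>w\<in>C. sum (wt o') (reach n v w))"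
    unfolding C_def by (rule reach_Suc_le)
  also have "\<dots> = (\<Sum>w\<in>D. sum (wt o') (reach n v w)) + (\<Sum>w\<in>P. sum (wt o') (reach n v w))"
    unfolding C using fin DP by (intro sum.union_disjoint) auto
  also have "(\<Sum>w\<in>D. sum (wt o') (reach n v w)) \<le> kap ^ Suc n * \<gamma> * wt o' v"
  proof -
    have "(\<Sum>w\<in>D. sum (wt o') (reach n v w)) \<le> (\<Sum>w\<in>D. kap ^ Suc n * wt o' v / sqrt (br v))"
    proof (intro sum_mono)
      fix w assume "w \<in> D"
      then have w: "E v w" "vdist E o' w = Suc (vdist E o' v)" by (auto simp: D_def)
      show "sum (wt o') (reach n v w) \<le> kap ^ Suc n * wt o' v / sqrt (br v)"
        using reach_down[OF w, of n] child_weight[OF w, of n] by simp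
    qed
    also have "\<dots> = real (card D) * (kap ^ Suc n * wt o' v / sqrt (br v))" by simp
    also have "\<dots> \<le> real (br v) * (kap ^ Suc n * wt o' v / sqrt (br v))"
    proof (intro mult_right_mono)
      have "card D \<le> card C" using C fin by (intro card_mono) auto
      then show "real (card D) \<le> real (br v)"
        using card_nbrs_but[OF Suc.prems(1)] by (simp add: C_def)
    qed (use kap_ge1 wt_pos[of o' v] in auto)
    also have "\<dots> = kap ^ Suc n * sqrt (br v) * wt o' v"
    proof -
      have "real (br v) / sqrt (br v) = sqrt (br v)"
        using br_pos[of v] by (simp add: real_div_sqrt)
      then show ?thesis by (metis mult.commute mult.left_commute times_divide_eq_right)
    qed
    also have "\<dots> \<le> kap ^ Suc n * \<gamma> * wt o' v"
      unfolding \<gamma>_def using kap_ge1 wt_pos[of o' v] sqrt_br_le[of v]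
      by (intro mult_right_mono mult_left_mono) auto
    finally show ?thesis .
  qed
  also have "(\<Sum>w\<in>P. sum (wt o') (reach n v w)) \<le> real (Suc n) * kap ^ Suc n * \<gamma> * wt o' v"
  proof (cases "P = {}")
    case True
    then show ?thesis using kap_ge1 wt_pos[of o' v] by (simp add: \<gamma>_def)
  next
    case False
    then obtain p where p: "p \<in> P" by blast
    have "P = {p}" using p parent_unique[of v p o'] by (auto simp: P_def)
    moreover have "sum (wt o') (reach n v p) \<le> real (Suc n) * kap ^ n * \<gamma> * wt o' p"
      unfolding \<gamma>_def using p by (intro Suc.IH) (auto simp: P_def)
    moreover have "wt o' p = kap * wt o' v" using p by (intro wt_child) (auto simp: P_def)
    ultimately show ?thesis by (simp add: mult_ac)
  qed
  finally show ?case unfolding \<gamma>_def[symmetric] by (simp add: algebra_simps)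
qed

lemma sphere_weight:
  "sum (wt o') {x. vdist E v x = n} \<le> (real (dR + dB) + 1)\<^sup>2 * (real (Suc n) * kap ^ n) * wt o' v"
proof (cases n)
  case 0
  have "{x. vdist E v x = 0} = {v}" using vdist_0D[of v] by auto
  moreover have "(real (dR + dB) + 1)\<^sup>2 \<ge> 1" by simp
  ultimately show ?thesis using 0 wt_pos[of o' v] by simp
next
  case (Suc m)
  define \<gamma> where "\<gamma> = real (dR + dB)"
  have \<gamma>: "\<gamma> \<ge> 1" using dR_pos by (simp add: \<gamma>_def)
  have each: "sum (wt o') (reach m v w) \<le> real (Suc m) * kap ^ Suc m * \<gamma> * wt o' v" if "E v w" for w
    using vdist_adj[OF that, of o']
  proof
    assume w: "vdist E o' w = Suc (vdist E o' v)"
    have "wt o' w \<le> kap * wt o' v"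
    proof -
      have "1 * wt o' w \<le> kap * kap * wt o' w"
        using kap_ge1 wt_pos[of o' w] mult_mono[of 1 kap 1 kap] by (intro mult_right_mono) auto
      then show ?thesis using wt_child[OF w] by simp
    qed
    have "sum (wt o') (reach m v w) \<le> kap ^ m * sqrt (br w) * wt o' w"
      by (rule reach_down[OF that w])
    also have "\<dots> \<le> kap ^ m * \<gamma> * (kap * wt o' v)"
      using kap_ge1 wt_pos[of o' w] sqrt_br_le[of w] \<open>wt o' w \<le> kap * wt o' v\<close>
      by (intro mult_mono) (auto simp: \<gamma>_def)
    also have "\<dots> = 1 * (kap ^ m * \<gamma> * (kap * wt o' v))" by simp
    also have "\<dots> \<le> real (Suc m) * (kap ^ m * \<gamma> * (kap * wt o' v))"
      using kap_ge1 \<gamma> wt_pos[of o' v] by (intro mult_right_mono) auto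
    finally show ?thesis by (simp add: mult_ac)
  next
    assume w: "vdist E o' v = Suc (vdist E o' w)"
    show ?thesis using reach_up[OF that w, of m] wt_child[OF w] by (simp add: \<gamma>_def mult_ac)
  qed
  have "sum (wt o') {x. vdist E v x = Suc m} \<le> sum (wt o') (\<Union>w\<in>{w. E v w}. reach m v w)"
    using sphere_subset by (intro sum_mono2) (auto simp: less_imp_le[OF wt_pos])
  also have "\<dots> \<le> (\<Sum>w\<in>{w. E v w}. sum (wt o') (reach m v w))"
    by (rule sum_UNION_le) (auto simp: less_imp_le[OF wt_pos])
  also have "\<dots> \<le> (\<Sum>w\<in>{w. E v w}. real (Suc m) * kap ^ Suc m * \<gamma> * wt o' v)"
    using each by (intro sum_mono) auto
  also have "\<dots> = real (br v + 1) * \<gamma> * (real (Suc m) * kap ^ Suc m * wt o' v)"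
    by (simp add: card_nbrs)
  also have "\<dots> \<le> ((\<gamma> + 1) * (\<gamma> + 1)) * (real (Suc (Suc m)) * kap ^ Suc m * wt o' v)"
  proof (intro mult_mono)
    show "real (br v + 1) \<le> \<gamma> + 1" by (simp add: br_def \<gamma>_def)
  qed (use \<gamma> kap_ge1 wt_pos[of o' v] in auto)
  finally show ?thesis unfolding Suc \<gamma>_def[symmetric] by (simp add: power2_eq_square mult_ac)
qed

lemma vertex_schur:
  assumes \<theta>: "0 \<le> \<theta>" "\<theta> * kap < 1" and F: "finite F"
  shows "(\<Sum>x\<in>F. \<theta> ^ vdist E v x * wt o' x)
    \<le> (real (dR + dB) + 1)\<^sup>2 / (1 - \<theta> * kap)\<^sup>2 * wt o' v"
proof -
  define \<Gamma> where "\<Gamma> = (real (dR + dB) + 1)\<^sup>2"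
  define N where "N = vdist E v ` F"
  \<comment> \<open>The differentiated geometric series; its linear factor is the one that
    \<open>reach_up\<close> produced.\<close>
  have sums: "(\<lambda>n. real (Suc n) * (\<theta> * kap) ^ n) sums (1 / (1 - \<theta> * kap)\<^sup>2)"
    using geometric_deriv_sums[of "\<theta> * kap"] \<theta> kap_ge1 by simp
  have "(\<Sum>x\<in>F. \<theta> ^ vdist E v x * wt o' x)
      = (\<Sum>n\<in>N. \<Sum>x\<in>{x \<in> F. vdist E v x = n}. \<theta> ^ vdist E v x * wt o' x)"
    unfolding N_def using F by (intro sum.image_gen) auto
  also have "\<dots> \<le> (\<Sum>n\<in>N. \<Gamma> * wt o' v * (real (Suc n) * (\<theta> * kap) ^ n))"
  proof (intro sum_mono)
    fix n
    have "(\<Sum>x\<in>{x \<in> F. vdist E v x = n}. \<theta> ^ vdist E v x * wt o' x)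
        = \<theta> ^ n * sum (wt o') {x \<in> F. vdist E v x = n}"
      by (simp add: sum_distrib_left)
    also have "\<dots> \<le> \<theta> ^ n * sum (wt o') {x. vdist E v x = n}"
      using finite_sphere \<theta> by (intro mult_left_mono sum_mono2) (auto simp: less_imp_le[OF wt_pos])
    also have "\<dots> \<le> \<theta> ^ n * (\<Gamma> * (real (Suc n) * kap ^ n) * wt o' v)"
      unfolding \<Gamma>_def using \<theta> by (intro mult_left_mono sphere_weight) auto
    also have "\<dots> = \<Gamma> * wt o' v * (real (Suc n) * (\<theta> * kap) ^ n)"
      by (simp add: power_mult_distrib mult_ac)
    finally show "(\<Sum>x\<in>{x \<in> F. vdist E v x = n}. \<theta> ^ vdist E v x * wt o' x)
        \<le> \<Gamma> * wt o' v * (real (Suc n) * (\<theta> * kap) ^ n)" .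
  qed
  also have "\<dots> = \<Gamma> * wt o' v * (\<Sum>n\<in>N. real (Suc n) * (\<theta> * kap) ^ n)"
    by (simp add: sum_distrib_left)
  also have "\<dots> \<le> \<Gamma> * wt o' v * (1 / (1 - \<theta> * kap)\<^sup>2)"
  proof (intro mult_left_mono)
    have "(\<Sum>n\<in>N. real (Suc n) * (\<theta> * kap) ^ n) \<le> (\<Sum>n. real (Suc n) * (\<theta> * kap) ^ n)"
      using F \<theta> kap_ge1 sums by (intro sum_le_suminf) (auto simp: N_def sums_iff)
    then show "(\<Sum>n\<in>N. real (Suc n) * (\<theta> * kap) ^ n) \<le> 1 / (1 - \<theta> * kap)\<^sup>2"
      using sums by (simp add: sums_iff)
  qed (use wt_pos[of o' v] in \<open>auto simp: \<Gamma>_def\<close>)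
  finally show ?thesis by (simp add: \<Gamma>_def)
qed

text \<open>An edge is represented by its red end point, which at most \<open>dR + dB + 1\<close>
  edges share; this adds one more factor to the square in \<open>vertex_schur\<close>.\<close>

lemma edge_schur:
  assumes \<theta>: "0 \<le> \<theta>" "\<theta> * kap < 1"
  shows "schur_kernel (edges E red) (\<lambda>e e'. \<theta> ^ vdist E (fst e) (fst e')) (\<lambda>e. wt o' (fst e))
     ((real (dR + dB) + 1) ^ 3 / (1 - \<theta> * kap)\<^sup>2)"
proof
  fix e and F :: "('v \<times> 'v) set"
  assume F: "finite F" "F \<subseteq> edges E red"
  define h where "h x = \<theta> ^ vdist E (fst e) x * wt o' x" for x
  have h: "h x \<ge> 0" for x using \<theta> wt_pos[of o' x] by (simp add: h_def)
  have "(\<Sum>y\<in>F. h (fst y)) = (\<Sum>x\<in>fst ` F. \<Sum>y\<in>{y \<in> F. fst y = x}. h (fst y))"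
    using F by (intro sum.image_gen) auto
  also have "\<dots> \<le> (\<Sum>x\<in>fst ` F. (real (dR + dB) + 1) * h x)"
  proof (intro sum_mono)
    fix x
    have "{y \<in> F. fst y = x} \<subseteq> Pair x ` {b. E x b}" using F(2) by (auto simp: edges_def)
    then have "card {y \<in> F. fst y = x} \<le> card {b. E x b}"
      by (meson card_image_le card_mono finite_imageI finite_nbrs order_trans)
    then have "real (card {y \<in> F. fst y = x}) \<le> real (dR + dB) + 1"
      unfolding card_nbrs by (simp add: br_def split: if_splits)
    then have "real (card {y \<in> F. fst y = x}) * h x \<le> (real (dR + dB) + 1) * h x"
      using h by (intro mult_right_mono) auto
    then show "(\<Sum>y\<in>{y \<in> F. fst y = x}. h (fst y)) \<le> (real (dR + dB) + 1) * h x" by simp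
  qed
  also have "\<dots> = (real (dR + dB) + 1) * (\<Sum>x\<in>fst ` F. h x)"
    by (simp add: sum_distrib_left)
  also have "\<dots> \<le> (real (dR + dB) + 1) * ((real (dR + dB) + 1)\<^sup>2 / (1 - \<theta> * kap)\<^sup>2 * wt o' (fst e))"
    unfolding h_def using F vertex_schur[OF \<theta>] by (intro mult_left_mono) auto
  finally show "(\<Sum>y\<in>F. \<theta> ^ vdist E (fst e) (fst y) * wt o' (fst y))
      \<le> (real (dR + dB) + 1) ^ 3 / (1 - \<theta> * kap)\<^sup>2 * wt o' (fst e)"
    by (simp add: h_def power2_eq_square power3_eq_cube mult_ac)
qed (use \<theta> wt_pos vdist_sym in auto)

end


section \<open>Transfer matrices\<close>

lemma om_sq: "om lam * om lam = lam"
  by (simp add: om_def flip: power2_eq_square)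

lemma cosw_0 [simp]: "cosw lam 0 = 1" and sinw_0 [simp]: "sinw lam 0 = 0"
  by (simp_all add: cosw_def sinw_def)

lemma cosw_1: "cosw lam 1 = cc lam" and sinw_1: "sinw lam 1 = ss lam"
  by (simp_all add: cosw_def cc_def ss_def)

lemma om_sinw: "om lam * sinw lam y = sin (om lam * of_real y)"
  by (simp add: sinw_def)

text \<open>Valid for \<open>om lam = 0\<close> as well. Keeping later formulas polynomial in
  \<open>lam\<close>, \<open>cosw\<close> and \<open>sinw\<close> avoids a separate case
  \<open>lam = 0\<close>.\<close>

lemma lam_sinw: "lam * sinw lam y = om lam * sin (om lam * of_real y)"
  by (subst om_sq[symmetric]) (simp only: mult.assoc om_sinw)

lemma cc'_eq: "cc' lam = - lam * ss lam"
  using lam_sinw[of lam 1] by (simp add: cc'_def ss_def)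

lemma cosw_add: "cosw lam (x + y) = cosw lam x * cosw lam y - lam * sinw lam x * sinw lam y"
proof -
  have "lam * sinw lam x * sinw lam y = (om lam * sinw lam x) * (om lam * sinw lam y)"
    using om_sq[of lam] by (metis (no_types, lifting) mult.assoc mult.left_commute)
  then show ?thesis by (simp add: om_sinw cosw_def distrib_left cos_add)
qed

lemma sinw_add: "sinw lam (x + y) = sinw lam x * cosw lam y + cosw lam x * sinw lam y"
  by (auto simp: sinw_def cosw_def distrib_left sin_add field_simps)

lemma cosw_minus: "cosw lam (- y) = cosw lam y" and sinw_minus: "sinw lam (- y) = - sinw lam y"
  by (auto simp: cosw_def sinw_def)

lemma cosw_diff: "cosw lam (x - y) = cosw lam x * cosw lam y + lam * sinw lam x * sinw lam y"
  using cosw_add[of lam x "- y"] by (simp add: cosw_minus sinw_minus)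

lemma sinw_diff: "sinw lam (x - y) = sinw lam x * cosw lam y - cosw lam x * sinw lam y"
  using sinw_add[of lam x "- y"] by (simp add: cosw_minus sinw_minus)

lemma cosw_sinw_sq: "cosw lam x * cosw lam x + lam * sinw lam x * sinw lam x = 1"
  using cosw_diff[of lam x x] by simp

lemma cc_ss: "cc lam * cc lam + lam * ss lam * ss lam = 1"
  using cosw_sinw_sq[of lam 1] by (simp add: cosw_1 sinw_1)

lemma has_vector_derivative_cosw [derivative_intros]:
  "(cosw lam has_vector_derivative - lam * sinw lam y) (at y within S)"
proof -
  have "((\<lambda>z. cos (om lam * z)) has_field_derivative - lam * sinw lam y) (at (of_real y))"
    by (auto intro!: derivative_eq_intros simp: lam_sinw)
  from has_vector_derivative_real_field[OF this] show ?thesis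
    by (simp add: cosw_def[abs_def])
qed

lemma has_vector_derivative_sinw [derivative_intros]:
  "(sinw lam has_vector_derivative cosw lam y) (at y within S)"
proof (cases "om lam = 0")
  case True
  then have "sinw lam = of_real" by (auto simp: sinw_def)
  then show ?thesis using True
    by (auto simp: cosw_def intro!: derivative_eq_intros)
next
  case False
  have "((\<lambda>z. sin (om lam * z) / om lam) has_field_derivative cosw lam y) (at (of_real y))"
    using False by (auto intro!: derivative_eq_intros simp: cosw_def)
  from has_vector_derivative_real_field[OF this] False show ?thesis
    by (simp add: sinw_def[abs_def])
qed

lemma continuous_on_cosw0: "continuous_on S (cosw lam)"
  and continuous_on_sinw0: "continuous_on S (sinw lam)"
  using has_vector_derivative_cosw has_vector_derivative_sinw
  by (auto intro!: continuous_on_vector_derivative)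

lemma continuous_on_cosw [continuous_intros]:
  "continuous_on S f \<Longrightarrow> continuous_on S (\<lambda>x. cosw lam (f x))"
  by (rule continuous_on_compose2[OF continuous_on_cosw0[of UNIV]]) auto

lemma continuous_on_sinw [continuous_intros]:
  "continuous_on S f \<Longrightarrow> continuous_on S (\<lambda>x. sinw lam (f x))"
  by (rule continuous_on_compose2[OF continuous_on_sinw0[of UNIV]]) auto

lemma cosw_sinw_bounded: "\<exists>K\<ge>1. \<forall>x\<in>{-1..1}. cmod (cosw lam x) \<le> K \<and> cmod (sinw lam x) \<le> K"
proof -
  have "bounded (cosw lam ` {-1..1})" "bounded (sinw lam ` {-1..1})"
    by (auto intro!: compact_imp_bounded compact_continuous_image continuous_intros)
  then obtain K1 K2 where "\<forall>x\<in>{-1..1}. cmod (cosw lam x) \<le> K1" "\<forall>x\<in>{-1..1}. cmod (sinw lam x) \<le> K2"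
    by (auto simp: bounded_iff)
  then show ?thesis by (intro exI[of _ "max 1 (max K1 K2)"]) force
qed

section \<open>Eigenvalues of the transfer matrix\<close>

lemma is_eigenvalue_mat2:
  "is_eigenvalue (mat2 a b c d) \<mu> \<longleftrightarrow> \<mu>\<^sup>2 - (a + d) * \<mu> + (a * d - b * c) = 0"
proof -
  have ev: "is_eigenvalue (mat2 a b c d) \<mu> \<longleftrightarrow>
      (\<exists>x y. (x \<noteq> 0 \<or> y \<noteq> 0) \<and> a * x + b * y = \<mu> * x \<and> c * x + d * y = \<mu> * y)" (is "?L \<longleftrightarrow> ?R")
  proof
    assume ?L
    then obtain v where "v \<noteq> 0" "mat2 a b c d *v v = \<mu> *s v" by (auto simp: is_eigenvalue_def)
    then show ?R
      by (intro exI[of _ "v $ 1"] exI[of _ "v $ 2"])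
        (auto simp: mat2_def matrix_vector_mult_def sum_2 vec_eq_iff forall_2)
  next
    assume ?R
    then obtain x y where xy: "x \<noteq> 0 \<or> y \<noteq> 0" "a * x + b * y = \<mu> * x" "c * x + d * y = \<mu> * y" by blast
    define v :: "complex^2" where "v = (\<chi> i. if i = 1 then x else y)"
    have v: "v $ 1 = x" "v $ 2 = y" by (auto simp: v_def)
    have "v \<noteq> 0" using xy v by (auto simp: vec_eq_iff forall_2)
    moreover have "mat2 a b c d *v v = \<mu> *s v"
      using xy v by (auto simp: mat2_def matrix_vector_mult_def sum_2 vec_eq_iff forall_2)
    ultimately show ?L unfolding is_eigenvalue_def by blast
  qed
  show ?thesis unfolding ev
  proof
    assume "\<exists>x y. (x \<noteq> 0 \<or> y \<noteq> 0) \<and> a * x + b * y = \<mu> * x \<and> c * x + d * y = \<mu> * y"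
    then obtain x y where xy: "x \<noteq> 0 \<or> y \<noteq> 0" "a * x + b * y = \<mu> * x" "c * x + d * y = \<mu> * y" by blast
    have "(\<mu>\<^sup>2 - (a + d) * \<mu> + (a * d - b * c)) * x = 0" "(\<mu>\<^sup>2 - (a + d) * \<mu> + (a * d - b * c)) * y = 0"
      using xy(2,3) by algebra+
    with xy(1) show "\<mu>\<^sup>2 - (a + d) * \<mu> + (a * d - b * c) = 0" by auto
  next
    assume ch: "\<mu>\<^sup>2 - (a + d) * \<mu> + (a * d - b * c) = 0"
    \<comment> \<open>The candidates for an eigenvector are (b, \<mu> - a) and (\<mu> - d, c); both
      vanish only if the matrix is \<mu> times the identity.\<close>
    consider "b \<noteq> 0 \<or> \<mu> \<noteq> a" | "\<mu> \<noteq> d \<or> c \<noteq> 0" | "b = 0" "c = 0" "\<mu> = a" "\<mu> = d" by blast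
    then show "\<exists>x y. (x \<noteq> 0 \<or> y \<noteq> 0) \<and> a * x + b * y = \<mu> * x \<and> c * x + d * y = \<mu> * y"
    proof cases
      case 1
      then have "b \<noteq> 0 \<or> \<mu> - a \<noteq> 0" by simp
      moreover have "a * b + b * (\<mu> - a) = \<mu> * b" by (simp add: algebra_simps)
      moreover have "c * b + d * (\<mu> - a) = \<mu> * (\<mu> - a)" using ch by algebra
      ultimately show ?thesis by blast
    next
      case 2
      then have "\<mu> - d \<noteq> 0 \<or> c \<noteq> 0" by simp
      moreover have "c * (\<mu> - d) + d * c = \<mu> * c" by (simp add: algebra_simps)
      moreover have "a * (\<mu> - d) + b * c = \<mu> * (\<mu> - d)" using ch by algebra
      ultimately show ?thesis by blast
    next
      case 3
      then show ?thesis by (intro exI[of _ 1] exI[of _ 0]) auto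
    qed
  qed
qed

definition T0_trace :: "nat \<Rightarrow> nat \<Rightarrow> complex \<Rightarrow> complex" where
  "T0_trace dR dB lam = (cc lam)\<^sup>2 + ss lam * cc' lam * (1 / of_nat dB + 1 / of_nat dR)
     + (cc lam)\<^sup>2 / (of_nat dR * of_nat dB)"

text \<open>This is why one eigenvalue serves both \<open>V\<close>, which leaves the edge through
  its blue end, and \<open>U\<close>, which leaves it through the red end.\<close>

lemma T0_trace_sym: "T0_trace dR dB lam = T0_trace dB dR lam"
  by (simp add: T0_trace_def algebra_simps)

text \<open>\<open>M0\<close> has determinant 1, so the determinant of the product comes from the
  two diagonal factors alone.\<close>

lemma is_eigenvalue_T0:
  assumes "dR \<ge> 1" "dB \<ge> 1"
  shows "is_eigenvalue (T0 dR dB lam) \<mu> \<longleftrightarrow>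
    \<mu>\<^sup>2 - T0_trace dR dB lam * \<mu> + 1 / (of_nat dR * of_nat dB) = 0"
proof -
  define c s c' p q where "c = cc lam" and "s = ss lam" and "c' = cc' lam"
    and "p = 1 / (of_nat dR :: complex)" and "q = 1 / (of_nat dB :: complex)"
  have det: "c * c - s * c' = 1"
    using cc_ss[of lam] by (simp add: c_def s_def c'_def cc'_eq algebra_simps)
  have "T0 dR dB lam = mat2 (c * c + s * c' * q) (c * s + s * c * q)
      (p * (c' * c + c * c' * q)) (p * (c' * s + c * c * q))"
    by (simp add: T0_def M0_def Jd_def mat2_def matrix_matrix_mult_def sum_2 vec_eq_iff forall_2
        c_def s_def c'_def p_def q_def algebra_simps)
  moreover have "c * c + s * c' * q + p * (c' * s + c * c * q) = T0_trace dR dB lam"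
    by (simp add: T0_trace_def c_def s_def c'_def p_def q_def algebra_simps power2_eq_square)
  moreover have "(c * c + s * c' * q) * (p * (c' * s + c * c * q))
      - (c * s + s * c * q) * (p * (c' * c + c * c' * q)) = p * q * (c * c - s * c')\<^sup>2"
    by (simp add: algebra_simps power2_eq_square)
  ultimately show ?thesis
    by (simp add: is_eigenvalue_mat2 det) (simp add: p_def q_def)
qed

lemma quadratic_roots:
  fixes t d :: complex
  obtains z1 z2 where "z1 + z2 = t" "z1 * z2 = d" "\<And>z. z\<^sup>2 - t * z + d = 0 \<longleftrightarrow> z = z1 \<or> z = z2"
proof -
  define D where "D = csqrt (t\<^sup>2 - 4 * d)"
  have D: "D\<^sup>2 = t\<^sup>2 - 4 * d" by (simp add: D_def)
  define z1 z2 where "z1 = (t + D) / 2" and "z2 = (t - D) / 2"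
  have s: "z1 + z2 = t" by (simp add: z1_def z2_def field_simps)
  have "4 * (z1 * z2) = t\<^sup>2 - D\<^sup>2" by (simp add: z1_def z2_def field_simps power2_eq_square)
  then have p: "z1 * z2 = d" using D by simp
  have "z\<^sup>2 - t * z + d = (z - z1) * (z - z2)" for z
    by (simp add: algebra_simps power2_eq_square flip: s p)
  then show ?thesis using s p that by simp
qed

text \<open>The moduli of the two eigenvalues multiply to \<open>\<rho> * \<rho>\<close> and neither
  equals \<rho>, so exactly one is smaller. This makes the definite description in
  \<open>mu_minus\<close> well defined.\<close>

lemma mu_minus:
  assumes d: "dR \<ge> 1" "dB \<ge> 1" and lam: "lam \<notin> sigma1 dR dB"
  defines "\<mu> \<equiv> mu_minus dR dB lam"
  shows "\<mu>\<^sup>2 - T0_trace dR dB lam * \<mu> + 1 / (of_nat dR * of_nat dB) = 0"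
    and "cmod \<mu> < 1 / sqrt (real (dB * dR))"
proof -
  define \<delta> where "\<delta> = 1 / (of_nat dR * of_nat dB :: complex)"
  define \<rho> where "\<rho> = 1 / sqrt (real (dB * dR))"
  have \<rho>: "\<rho> > 0" using d by (simp add: \<rho>_def)
  have \<delta>\<rho>: "cmod \<delta> = \<rho> * \<rho>"
    by (simp add: \<delta>_def \<rho>_def norm_mult norm_divide real_sqrt_mult field_simps)
  obtain z1 z2 where z: "z1 + z2 = T0_trace dR dB lam" "z1 * z2 = \<delta>"
    "\<And>z. z\<^sup>2 - T0_trace dR dB lam * z + \<delta> = 0 \<longleftrightarrow> z = z1 \<or> z = z2"
    using quadratic_roots by blast
  have ev: "is_eigenvalue (T0 dR dB lam) z \<longleftrightarrow> z = z1 \<or> z = z2" for z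
    using is_eigenvalue_T0[OF d, of lam z] z(3) by (simp add: \<delta>_def)
  have ne: "cmod z1 \<noteq> \<rho>" "cmod z2 \<noteq> \<rho>"
    using lam ev unfolding sigma1_def \<rho>_def by blast+
  have prod: "cmod z1 * cmod z2 = \<rho> * \<rho>" using z(2) \<delta>\<rho> by (metis norm_mult)
  have not_both: "\<not> (cmod z1 < \<rho> \<and> cmod z2 < \<rho>)"
    using prod mult_strict_mono[of "cmod z1" \<rho> "cmod z2" \<rho>] \<rho> by auto
  have some: "cmod z1 < \<rho> \<or> cmod z2 < \<rho>"
    using prod mult_strict_mono[of \<rho> "cmod z1" \<rho> "cmod z2"] \<rho> ne by force
  have "\<exists>!z. is_eigenvalue (T0 dR dB lam) z \<and> cmod z < \<rho>"
    using not_both some ev by metis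
  from theI'[OF this] have "is_eigenvalue (T0 dR dB lam) \<mu> \<and> cmod \<mu> < \<rho>"
    by (simp add: \<mu>_def mu_minus_def \<rho>_def)
  then show "\<mu>\<^sup>2 - T0_trace dR dB lam * \<mu> + 1 / (of_nat dR * of_nat dB) = 0"
    and "cmod \<mu> < 1 / sqrt (real (dB * dR))"
    using is_eigenvalue_T0[OF d] by (auto simp: \<rho>_def)
qed

section \<open>Decay of the piecewise solutions\<close>

lemma fst_solcoef_Suc:
    "fst (solcoef lam d1 d2 a b (Suc n)) = fst (solcoef lam d1 d2 a b n) * cc lam
       + snd (solcoef lam d1 d2 a b n) * ss lam"
  and snd_solcoef_Suc:
    "snd (solcoef lam d1 d2 a b (Suc n)) = (fst (solcoef lam d1 d2 a b n) * cc' lam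
       + snd (solcoef lam d1 d2 a b n) * cc lam) / of_nat (if odd (Suc n) then d1 else d2)"
  by (simp_all add: case_prod_unfold Let_def del: of_nat_Suc)

text \<open>The initial data are \<open>k\<close> times (T12, \<mu> - T11), the eigenvector read off
  the first row of the two-step matrix T. The value component is an identity; the derivative
  component uses the characteristic equation and the unit determinant of \<open>M0\<close>.\<close>

lemma solcoef_eigen:
  assumes d: "d1 \<ge> 1" "d2 \<ge> 1"
    and ch: "\<mu>\<^sup>2 - T0_trace d1 d2 lam * \<mu> + 1 / (of_nat d1 * of_nat d2) = 0"
    and a: "a = k * (ss lam * cc lam * (1 + 1 / of_nat d1))"
    and b: "b = k * (\<mu> - (cc lam)\<^sup>2 - ss lam * cc' lam / of_nat d1)"
  shows "fst (solcoef lam d1 d2 a b (Suc (Suc n))) = \<mu> * fst (solcoef lam d1 d2 a b n)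
       \<and> snd (solcoef lam d1 d2 a b (Suc (Suc n))) = \<mu> * snd (solcoef lam d1 d2 a b n)"
proof (induction n)
  case 0
  define c s c' p q where "c = cc lam" and "s = ss lam" and "c' = cc' lam"
    and "p = 1 / (of_nat d1 :: complex)" and "q = 1 / (of_nat d2 :: complex)"
  have det: "c * c - s * c' = 1"
    using cc_ss[of lam] by (simp add: c_def s_def c'_def cc'_eq algebra_simps)
  have ch': "\<mu>\<^sup>2 - (c * c + s * c' * (p + q) + c * c * (p * q)) * \<mu> + p * q = 0"
    using ch by (simp add: T0_trace_def c_def s_def c'_def p_def q_def power2_eq_square add.commute)
  have ab: "a = k * (s * c * (1 + p))" "b = k * (\<mu> - c * c - s * c' * p)"
    using a b by (simp_all add: c_def s_def c'_def p_def power2_eq_square)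
  have "(a * c + b * s) * c + ((a * c' + b * c) * p) * s = \<mu> * a"
    unfolding ab by (simp add: algebra_simps)
  moreover have "((a * c + b * s) * c' + ((a * c' + b * c) * p) * c) * q = \<mu> * b"
    unfolding ab using ch' det by algebra
  ultimately show ?case
    by (simp add: c_def s_def c'_def p_def q_def)
next
  case (Suc n)
  show ?case
    unfolding fst_solcoef_Suc[of _ _ _ _ _ "Suc (Suc n)"] snd_solcoef_Suc[of _ _ _ _ _ "Suc (Suc n)"]
      conjunct1[OF Suc] conjunct2[OF Suc]
    unfolding fst_solcoef_Suc[of _ _ _ _ _ n] snd_solcoef_Suc[of _ _ _ _ _ n]
    by (simp add: algebra_simps)
qed

lemma solcoef_decay:
  assumes "\<mu> \<noteq> 0"
    and "\<And>n. fst (solcoef lam d1 d2 a b (Suc (Suc n))) = \<mu> * fst (solcoef lam d1 d2 a b n)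
       \<and> snd (solcoef lam d1 d2 a b (Suc (Suc n))) = \<mu> * snd (solcoef lam d1 d2 a b n)"
  shows "\<exists>K\<ge>0. \<forall>n. cmod (fst (solcoef lam d1 d2 a b n)) \<le> K * sqrt (cmod \<mu>) ^ n
      \<and> cmod (snd (solcoef lam d1 d2 a b n)) \<le> K * sqrt (cmod \<mu>) ^ n"
proof -
  define x where "x n = fst (solcoef lam d1 d2 a b n)" for n
  define y where "y n = snd (solcoef lam d1 d2 a b n)" for n
  define t where "t = sqrt (cmod \<mu>)"
  have t: "t > 0" "cmod \<mu> = t * t" using assms(1) by (simp_all add: t_def)
  have rec: "x (Suc (Suc n)) = \<mu> * x n" "y (Suc (Suc n)) = \<mu> * y n" for n
    using assms(2) by (auto simp: x_def y_def)
  \<comment> \<open>Large enough for the indices 0 and 1; the division by \<open>t\<close> is for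
    index 1, where the bound is \<open>K * t\<close>. From there two steps multiply both sides by
    \<open>t * t\<close>.\<close>
  define K where "K = cmod (x 0) + cmod (y 0) + (cmod (x 1) + cmod (y 1)) / t"
  have K: "K \<ge> 0" using t by (simp add: K_def)
  have Kt: "K * t = (cmod (x 0) + cmod (y 0)) * t + cmod (x 1) + cmod (y 1)"
    using t by (simp add: K_def field_simps)
  have "cmod (x n) \<le> K * t ^ n \<and> cmod (y n) \<le> K * t ^ n" for n
  proof (induction n rule: induct_nat_012)
    case 0
    then show ?case using t by (simp add: K_def)
  next
    case 1
    have "0 \<le> (cmod (x 0) + cmod (y 0)) * t" using t by simp
    then show ?case using Kt norm_ge_zero[of "x 1"] norm_ge_zero[of "y 1"]
      by simp
  next
    case (ge2 n)
    have "t * t * cmod (x n) \<le> t * t * (K * t ^ n)" "t * t * cmod (y n) \<le> t * t * (K * t ^ n)"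
      using ge2 t by (auto intro!: mult_left_mono)
    then show ?case by (simp add: rec norm_mult t(2) mult_ac)
  qed
  then show ?thesis using K by (auto simp: x_def y_def t_def)
qed

text \<open>Includes \<open>s = 1\<close>, where the floor in \<open>sol\<close> already selects the
  next piece; the value coefficient of that piece is the end value of the previous one.\<close>

lemma sol_at:
  assumes "0 \<le> s" "s \<le> 1"
  shows "sol lam d1 d2 a b (real n + s) = fst (solcoef lam d1 d2 a b n) * cosw lam s
     + snd (solcoef lam d1 d2 a b n) * sinw lam s"
proof (cases "s = 1")
  case True
  have "nat \<lfloor>real n + 1\<rfloor> = Suc n" by linarith
  then show ?thesis using True
    by (simp add: sol_def case_prod_unfold Let_def cosw_1 sinw_1)
next
  case False
  with assms have "nat \<lfloor>real n + s\<rfloor> = n" by linarith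
  then show ?thesis by (simp add: sol_def case_prod_unfold Let_def)
qed

section \<open>The coefficients of \<open>V\<close> and \<open>U\<close> and their Wronskian\<close>

locale spectral =
  fixes dR dB :: nat and lam :: complex
  assumes dR1: "dR \<ge> 1" and dB1: "dB \<ge> 1"
    and lam: "lam \<notin> sigma1 dR dB \<union> sigma2 dR dB"
begin

definition mu :: complex where "mu = mu_minus dR dB lam"
definition aV :: complex where "aV = ss lam * cc lam * (1 + 1 / of_nat dB)"
definition bV :: complex where "bV = mu - (cc lam)\<^sup>2 - ss lam * cc' lam / of_nat dB"
definition aU :: complex where "aU = - ss lam * cc lam * (1 + 1 / of_nat dR)"
definition bU :: complex where "bU = - (mu - (cc lam)\<^sup>2 - ss lam * cc' lam / of_nat dR)"
definition VA :: "nat \<Rightarrow> complex" where "VA n = fst (solcoef lam dB dR aV bV n)"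
definition VB :: "nat \<Rightarrow> complex" where "VB n = snd (solcoef lam dB dR aV bV n)"
text \<open>\<open>U\<close> is expanded in the variable \<open>1 - x\<close>, so \<open>UB\<close>
  is a derivative in the direction away from the base edge, as \<open>VB\<close> is for
  \<open>V\<close>.\<close>

definition UA :: "nat \<Rightarrow> complex" where "UA n = fst (solcoef lam dR dB aU bU n)"
definition UB :: "nat \<Rightarrow> complex" where "UB n = snd (solcoef lam dR dB aU bU n)"
definition W :: complex where "W = Wr dR dB lam"
definition theta :: real where "theta = sqrt (cmod mu)"

lemma mu_char: "mu\<^sup>2 - T0_trace dR dB lam * mu + 1 / (of_nat dR * of_nat dB) = 0"
  and mu_less: "cmod mu < 1 / sqrt (real (dB * dR))"
  using mu_minus[OF dR1 dB1] lam by (auto simp: mu_def)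

lemma mu_char': "mu\<^sup>2 - T0_trace dB dR lam * mu + 1 / (of_nat dB * of_nat dR) = 0"
  using mu_char by (simp add: T0_trace_sym mult.commute)

lemma mu_nz: "mu \<noteq> 0"
  using mu_char dR1 dB1 by auto

lemma theta_pos: "theta > 0"
  using mu_nz by (simp add: theta_def)

text \<open>The exclusion of \<open>sigma1\<close> in the form that the Schur test asks for.\<close>

lemma theta_small: "theta * sqrt (sqrt (real (dR * dB))) < 1"
proof -
  have "sqrt (real (dB * dR)) > 0" using dR1 dB1 by simp
  then have "cmod mu * sqrt (real (dR * dB)) < 1"
    using mu_less by (simp add: field_simps mult.commute)
  then have "sqrt (cmod mu * sqrt (real (dR * dB))) < sqrt 1" by (simp only: real_sqrt_less_iff)
  then show ?thesis by (simp add: theta_def real_sqrt_mult)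
qed

lemma V_two_step: "VA (Suc (Suc n)) = mu * VA n \<and> VB (Suc (Suc n)) = mu * VB n"
  unfolding VA_def VB_def
  by (rule solcoef_eigen[OF dB1 dR1 mu_char', where k = 1]) (simp_all add: aV_def bV_def)

lemma U_two_step: "UA (Suc (Suc n)) = mu * UA n \<and> UB (Suc (Suc n)) = mu * UB n"
  unfolding UA_def UB_def
  by (rule solcoef_eigen[OF dR1 dB1 mu_char, where k = "-1"]) (simp_all add: aU_def bU_def)

lemma coef_decay:
  "\<exists>K\<ge>0. \<forall>n. cmod (VA n) \<le> K * theta ^ n \<and> cmod (VB n) \<le> K * theta ^ n
      \<and> cmod (UA n) \<le> K * theta ^ n \<and> cmod (UB n) \<le> K * theta ^ n"
proof -
  obtain K where K: "K \<ge> 0" "\<And>n. cmod (VA n) \<le> K * theta ^ n \<and> cmod (VB n) \<le> K * theta ^ n"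
    using solcoef_decay[OF mu_nz V_two_step[unfolded VA_def VB_def]]
    unfolding VA_def VB_def theta_def by blast
  obtain L where L: "L \<ge> 0" "\<And>n. cmod (UA n) \<le> L * theta ^ n \<and> cmod (UB n) \<le> L * theta ^ n"
    using solcoef_decay[OF mu_nz U_two_step[unfolded UA_def UB_def]]
    unfolding UA_def UB_def theta_def by blast
  have "K * theta ^ n \<le> (K + L) * theta ^ n" "L * theta ^ n \<le> (K + L) * theta ^ n" for n
    using K L theta_pos by (auto intro!: mult_right_mono)
  then show ?thesis using K L by (intro exI[of _ "K + L"]) (meson add_nonneg_nonneg order_trans)
qed

lemma Vf_at: "0 \<le> s \<Longrightarrow> s \<le> 1 \<Longrightarrow> Vf dR dB lam (real n + s) = VA n * cosw lam s + VB n * sinw lam s"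
  using sol_at[of s lam dB dR aV bV n] by (simp add: Vf_def VA_def VB_def aV_def bV_def mu_def)

lemma Uf_at: "0 \<le> s \<Longrightarrow> s \<le> 1 \<Longrightarrow> Uf dR dB lam (1 - (real n + s)) = UA n * cosw lam s + UB n * sinw lam s"
  using sol_at[of s lam dR dB aU bU n] by (simp add: Uf_def UA_def UB_def aU_def bU_def mu_def)

lemma V0: "VA 0 = aV" "VB 0 = bV" and U0: "UA 0 = aU" "UB 0 = bU"
  by (simp_all add: VA_def VB_def UA_def UB_def)

text \<open>The jump conditions are multiplied out: branching number times outgoing derivative
  equals incoming derivative, the form in which they enter the Kirchhoff condition.\<close>

lemma VA_Suc: "VA (Suc n) = VA n * cc lam + VB n * ss lam"
  and VB_Suc: "of_nat (if odd (Suc n) then dB else dR) * VB (Suc n) = VB n * cc lam - lam * VA n * ss lam"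
  and UA_Suc: "UA (Suc n) = UA n * cc lam + UB n * ss lam"
  and UB_Suc: "of_nat (if odd (Suc n) then dR else dB) * UB (Suc n) = UB n * cc lam - lam * UA n * ss lam"
  using dR1 dB1
  unfolding VA_def VB_def UA_def UB_def fst_solcoef_Suc snd_solcoef_Suc
  by (simp_all add: cc'_eq)

lemma Vf_01: "x \<in> {0..1} \<Longrightarrow> Vf dR dB lam x = aV * cosw lam x + bV * sinw lam x"
  using Vf_at[of x 0] by (simp add: V0)

text \<open>On the base edge, U is expanded at x = 0 rather than at x = 1.\<close>

definition U0v :: complex where "U0v = aU * cc lam + bU * ss lam"
definition U0d :: complex where "U0d = lam * aU * ss lam - bU * cc lam"

lemma Uf_01: "x \<in> {0..1} \<Longrightarrow> Uf dR dB lam x = U0v * cosw lam x + U0d * sinw lam x"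
  using Uf_at[of "1 - x" 0]
  by (simp add: U0 U0v_def U0d_def cosw_diff sinw_diff cosw_1 sinw_1 algebra_simps)

text \<open>The Wronskian at 1/2 is moved to 0, where the coefficients are the Cauchy data;
  \<open>cosw_sinw_sq\<close> removes the dependence on the point.\<close>

lemma W_eq: "W = U0v * bV - U0d * aV"
proof -
  have V: "(Vf dR dB lam has_vector_derivative - lam * aV * sinw lam (1/2) + bV * cosw lam (1/2)) (at (1/2))"
  proof (rule has_vector_derivative_transform_within_open)
    show "((\<lambda>x. aV * cosw lam x + bV * sinw lam x) has_vector_derivative
        - lam * aV * sinw lam (1/2) + bV * cosw lam (1/2)) (at (1/2))"
      by (auto intro!: derivative_eq_intros simp: algebra_simps)
    show "open {0<..<1::real}" "1/2 \<in> {0<..<1::real}" by auto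
    show "\<And>x. x \<in> {0<..<1} \<Longrightarrow> aV * cosw lam x + bV * sinw lam x = Vf dR dB lam x"
      by (simp add: Vf_01)
  qed
  have U: "(Uf dR dB lam has_vector_derivative - lam * U0v * sinw lam (1/2) + U0d * cosw lam (1/2)) (at (1/2))"
  proof (rule has_vector_derivative_transform_within_open)
    show "((\<lambda>x. U0v * cosw lam x + U0d * sinw lam x) has_vector_derivative
        - lam * U0v * sinw lam (1/2) + U0d * cosw lam (1/2)) (at (1/2))"
      by (auto intro!: derivative_eq_intros simp: algebra_simps)
    show "open {0<..<1::real}" "1/2 \<in> {0<..<1::real}" by auto
    show "\<And>x. x \<in> {0<..<1} \<Longrightarrow> U0v * cosw lam x + U0d * sinw lam x = Uf dR dB lam x"
      by (simp add: Uf_01)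
  qed
  define c s where "c = cosw lam (1/2)" and "s = sinw lam (1/2)"
  have "c * c + lam * s * s = 1" using cosw_sinw_sq by (simp add: c_def s_def)
  moreover have "W = (U0v * c + U0d * s) * (- lam * aV * s + bV * c)
      - (- lam * U0v * s + U0d * c) * (aV * c + bV * s)"
    using V U by (simp add: W_def Wr_def vector_derivative_at Vf_01 Uf_01 c_def s_def)
  ultimately show ?thesis by algebra
qed

lemma W_nz: "W \<noteq> 0"
  using lam by (auto simp: W_def sigma2_def)

text \<open>For fixed \<open>t\<close> both sides solve the homogeneous equation in
  \<open>x\<close>, vanish at \<open>x = t\<close> and have slope \<open>W\<close> there. The
  difference between the two branches of the kernel is thus Duhamel's kernel.\<close>

lemma UV_sinw:
  assumes "x \<in> {0..1}" "t \<in> {0..1}"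
  shows "Vf dR dB lam x * Uf dR dB lam t - Uf dR dB lam x * Vf dR dB lam t = W * sinw lam (x - t)"
  using assms by (simp add: Vf_01 Uf_01 W_eq sinw_diff algebra_simps)

end


section \<open>The inhomogeneous equation on an edge\<close>

lemma set_borel_measurable_mult:
  fixes f g :: "real \<Rightarrow> complex"
  assumes "set_borel_measurable lborel S f" "set_borel_measurable lborel S g"
  shows "set_borel_measurable lborel S (\<lambda>t. f t * g t)"
proof -
  have "(\<lambda>t. (indicator S t *\<^sub>R f t) * (indicator S t *\<^sub>R g t)) \<in> borel_measurable lborel"
    using assms unfolding set_borel_measurable_def by (intro borel_measurable_times)
  moreover have "(\<lambda>t. (indicator S t *\<^sub>R f t) * (indicator S t *\<^sub>R g t)) = (\<lambda>t. indicator S t *\<^sub>R (f t * g t))"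
    by (auto simp: indicator_def)
  ultimately show ?thesis by (simp add: set_borel_measurable_def)
qed

lemma set_borel_measurable_Icc:
  fixes f :: "real \<Rightarrow> complex"
  assumes "continuous_on {a..b} f"
  shows "set_borel_measurable lborel {a..b} f"
proof -
  have "(\<lambda>x. indicator {a..b} x *\<^sub>R f x) \<in> borel_measurable borel"
    using assms by (intro borel_measurable_continuous_on_indicator) auto
  then show ?thesis by (simp add: set_borel_measurable_def)
qed

lemma set_integrable_cont_mult:
  fixes k f :: "real \<Rightarrow> complex"
  assumes k: "continuous_on {a..b} k" and f: "set_integrable lborel {a..b} f"
  shows "set_integrable lborel {a..b} (\<lambda>t. k t * f t)"
proof -
  have "bounded (k ` {a..b})" using k by (intro compact_imp_bounded compact_continuous_image) auto
  then obtain B where B: "\<And>t. t \<in> {a..b} \<Longrightarrow> cmod (k t) \<le> B" unfolding bounded_iff by blast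
  have "set_integrable lborel {a..b} (\<lambda>t. of_real B * f t)" using f by simp
  moreover have "set_borel_measurable lborel {a..b} f"
    using f by (auto simp: set_integrable_def set_borel_measurable_def)
  ultimately show ?thesis
  proof (rule set_integrable_bound[OF _ set_borel_measurable_mult[OF set_borel_measurable_Icc[OF k]]])
    have "cmod (k t * f t) \<le> cmod (of_real B * f t)" if "t \<in> {a..b}" for t
      using B[OF that] by (simp add: norm_mult mult_right_mono order_trans[OF _ abs_ge_self])
    then show "AE t in lborel. t \<in> {a..b} \<longrightarrow> cmod (k t * f t) \<le> cmod (of_real B * f t)" by simp
  qed
qed

lemma continuous_on_indefinite:
  fixes h :: "real \<Rightarrow> complex"
  assumes "set_integrable lborel {0..1} h"
  shows "continuous_on {0..1} (\<lambda>x. LINT t:{0..x}|lborel. h t)"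
proof -
  have "continuous_on {0..1} (\<lambda>x. integral {0..x} h)"
    using set_borel_integral_eq_integral(1)[OF assms] by (rule indefinite_integral_continuous_1)
  then show ?thesis
  proof (rule continuous_on_eq)
    fix x :: real assume x: "x \<in> {0..1}"
    have "set_integrable lborel {0..x} h" by (rule set_integrable_subset[OF assms]) (use x in auto)
    from set_borel_integral_eq_integral(2)[OF this]
    show "integral {0..x} h = (LINT t:{0..x}|lborel. h t)" by simp
  qed
qed

lemma LINT_Icc_self: "(LINT t:{a..a::real}|lborel. h t) = (0 :: complex)"
proof -
  have "AE t in lborel. indicator {a..a} t *\<^sub>R h t = 0"
    using AE_lborel_singleton[of a] by eventually_elim auto
  then show ?thesis unfolding set_lebesgue_integral_def by (rule integral_eq_zero_AE)
qed

lemma set_integral_norm_bound':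
  fixes f :: "real \<Rightarrow> complex"
  assumes "\<And>t. t \<in> S \<Longrightarrow> cmod (f t) \<le> g t" "set_integrable lborel S g"
  shows "cmod (LINT t:S|lborel. f t) \<le> (LINT t:S|lborel. g t)"
proof -
  have "cmod (LINT t:S|lborel. f t) \<le> (LINT t|lborel. norm (indicator S t *\<^sub>R f t))"
    unfolding set_lebesgue_integral_def by (rule integral_norm_bound)
  also have "\<dots> \<le> (LINT t:S|lborel. g t)"
    unfolding set_lebesgue_integral_def
    using assms order_trans[OF norm_ge_zero assms(1)]
    by (intro integral_mono') (auto simp: set_integrable_def indicator_def)
  finally show ?thesis .
qed

text \<open>Fubini on the triangle \<open>0 \<le> t \<le> y \<le> x\<close>, where integrating
  \<open>k\<close> in \<open>y\<close> gives \<open>K\<close>. As \<open>f\<close> is merely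
  integrable, this replaces differentiation under the integral; \<open>K\<close> will be
  \<open>sinw\<close> and \<open>cosw - 1\<close>.\<close>

lemma convolution_integral:
  fixes k K f :: "real \<Rightarrow> complex"
  assumes k: "continuous_on UNIV k" and dK: "\<And>z. (K has_vector_derivative k z) (at z)"
    and K0: "K 0 = 0" and f: "set_integrable lborel {0..1} f" and x: "x \<in> {0..1}"
  shows "(LINT t:{0..x}|lborel. K (x - t) * f t)
    = (LINT y:{0..x}|lborel. LINT t:{0..y}|lborel. k (y - t) * f t)"
proof -
  define f' where "f' t = indicator {0..1::real} t *\<^sub>R f t" for t
  have f': "integrable lborel f'" using f by (simp add: f'_def[abs_def] set_integrable_def)
  then have [measurable]: "f' \<in> borel_measurable borel" by auto
  have [measurable]: "k \<in> borel_measurable borel" using k by (rule borel_measurable_continuous_onI)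
  define H where "H t y = (if 0 \<le> t \<and> t \<le> y \<and> y \<le> x then k (y - t) * f' t else 0)" for t y
  have "bounded (k ` {0..1})"
    using k by (intro compact_imp_bounded compact_continuous_image) (auto intro: continuous_on_subset)
  then obtain B where B: "\<And>t. t \<in> {0..1} \<Longrightarrow> cmod (k t) \<le> B" unfolding bounded_iff by blast
  have B0: "B \<ge> 0" using order_trans[OF norm_ge_zero B[of 0]] by simp
  \<comment> \<open>A product of integrable functions of \<open>y\<close> and of \<open>t\<close>,
    from which integrability on the plane follows.\<close>
  have H_le: "cmod (H t y) \<le> indicator {0..1} y * (B * cmod (f' t))" for t y
    using x B[of "y - t"] B0 by (auto simp: H_def norm_mult intro!: mult_right_mono)
  have [measurable]: "case_prod H \<in> borel_measurable (lborel \<Otimes>\<^sub>M lborel)"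
    unfolding H_def[abs_def] by measurable
  have ind: "integrable lborel (\<lambda>y. indicator {0..1::real} y * (B * cmod (f' t)))" for t
    by (intro integrable_mult_left integrable_real_indicator) auto
  have "integrable (lborel \<Otimes>\<^sub>M lborel) (case_prod H)"
  proof (rule lborel_pair.Fubini_integrable)
    have "cmod (f' t) * B \<ge> (LINT y|lborel. cmod (H t y))" for t
    proof -
      have "(LINT y|lborel. cmod (H t y)) \<le> (LINT y|lborel. indicator {0..1::real} y * (B * cmod (f' t)))"
        using ind H_le B0 by (intro integral_mono') auto
      then show ?thesis by (simp add: mult_ac)
    qed
    then have le: "norm (LINT y|lborel. cmod (H t y)) \<le> norm (cmod (f' t) * B)" for t
      by (simp add: order_trans[OF _ abs_ge_self])
    have "(\<lambda>t. LINT y|lborel. cmod (H t y)) \<in> borel_measurable lborel" by measurable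
    then have "integrable lborel (\<lambda>t. LINT y|lborel. cmod (H t y))"
      by (rule Bochner_Integration.integrable_bound[OF integrable_mult_left[where c = B, OF integrable_norm[OF f']]])
        (use le in simp)
    then show "integrable lborel (\<lambda>t. LINT y|lborel. norm (case (t, y) of (t, y) \<Rightarrow> H t y))" by simp
    have "integrable lborel (H t)" for t
      using H_le B0 by (intro Bochner_Integration.integrable_bound[OF ind[of t]]) (auto simp: abs_mult)
    then show "AE t in lborel. integrable lborel (\<lambda>y. case (t, y) of (t, y) \<Rightarrow> H t y)" by simp
  qed simp
  then have F: "(LINT y|lborel. LINT t|lborel. H t y) = (LINT t|lborel. LINT y|lborel. H t y)"
    by (rule lborel_pair.Fubini_integral)
  have "(LINT t|lborel. H t y) = indicator {0..x} y *\<^sub>R (LINT t:{0..y}|lborel. k (y - t) * f t)" for y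
  proof (cases "y \<in> {0..x}")
    case True
    then have "H t y = indicator {0..y} t *\<^sub>R (k (y - t) * f t)" for t
      using x by (auto simp: H_def f'_def)
    then show ?thesis using True by (simp add: set_lebesgue_integral_def)
  next
    case False
    then have "H t y = 0" for t by (auto simp: H_def)
    then show ?thesis using False by simp
  qed
  moreover have "(LINT y|lborel. H t y) = indicator {0..x} t *\<^sub>R (K (x - t) * f t)" for t
  proof (cases "t \<in> {0..x}")
    case True
    then have "H t y = (indicator {t..x} y *\<^sub>R k (y - t)) * f t" for y
      using x by (auto simp: H_def f'_def)
    then have "(LINT y|lborel. H t y) = (LINT y|lborel. indicator {t..x} y *\<^sub>R k (y - t)) * f t"
      by (simp only: integral_mult_left_zero)
    also have "(LINT y|lborel. indicator {t..x} y *\<^sub>R k (y - t)) = K (x - t) - K (t - t)"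
    proof (rule integral_FTC_Icc)
      fix y
      have "((\<lambda>y. y - t) has_vector_derivative 1) (at y)" by (auto intro!: derivative_eq_intros)
      from vector_diff_chain_at[OF this dK]
      show "((\<lambda>y. K (y - t)) has_vector_derivative k (y - t)) (at y within {t..x})"
        by (simp add: o_def has_vector_derivative_at_within)
      show "continuous_on {t..x} (\<lambda>y. k (y - t))"
        by (rule continuous_on_compose2[OF k, of _ "\<lambda>y. y - t"]) (auto intro: continuous_intros)
    qed (use True in simp)
    finally show ?thesis using True K0 by simp
  next
    case False
    then have "H t y = 0" for y by (auto simp: H_def)
    then show ?thesis using False by simp
  qed
  ultimately show ?thesis using F by (simp add: set_lebesgue_integral_def)
qed

text \<open>Duhamel's formula: minus \<open>Pf lam f\<close> is the solution of the inhomogeneous equation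
  with zero Cauchy data at 0, and \<open>Qf lam f\<close> is the derivative of \<open>Pf lam f\<close>.\<close>

definition Pf :: "complex \<Rightarrow> (real \<Rightarrow> complex) \<Rightarrow> real \<Rightarrow> complex" where
  "Pf lam f x = (LINT t:{0..x}|lborel. sinw lam (x - t) * f t)"

definition Qf :: "complex \<Rightarrow> (real \<Rightarrow> complex) \<Rightarrow> real \<Rightarrow> complex" where
  "Qf lam f x = (LINT t:{0..x}|lborel. cosw lam (x - t) * f t)"

context
  fixes f :: "real \<Rightarrow> complex"
  assumes f: "set_integrable lborel {0..1} f"
begin

lemma set_integrable_cont_mult_sub:
  assumes k: "continuous_on UNIV k" and x: "x \<in> {0..1}"
  shows "set_integrable lborel {0..x} (\<lambda>t. k t * f t)"
proof (rule set_integrable_cont_mult)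
  show "continuous_on {0..x} k" using k continuous_on_subset by blast
  show "set_integrable lborel {0..x} f" by (rule set_integrable_subset[OF f]) (use x in auto)
qed

text \<open>The addition theorem takes \<open>x\<close> out of the integrand and leaves indefinite
  integrals of fixed integrable functions.\<close>

lemma continuous_on_Qf: "continuous_on {0..1} (Qf lam f)"
proof -
  have "Qf lam f x = cosw lam x * (LINT t:{0..x}|lborel. cosw lam t * f t)
      + lam * sinw lam x * (LINT t:{0..x}|lborel. sinw lam t * f t)" if "x \<in> {0..1}" for x
  proof -
    have "Qf lam f x = (LINT t:{0..x}|lborel. cosw lam x * (cosw lam t * f t) + lam * sinw lam x * (sinw lam t * f t))"
      unfolding Qf_def by (simp add: cosw_diff algebra_simps)
    also have "\<dots> = (LINT t:{0..x}|lborel. cosw lam x * (cosw lam t * f t)) + (LINT t:{0..x}|lborel. lam * sinw lam x * (sinw lam t * f t))"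
      using that by (intro set_integral_add set_integrable_mult_right set_integrable_cont_mult_sub continuous_intros) auto
    finally show ?thesis by simp
  qed
  note eq = this
  have "continuous_on {0..1} (\<lambda>x. cosw lam x * (LINT t:{0..x}|lborel. cosw lam t * f t)
      + lam * sinw lam x * (LINT t:{0..x}|lborel. sinw lam t * f t))"
    by (intro continuous_intros continuous_on_indefinite set_integrable_cont_mult f)
  then show ?thesis by (rule continuous_on_eq) (simp add: eq)
qed

lemma Pf_eq_integral: "x \<in> {0..1} \<Longrightarrow> Pf lam f x = (LINT t:{0..x}|lborel. Qf lam f t)"
  unfolding Pf_def Qf_def
  by (rule convolution_integral[OF continuous_on_cosw0 has_vector_derivative_sinw sinw_0 f])

text \<open>\<open>Qf\<close> is continuous, so its primitive is differentiable at every point and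
  not just almost everywhere.\<close>

lemma Pf_has_derivative:
  assumes "x \<in> {0..1}"
  shows "(Pf lam f has_vector_derivative Qf lam f x) (at x within {0..1})"
proof -
  have "((\<lambda>u. integral {0..u} (Qf lam f)) has_vector_derivative Qf lam f x) (at x within {0..1})"
    using continuous_on_Qf assms by (rule integral_has_vector_derivative)
  moreover have "integral {0..u} (Qf lam f) = Pf lam f u" if "u \<in> {0..1}" for u
  proof -
    have "continuous_on {0..u} (Qf lam f)"
      using that by (intro continuous_on_subset[OF continuous_on_Qf]) auto
    then have "set_integrable lborel {0..u} (Qf lam f)" by (rule borel_integrable_atLeastAtMost')
    from set_borel_integral_eq_integral(2)[OF this] show ?thesis
      using Pf_eq_integral[OF that] by simp
  qed
  ultimately show ?thesis
    by (intro has_vector_derivative_transform[OF assms, of "Pf lam f"]) simp_all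
qed

lemma continuous_on_Pf: "continuous_on {0..1} (Pf lam f)"
  by (rule continuous_on_vector_derivative[OF Pf_has_derivative])

lemma Qf_eq_integral:
  assumes "x \<in> {0..1}"
  shows "Qf lam f x = (LINT t:{0..x}|lborel. f t - lam * Pf lam f t)"
proof -
  have i1: "set_integrable lborel {0..x} f" using assms by (intro set_integrable_subset[OF f]) auto
  have i2: "set_integrable lborel {0..x} (\<lambda>t. cosw lam (x - t) * f t)"
    using assms by (intro set_integrable_cont_mult_sub continuous_intros)
  have i3: "set_integrable lborel {0..x} (Pf lam f)"
    using assms by (intro borel_integrable_atLeastAtMost' continuous_on_subset[OF continuous_on_Pf]) auto
  \<comment> \<open>Subtracting 1 makes the kernel vanish at 0, as
    \<open>convolution_integral\<close> demands, and splits off the integral of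
    \<open>f\<close>.\<close>
  have "(LINT t:{0..x}|lborel. (cosw lam (x - t) - 1) * f t)
      = (LINT y:{0..x}|lborel. LINT t:{0..y}|lborel. (- lam * sinw lam (y - t)) * f t)"
  proof (rule convolution_integral[where K = "\<lambda>z. cosw lam z - 1" and k = "\<lambda>z. - lam * sinw lam z", OF _ _ _ f assms])
    show "continuous_on UNIV (\<lambda>z. - lam * sinw lam z)" by (intro continuous_intros)
    show "((\<lambda>z. cosw lam z - 1) has_vector_derivative - lam * sinw lam z) (at z)" for z
      using has_vector_derivative_diff[OF has_vector_derivative_cosw[of lam z UNIV] has_vector_derivative_const[of 1]]
      by simp
  qed simp
  also have "\<dots> = (LINT y:{0..x}|lborel. - lam * Pf lam f y)"
    by (simp only: Pf_def mult.assoc set_integral_mult_right)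
  also have "\<dots> = - lam * (LINT y:{0..x}|lborel. Pf lam f y)" by (rule set_integral_mult_right)
  finally have "(LINT t:{0..x}|lborel. (cosw lam (x - t) - 1) * f t) = - lam * (LINT y:{0..x}|lborel. Pf lam f y)" .
  moreover have "(LINT t:{0..x}|lborel. (cosw lam (x - t) - 1) * f t) = Qf lam f x - (LINT t:{0..x}|lborel. f t)"
    using set_integral_diff(2)[OF i2 i1] by (simp add: Qf_def algebra_simps)
  moreover have "(LINT t:{0..x}|lborel. f t - lam * Pf lam f t) = (LINT t:{0..x}|lborel. f t) - lam * (LINT t:{0..x}|lborel. Pf lam f t)"
    using set_integral_diff(2)[OF i1 set_integrable_mult_right[of lam, OF i3]] by simp
  ultimately show ?thesis by (simp add: algebra_simps)
qed

lemma Pf_bound: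
  assumes K: "\<And>z. z \<in> {-1..1} \<Longrightarrow> cmod (sinw lam z) \<le> K" and x: "x \<in> {0..1}"
  shows "cmod (Pf lam f x) \<le> K * (LINT t:{0..1}|lborel. cmod (f t))"
proof -
  have K0: "K \<ge> 0" using K[of 0] by simp
  have n: "set_integrable lborel {0..1} (\<lambda>t. K * cmod (f t))"
    using integrable_norm[OF f[unfolded set_integrable_def]]
    by (intro set_integrable_mult_right) (simp add: set_integrable_def)
  have "cmod (Pf lam f x) \<le> (LINT t:{0..x}|lborel. K * cmod (f t))"
    unfolding Pf_def using x K
    by (intro set_integral_norm_bound' set_integrable_subset[OF n]) (auto simp: norm_mult intro!: mult_right_mono)
  also have "\<dots> \<le> (LINT t:{0..1}|lborel. K * cmod (f t))"
    unfolding set_lebesgue_integral_def using n K0 x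
    by (intro integral_mono') (auto simp: set_integrable_def indicator_def)
  finally show ?thesis by simp
qed

end


text \<open>The interval has length 1, so \<open>x \<le> 1 + x\<^sup>2\<close> gives integrability
  and the mean of the modulus is at most its root mean square.\<close>

lemma L2_imp_L1:
  fixes f :: "real \<Rightarrow> complex"
  assumes m: "set_borel_measurable lborel {0..1} f"
    and fin: "(\<integral>\<^sup>+ t. ennreal ((cmod (f t))\<^sup>2) * indicator {0..1} t \<partial>lborel) < \<infinity>"
  shows "set_integrable lborel {0..1} f"
    and "set_integrable lborel {0..1} (\<lambda>t. cmod (f t))"
    and "set_integrable lborel {0..1} (\<lambda>t. (cmod (f t))\<^sup>2)"
    and "(\<integral>\<^sup>+ t. ennreal ((cmod (f t))\<^sup>2) * indicator {0..1} t \<partial>lborel)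
       = ennreal (LINT t:{0..1}|lborel. (cmod (f t))\<^sup>2)"
    and "(LINT t:{0..1}|lborel. cmod (f t)) \<le> sqrt (LINT t:{0..1}|lborel. (cmod (f t))\<^sup>2)"
proof -
  let ?I = "indicator {0..1::real} :: real \<Rightarrow> real"
  have m': "(\<lambda>t. ?I t *\<^sub>R f t) \<in> borel_measurable lborel"
    using m by (simp add: set_borel_measurable_def)
  have n1: "(\<lambda>t. cmod (?I t *\<^sub>R f t)) = (\<lambda>t. ?I t *\<^sub>R cmod (f t))"
    and n2: "(\<lambda>t. (cmod (?I t *\<^sub>R f t))\<^sup>2) = (\<lambda>t. ?I t *\<^sub>R (cmod (f t))\<^sup>2)"
    by (auto simp: indicator_def)
  have m1: "(\<lambda>t. ?I t *\<^sub>R cmod (f t)) \<in> borel_measurable lborel"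
    using measurable_compose[OF m' borel_measurable_norm] unfolding n1 .
  have m2: "(\<lambda>t. ?I t *\<^sub>R (cmod (f t))\<^sup>2) \<in> borel_measurable lborel"
    using borel_measurable_power[OF measurable_compose[OF m' borel_measurable_norm], of 2] unfolding n2 .
  have nn: "(\<integral>\<^sup>+ t. ennreal ((cmod (f t))\<^sup>2) * indicator {0..1} t \<partial>lborel)
      = (\<integral>\<^sup>+ t. ennreal (?I t *\<^sub>R (cmod (f t))\<^sup>2) \<partial>lborel)"
    by (intro nn_integral_cong) (auto simp: indicator_def)
  have i2: "integrable lborel (\<lambda>t. ?I t *\<^sub>R (cmod (f t))\<^sup>2)"
    using m2 fin nn by (intro integrableI_nonneg) auto
  then show s2: "set_integrable lborel {0..1} (\<lambda>t. (cmod (f t))\<^sup>2)" by (simp add: set_integrable_def)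
  show "(\<integral>\<^sup>+ t. ennreal ((cmod (f t))\<^sup>2) * indicator {0..1} t \<partial>lborel)
       = ennreal (LINT t:{0..1}|lborel. (cmod (f t))\<^sup>2)"
    unfolding nn set_lebesgue_integral_def using i2 by (intro nn_integral_eq_integral) auto
  have one: "set_integrable lborel {0..1::real} (\<lambda>t. c)" for c :: real
    by (intro borel_integrable_atLeastAtMost') auto
  have "x \<le> 1 + x\<^sup>2" for x :: real
    using zero_le_power2[of "x - 1/2"] by (simp add: power2_eq_square algebra_simps)
  then have "integrable lborel (\<lambda>t. ?I t *\<^sub>R f t)"
    using m' i2 one[of 1]
    by (intro Bochner_Integration.integrable_bound[OF
          Bochner_Integration.integrable_add[OF one[of 1, unfolded set_integrable_def] i2]])
      (auto simp: indicator_def)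
  then show "set_integrable lborel {0..1} f" by (simp add: set_integrable_def)
  then have "integrable lborel (\<lambda>t. ?I t *\<^sub>R cmod (f t))"
    unfolding set_integrable_def n1[symmetric] by (rule integrable_norm)
  then show s1: "set_integrable lborel {0..1} (\<lambda>t. cmod (f t))" by (simp add: set_integrable_def)
  \<comment> \<open>The mean: the inequality is the nonnegativity of the variance.\<close>
  define m where "m = (LINT t:{0..1}|lborel. cmod (f t))"
  have "0 \<le> (LINT t:{0..1}|lborel. (cmod (f t) - m)\<^sup>2)"
    by (simp add: set_lebesgue_integral_def)
  also have "\<dots> = (LINT t:{0..1}|lborel. ((cmod (f t))\<^sup>2 - 2 * m * cmod (f t)) + m\<^sup>2)"
    by (simp add: power2_diff algebra_simps)
  also have "\<dots> = (LINT t:{0..1}|lborel. (cmod (f t))\<^sup>2 - 2 * m * cmod (f t)) + (LINT t:{0..1::real}|lborel. m\<^sup>2)"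
    using s1 s2 one by (intro set_integral_add set_integral_diff set_integrable_mult_right)
  also have "(LINT t:{0..1}|lborel. (cmod (f t))\<^sup>2 - 2 * m * cmod (f t))
      = (LINT t:{0..1}|lborel. (cmod (f t))\<^sup>2) - (LINT t:{0..1}|lborel. 2 * m * cmod (f t))"
    using s1 s2 by (intro set_integral_diff set_integrable_mult_right)
  also have "(LINT t:{0..1}|lborel. 2 * m * cmod (f t)) = 2 * m * m"
    by (simp add: m_def)
  also have "(LINT t:{0..1::real}|lborel. m\<^sup>2) = m\<^sup>2" by (simp add: set_lebesgue_integral_def)
  finally have "m\<^sup>2 \<le> (LINT t:{0..1}|lborel. (cmod (f t))\<^sup>2)" by (simp add: power2_eq_square)
  then show "(LINT t:{0..1}|lborel. cmod (f t)) \<le> sqrt (LINT t:{0..1}|lborel. (cmod (f t))\<^sup>2)"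
    unfolding m_def by (rule real_le_rsqrt)
qed


section \<open>The terms of the resolvent series\<close>

text \<open>Sums of extended nonnegative reals are suprema of finite sums, so norm estimates reduce
  to finite sets of edges.\<close>

lemma L2sq_ge:
  assumes "finite F" "F \<subseteq> edges E red"
  shows "(\<Sum>e\<in>F. \<integral>\<^sup>+ t. ennreal ((cmod (g e t))\<^sup>2) * indicator {0..1} t \<partial>lborel) \<le> L2sq E red g"
  unfolding L2sq_def using assms
  by (subst nonneg_infsum_complete) (auto intro: SUP_upper2)

lemma L2sq_le:
  assumes "\<And>F. finite F \<Longrightarrow> F \<subseteq> edges E red \<Longrightarrow>
    (\<Sum>e\<in>F. \<integral>\<^sup>+ t. ennreal ((cmod (g e t))\<^sup>2) * indicator {0..1} t \<partial>lborel) \<le> C"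
  shows "L2sq E red g \<le> C"
  unfolding L2sq_def using assms
  by (subst nonneg_infsum_complete) (auto intro!: SUP_least)

locale resolvent = biregular E red dR dB + spectral dR dB lam
  for E :: "'v \<Rightarrow> 'v \<Rightarrow> bool" and red dR dB lam +
  fixes f :: "'v \<times> 'v \<Rightarrow> real \<Rightarrow> complex"
  assumes fL2: "in_L2 E red f"
begin

abbreviation "Edg \<equiv> edges E red"
abbreviation "V \<equiv> Vf dR dB lam"
abbreviation "U \<equiv> Uf dR dB lam"

lemma edge_adj: "e \<in> Edg \<Longrightarrow> E (fst e) (snd e)" and edge_red: "e \<in> Edg \<Longrightarrow> red (fst e)"
  and edge_blue: "e \<in> Edg \<Longrightarrow> \<not> red (snd e)"
  using adj_colour by (auto simp: edges_def)

definition phi :: "'v \<times> 'v \<Rightarrow> real" where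
  "phi e = sqrt (LINT t:{0..1}|lborel. (cmod (f e t))\<^sup>2)"

lemma phi_nonneg: "phi e \<ge> 0"
  by (simp add: phi_def set_lebesgue_integral_def)

lemma f_fin:
  assumes "e \<in> Edg"
  shows "(\<integral>\<^sup>+ t. ennreal ((cmod (f e t))\<^sup>2) * indicator {0..1} t \<partial>lborel) < \<infinity>"
proof -
  have "(\<Sum>e\<in>{e}. \<integral>\<^sup>+ t. ennreal ((cmod (f e t))\<^sup>2) * indicator {0..1} t \<partial>lborel) \<le> L2sq E red f"
    using assms by (intro L2sq_ge) auto
  also have "\<dots> < \<infinity>" using fL2 by (simp add: in_L2_def)
  finally show ?thesis by simp
qed

lemma f_meas: "e \<in> Edg \<Longrightarrow> set_borel_measurable lborel {0..1} (f e)"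
  using fL2 by (simp add: in_L2_def)

lemma f_int: "e \<in> Edg \<Longrightarrow> set_integrable lborel {0..1} (f e)"
  and f_int1: "e \<in> Edg \<Longrightarrow> set_integrable lborel {0..1} (\<lambda>t. cmod (f e t))"
  using L2_imp_L1(1,2)[OF f_meas f_fin] by blast+

lemma f_nn:
  assumes "e \<in> Edg"
  shows "(\<integral>\<^sup>+ t. ennreal ((cmod (f e t))\<^sup>2) * indicator {0..1} t \<partial>lborel) = ennreal ((phi e)\<^sup>2)"
  unfolding L2_imp_L1(4)[OF f_meas[OF assms] f_fin[OF assms]] phi_def
  by (simp add: set_lebesgue_integral_def)

lemma f_L1: "e \<in> Edg \<Longrightarrow> (LINT t:{0..1}|lborel. cmod (f e t)) \<le> phi e"
  unfolding phi_def by (rule L2_imp_L1(5)[OF f_meas f_fin])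

lemma continuous_U: "continuous_on {0..1} U"
proof -
  have "continuous_on {0..1} (\<lambda>x. U0v * cosw lam x + U0d * sinw lam x)" by (intro continuous_intros)
  then show ?thesis by (rule continuous_on_eq) (simp add: Uf_01)
qed

lemma continuous_V: "continuous_on {0..1} V"
proof -
  have "continuous_on {0..1} (\<lambda>x. aV * cosw lam x + bV * sinw lam x)" by (intro continuous_intros)
  then show ?thesis by (rule continuous_on_eq) (simp add: Vf_01)
qed

text \<open>Amplitudes of the term of \<open>e\<close>: beyond the blue end of \<open>e\<close> it
  is \<open>cV e\<close> times \<open>V\<close>, beyond the red end \<open>cU e\<close> times
  \<open>U\<close>.\<close>

definition cV :: "'v \<times> 'v \<Rightarrow> complex" where
  "cV e = (LINT t:{0..1}|lborel. - U t / W * f e t)"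

definition cU :: "'v \<times> 'v \<Rightarrow> complex" where
  "cU e = (LINT t:{0..1}|lborel. - V t / W * f e t)"

definition far :: "'v \<times> 'v \<Rightarrow> 'v \<Rightarrow> bool" where
  "far e v \<longleftrightarrow> vdist E (fst e) v = Suc (vdist E (snd e) v)"

text \<open>Value at the vertex \<open>v\<close> of the term belonging to the source edge \<open>e\<close>, and its derivative
  at \<open>v\<close> in the direction of the neighbour \<open>w\<close>.\<close>

definition Val :: "'v \<times> 'v \<Rightarrow> 'v \<Rightarrow> complex" where
  "Val e v = (if far e v then cV e * VA (vdist E (fst e) v) else cU e * UA (vdist E (snd e) v))"

definition OD :: "'v \<times> 'v \<Rightarrow> 'v \<Rightarrow> 'v \<Rightarrow> complex" where
  "OD e v w = (if far e v
     then cV e * VB (vdist E (fst e) v) * (if vdist E (fst e) w = Suc (vdist E (fst e) v) then 1 else - of_nat (br v))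
     else cU e * UB (vdist E (snd e) v) * (if vdist E (snd e) w = Suc (vdist E (snd e) v) then 1 else - of_nat (br v)))"

lemma not_far: "e \<in> Edg \<Longrightarrow> \<not> far e v \<Longrightarrow> vdist E (snd e) v = Suc (vdist E (fst e) v)"
  using vdist_adj'[OF edge_adj, of e v] unfolding far_def by blast

lemma br_fst: "e \<in> Edg \<Longrightarrow> br v = (if odd (vdist E (fst e) v) then dB else dR)"
  using red_iff_even[of v "fst e"] edge_red[of e] by (simp add: br_def)

lemma br_snd: "e \<in> Edg \<Longrightarrow> br v = (if odd (vdist E (snd e) v) then dR else dB)"
  using red_iff_even[of v "snd e"] edge_blue[of e] by (simp add: br_def)

text \<open>\<open>OD\<close> gives the factor 1 to each of the \<open>br v\<close> children and
  \<open>- br v\<close> to the one parent. A parent exists because \<open>v\<close> is never the end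
  point of \<open>e\<close> from which distances in its half are measured.\<close>

lemma kirchhoff_vertex:
  assumes "e \<in> Edg"
  shows "(\<Sum>w\<in>{w. E v w}. OD e v w) = 0"
proof -
  have gen: "(\<Sum>w\<in>{w. E v w}. k * (if vdist E u w = Suc (vdist E u v) then 1 else - of_nat (br v))) = (0::complex)"
    if vu: "v \<noteq> u" for k u
  proof -
    obtain p where p: "E v p" "vdist E u v = Suc (vdist E u p)" using parent_exists[OF vu] by blast
    have oth: "vdist E u w = Suc (vdist E u v)" if "w \<in> {w. E v w} - {p}" for w
      using that parent_unique[OF p, of w] vdist_adj[of v w u] by blast
    have p': "vdist E u p \<noteq> Suc (vdist E u v)" using p(2) by linarith
    have "(\<Sum>w\<in>{w. E v w}. k * (if vdist E u w = Suc (vdist E u v) then 1 else - of_nat (br v)))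
        = k * (- of_nat (br v)) + (\<Sum>w\<in>{w. E v w} - {p}. k * (if vdist E u w = Suc (vdist E u v) then 1 else - of_nat (br v)))"
      using p p' by (subst sum.remove[of _ p]) auto
    also have "(\<Sum>w\<in>{w. E v w} - {p}. k * (if vdist E u w = Suc (vdist E u v) then 1 else - of_nat (br v)))
        = (\<Sum>w\<in>{w. E v w} - {p}. k)"
      using oth by (intro sum.cong) simp_all
    also have "\<dots> = of_nat (br v) * k" using p(1) card_nbrs[of v] by simp
    finally show ?thesis by simp
  qed
  show ?thesis
  proof (cases "far e v")
    case True
    then have "v \<noteq> fst e" by (auto simp: far_def)
    then show ?thesis using True gen by (simp add: OD_def)
  next
    case False
    then have "v \<noteq> snd e" using not_far[OF assms] by fastforce
    then show ?thesis using False gen by (simp add: OD_def)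
  qed
qed

lemma pdist_near:
  assumes "vdist E v y = Suc (vdist E v x)" "0 \<le> s" "s \<le> 1"
  shows "pdist E v (x, y) s = real (vdist E v x) + s"
  using assms by (simp add: pdist_def)

lemma pdist_away:
  assumes "vdist E v x = Suc (vdist E v y)" "0 \<le> s" "s \<le> 1"
  shows "pdist E v (x, y) s = real (vdist E v y) + (1 - s)"
  using assms by (simp add: pdist_def)

lemma Rterm_far:
  assumes "xcoord E e e' s = x" "x \<ge> 1"
  shows "Rterm E dR dB lam f e e' s = cV e * V x"
proof -
  have "Rker dR dB lam x t = V x * (- U t / W)" if "t \<in> {0..1}" for t
  proof (cases "x \<le> t")
    \<comment> \<open>Here \<open>x = t = 1\<close>, and the two branches of the kernel agree on the
      diagonal.\<close>
    case True
    then have "x = t" using that assms(2) by simp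
    then show ?thesis by (simp add: Rker_def W_def)
  qed (simp add: Rker_def W_def)
  then have "Rterm E dR dB lam f e e' s = (LINT t:{0..1}|lborel. V x * (- U t / W * f e t))"
    unfolding Rterm_def assms(1) by (intro set_lebesgue_integral_cong) (auto simp: mult.assoc)
  also have "\<dots> = V x * cV e" unfolding cV_def by (rule set_integral_mult_right)
  finally show ?thesis by simp
qed

lemma Rterm_near:
  assumes "xcoord E e e' s = x" "x \<le> 0"
  shows "Rterm E dR dB lam f e e' s = cU e * U x"
proof -
  have "Rker dR dB lam x t = U x * (- V t / W)" if "t \<in> {0..1}" for t
    using that assms by (auto simp: Rker_def W_def)
  then have "Rterm E dR dB lam f e e' s = (LINT t:{0..1}|lborel. U x * (- V t / W * f e t))"
    unfolding Rterm_def assms(1) by (intro set_lebesgue_integral_cong) (auto simp: mult.assoc)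
  also have "\<dots> = U x * cU e" unfolding cU_def by (rule set_integral_mult_right)
  finally show ?thesis by simp
qed

lemma Vint: "e \<in> Edg \<Longrightarrow> set_integrable lborel {0..1} (\<lambda>t. - V t / W * f e t)"
  by (intro set_integrable_cont_mult f_int continuous_intros continuous_V) (simp_all add: W_nz)

lemma Uint: "e \<in> Edg \<Longrightarrow> set_integrable lborel {0..1} (\<lambda>t. - U t / W * f e t)"
  by (intro set_integrable_cont_mult f_int continuous_intros continuous_U) (simp_all add: W_nz)

text \<open>By \<open>UV_sinw\<close> the kernel is \<open>- U s * V t / W\<close> throughout, minus
  Duhamel's kernel for \<open>t \<le> s\<close>. The term keeps the shape it has elsewhere, up to a
  correction with zero Cauchy data at the red end.\<close>

lemma Rterm_self:
  assumes e: "e \<in> Edg" and s: "s \<in> {0..1}"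
  shows "Rterm E dR dB lam f e e s = cU e * U s - Pf lam (f e) s"
proof -
  have d: "vdist E (fst e) (snd e) = 1" "vdist E (snd e) (fst e) = 1"
    using adj_vdist edge_adj[OF e] adj_sym by blast+
  have x: "xcoord E e e s = s" using s d by (simp add: xcoord_def pdist_def Let_def)
  have ker: "Rker dR dB lam s t * f e t = U s * (- V t / W * f e t) - indicator {0..s} t *\<^sub>R (sinw lam (s - t) * f e t)"
    if t: "t \<in> {0..1}" for t
  proof (cases "s \<le> t")
    case True
    then have "indicator {0..s} t *\<^sub>R (sinw lam (s - t) * f e t) = 0" by (cases "s = t") auto
    then show ?thesis using True by (simp add: Rker_def W_def mult_ac)
  next
    case False
    have "- U t * V s / W = - U s * V t / W - sinw lam (s - t)"
      using UV_sinw[OF s t] W_nz by (simp add: field_simps)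
    then have "Rker dR dB lam s t = U s * (- V t / W) - sinw lam (s - t)"
      using False by (simp add: Rker_def W_def)
    moreover have "indicator {0..s} t *\<^sub>R (sinw lam (s - t) * f e t) = sinw lam (s - t) * f e t"
      using False t by simp
    ultimately show ?thesis by (simp only: left_diff_distrib mult.assoc)
  qed
  have "set_integrable lborel {0..s} (\<lambda>t. sinw lam (s - t) * f e t)"
    by (rule set_integrable_cont_mult_sub[OF f_int[OF e] _ s]) (intro continuous_intros)
  moreover have ind: "(\<lambda>t. indicator {0..1::real} t *\<^sub>R (indicator {0..s} t *\<^sub>R (sinw lam (s - t) * f e t)))
      = (\<lambda>t. indicator {0..s} t *\<^sub>R (sinw lam (s - t) * f e t))"
    using s by (auto simp: indicator_def fun_eq_iff)
  ultimately have i2: "set_integrable lborel {0..1} (\<lambda>t. indicator {0..s} t *\<^sub>R (sinw lam (s - t) * f e t))"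
    by (simp only: set_integrable_def)
  have i1: "set_integrable lborel {0..1} (\<lambda>t. U s * (- V t / W * f e t))"
    by (rule set_integrable_mult_right) (rule Vint[OF e])
  have "Rterm E dR dB lam f e e s = (LINT t:{0..1}|lborel. U s * (- V t / W * f e t) - indicator {0..s} t *\<^sub>R (sinw lam (s - t) * f e t))"
    unfolding Rterm_def x using ker by (intro set_lebesgue_integral_cong) auto
  also have "\<dots> = (LINT t:{0..1}|lborel. U s * (- V t / W * f e t))
     - (LINT t:{0..1}|lborel. indicator {0..s} t *\<^sub>R (sinw lam (s - t) * f e t))"
    by (rule set_integral_diff(2)[OF i1 i2])
  also have "(LINT t:{0..1}|lborel. U s * (- V t / W * f e t)) = U s * cU e"
    unfolding cU_def by (rule set_integral_mult_right)
  also have "(LINT t:{0..1}|lborel. indicator {0..s} t *\<^sub>R (sinw lam (s - t) * f e t)) = Pf lam (f e) s"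
    unfolding Pf_def set_lebesgue_integral_def ind ..
  finally show ?thesis by (simp add: mult.commute)
qed

text \<open>The matching at the blue end: \<open>cU e * U - Pf lam (f e)\<close> arrives there with
  the value and the derivative of \<open>cV e * V\<close>, because at 1 the integral runs over the
  whole edge and produces both amplitudes.\<close>

lemma Pf_1: "e \<in> Edg \<Longrightarrow> Pf lam (f e) 1 = cU e * U 1 - cV e * V 1"
  and Qf_1: "e \<in> Edg \<Longrightarrow> Qf lam (f e) 1 = cU e * (U0d * cc lam - lam * U0v * ss lam)
     - cV e * (bV * cc lam - lam * aV * ss lam)"
proof -
  assume e: "e \<in> Edg"
  have lin: "(LINT t:{0..1}|lborel. p * (- V t / W * f e t) - q * (- U t / W * f e t)) = p * cU e - q * cV e" for p q
    unfolding cU_def cV_def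
    by (subst set_integral_diff(2)) (simp_all only: set_integral_mult_right set_integrable_mult_right Vint[OF e] Uint[OF e])
  have "sinw lam (1 - t) = U 1 * (- V t / W) - V 1 * (- U t / W)" if "t \<in> {0..1}" for t
    using UV_sinw[of 1 t] that W_nz by (simp add: field_simps)
  then have "Pf lam (f e) 1 = (LINT t:{0..1}|lborel. U 1 * (- V t / W * f e t) - V 1 * (- U t / W * f e t))"
    unfolding Pf_def by (intro set_lebesgue_integral_cong) (auto simp: left_diff_distrib mult.assoc)
  then show "Pf lam (f e) 1 = cU e * U 1 - cV e * V 1" unfolding lin by (simp add: mult.commute)
  define p q where "p = U0d * cc lam - lam * U0v * ss lam" and "q = bV * cc lam - lam * aV * ss lam"
  have "W * cosw lam (1 - t) = q * U t - p * V t" if "t \<in> {0..1}" for t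
    using that by (simp add: Vf_01 Uf_01 W_eq cosw_diff cosw_1 sinw_1 p_def q_def algebra_simps)
  then have "cosw lam (1 - t) = p * (- V t / W) - q * (- U t / W)" if "t \<in> {0..1}" for t
    using that W_nz by (simp add: field_simps)
  then have "Qf lam (f e) 1 = (LINT t:{0..1}|lborel. p * (- V t / W * f e t) - q * (- U t / W * f e t))"
    unfolding Qf_def by (intro set_lebesgue_integral_cong) (auto simp: left_diff_distrib mult.assoc)
  then show "Qf lam (f e) 1 = cU e * (U0d * cc lam - lam * U0v * ss lam) - cV e * (bV * cc lam - lam * aV * ss lam)"
    unfolding lin by (simp add: p_def q_def mult.commute)
qed

end


section \<open>One formula for every term on every edge\<close>

lemma transfer_inverse:
  assumes "a' = a * cc lam + b * ss lam" "b' = b * cc lam - lam * a * ss lam"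
  shows "a = a' * cc lam - b' * ss lam" "b = b' * cc lam + lam * a' * ss lam"
  using cc_ss[of lam] assms by algebra+

lemma cosw_sinw_rev:
  "a * cosw lam (1 - s) + b * sinw lam (1 - s)
    = (a * cc lam + b * ss lam) * cosw lam s - (b * cc lam - lam * a * ss lam) * sinw lam s"
  by (simp add: cosw_diff sinw_diff cosw_1 sinw_1 algebra_simps)

context resolvent
begin

text \<open>A Kronecker factor, so that the source edge is no exception in the formulas or in the
  summation over \<open>e\<close>.\<close>

definition self :: "'v \<times> 'v \<Rightarrow> 'v \<times> 'v \<Rightarrow> complex \<Rightarrow> complex" where
  "self e e' z = (if e' = e then z else 0)"

lemma VB_step: "e \<in> Edg \<Longrightarrow> vdist E (fst e) y = Suc n \<Longrightarrow>
    of_nat (br y) * VB (Suc n) = VB n * cc lam - lam * VA n * ss lam"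
  using VB_Suc[of n] br_fst[of e y] by simp

lemma UB_step: "e \<in> Edg \<Longrightarrow> vdist E (snd e) y = Suc n \<Longrightarrow>
    of_nat (br y) * UB (Suc n) = UB n * cc lam - lam * UA n * ss lam"
  using UB_Suc[of n] br_snd[of e y] by simp

text \<open>The second and third identities equate the end value and end derivative of the first
  formula with the vertex data at the blue end. They carry continuity and the Kirchhoff condition
  over to the summed series.\<close>

lemma edge_formula:
  assumes e: "e \<in> Edg" and xy: "(x, y) \<in> Edg"
  shows "\<forall>s\<in>{0..1}. Rterm E dR dB lam f e (x, y) s
      = Val e x * cosw lam s + OD e x y * sinw lam s - self e (x, y) (Pf lam (f e) s)" (is ?T1)
    and "Val e y = Val e x * cc lam + OD e x y * ss lam - self e (x, y) (Pf lam (f e) 1)" (is ?T2)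
    and "- OD e y x = OD e x y * cc lam - lam * Val e x * ss lam - self e (x, y) (Qf lam (f e) 1)" (is ?T3)
proof -
  define r b where "r = fst e" and "b = snd e"
  have rb: "E r b" "red r" "\<not> red b" using edge_adj edge_red edge_blue e by (auto simp: r_def b_def)
  have adj: "E x y" "red x" "\<not> red y" using edge_adj[OF xy] edge_red[OF xy] edge_blue[OF xy] by auto
  \<comment> \<open>By \<open>side_cross\<close> only \<open>e\<close> joins the two halves, and the
    colours exclude that it is traversed backwards.\<close>
  consider (self) "(x, y) = e"
    | (far) "far e x" "far e y" "(x, y) \<noteq> e" | (near) "\<not> far e x" "\<not> far e y" "(x, y) \<noteq> e"
  proof -
    have "far e x \<Longrightarrow> \<not> far e y \<Longrightarrow> False"
      using side_cross[OF rb(1) adj(1)] not_far[OF e, of y] rb adj by (auto simp: far_def r_def b_def)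
    moreover have "far e y \<Longrightarrow> \<not> far e x \<Longrightarrow> (x, y) = e"
      using side_cross[OF rb(1) adj_sym[OF adj(1)]] not_far[OF e, of x] by (auto simp: far_def r_def b_def)
    ultimately show thesis using that by blast
  qed
  then have "?T1 \<and> ?T2 \<and> ?T3"
  proof cases
    case self
    have xyrb: "x = r" "y = b" using self by (auto simp: r_def b_def)
    have d: "vdist E r b = 1" "vdist E b r = 1" using rb(1) adj_vdist adj_sym by blast+
    have farx: "\<not> far e x" and fary: "far e y"
      using d xyrb by (auto simp: far_def r_def b_def)
    have Vx: "Val e x = cU e * U0v"
      using farx d xyrb UA_Suc[of 0] by (simp add: Val_def U0v_def U0 r_def b_def)
    have Vy: "Val e y = cV e * V 1"
      using fary d xyrb VA_Suc[of 0] Vf_01[of 1] by (simp add: Val_def V0 r_def b_def cosw_1 sinw_1)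
    have "OD e x y = - (cU e * (of_nat (br x) * UB (Suc 0)))"
      using farx d xyrb by (simp add: OD_def r_def b_def)
    moreover have "of_nat (br x) * UB (Suc 0) = - U0d"
      using UB_step[OF e, of x 0] d xyrb by (simp add: U0d_def U0 b_def)
    ultimately have Ox: "OD e x y = cU e * U0d" by simp
    have "OD e y x = - (cV e * (of_nat (br y) * VB (Suc 0)))"
      using fary d xyrb by (simp add: OD_def r_def b_def)
    moreover have "of_nat (br y) * VB (Suc 0) = bV * cc lam - lam * aV * ss lam"
      using VB_step[OF e, of y 0] d xyrb by (simp add: V0 r_def)
    ultimately have Oy: "OD e y x = - cV e * (bV * cc lam - lam * aV * ss lam)" by simp
    have ?T1 using Rterm_self[OF e] self Vx Ox by (auto simp: self_def Uf_01 algebra_simps)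
    moreover have ?T2 using self Pf_1[OF e] Uf_01[of 1]
      by (simp add: self_def Vx Vy Ox cosw_1 sinw_1 algebra_simps)
    moreover have ?T3 using self Qf_1[OF e] by (simp add: self_def Vx Ox Oy algebra_simps)
    ultimately show ?thesis by blast
  next
    case far
    have dx: "vdist E r x = Suc (vdist E b x)" and dy: "vdist E r y = Suc (vdist E b y)"
      using far by (auto simp: far_def r_def b_def)
    have xc: "xcoord E e (x, y) s = pdist E r (x, y) s" for s
    proof -
      have "pdist E r (x, y) s = pdist E b (x, y) s + 1" using dx dy by (simp add: pdist_def min_def)
      then show ?thesis by (simp add: xcoord_def r_def[symmetric] b_def[symmetric] Let_def)
    qed
    have sf: "self e (x, y) z = 0" for z using far by (simp add: self_def)
    from vdist_adj[OF adj(1), of r] show ?thesis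
    proof
      assume n: "vdist E r y = Suc (vdist E r x)"
      define n where "n = vdist E r x"
      \<comment> \<open>Keeps the coordinate at least 1 on the whole edge, as
        \<open>Rterm_far\<close> requires.\<close>
      have n1: "n \<ge> 1" using dx by (simp add: n_def)
      have v: "Val e x = cV e * VA n" "Val e y = cV e * VA (Suc n)" "OD e x y = cV e * VB n"
        "OD e y x = - (cV e * (of_nat (br y) * VB (Suc n)))"
        using far n by (simp_all add: Val_def OD_def n_def r_def)
      have ?T1
      proof
        fix s :: real assume s: "s \<in> {0..1}"
        then have "xcoord E e (x, y) s = real n + s"
          unfolding xc using pdist_near[OF n, of s] by (simp add: n_def)
        from Rterm_far[OF this] s n1
        have "Rterm E dR dB lam f e (x, y) s = cV e * V (real n + s)" by simp
        also have "V (real n + s) = VA n * cosw lam s + VB n * sinw lam s"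
          using s by (subst Vf_at) simp_all
        finally show "Rterm E dR dB lam f e (x, y) s
            = Val e x * cosw lam s + OD e x y * sinw lam s - self e (x, y) (Pf lam (f e) s)"
          by (simp add: v sf algebra_simps)
      qed
      moreover have ?T2 by (simp add: v sf VA_Suc algebra_simps)
      moreover have ?T3
        unfolding v sf VB_step[OF e n[unfolded r_def, folded n_def[unfolded r_def]]]
        by (simp add: algebra_simps)
      ultimately show ?thesis by blast
    next
      assume n: "vdist E r x = Suc (vdist E r y)"
      define n where "n = vdist E r y"
      have n1: "n \<ge> 1" using dy by (simp add: n_def)
      \<comment> \<open>The edge points towards the source, so \<open>V\<close> is expanded at
        \<open>y\<close> and then reversed; \<open>B\<close> is its derivative on reaching
        \<open>x\<close>, before the division by the branching number.\<close>
      define B where "B = of_nat (br x) * VB (Suc n)"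
      have B: "B = VB n * cc lam - lam * VA n * ss lam"
        unfolding B_def by (rule VB_step[OF e]) (use n in \<open>simp add: n_def r_def\<close>)
      have v: "Val e x = cV e * VA (Suc n)" "Val e y = cV e * VA n" "OD e x y = - (cV e * B)"
        "OD e y x = cV e * VB n"
        using far n by (simp_all add: Val_def OD_def n_def r_def B_def)
      have ?T1
      proof
        fix s :: real assume s: "s \<in> {0..1}"
        then have "xcoord E e (x, y) s = real n + (1 - s)"
          unfolding xc using pdist_away[OF n, of s] by (simp add: n_def)
        from Rterm_far[OF this] s n1
        have "Rterm E dR dB lam f e (x, y) s = cV e * V (real n + (1 - s))" by simp
        also have "V (real n + (1 - s)) = VA (Suc n) * cosw lam s - B * sinw lam s"
          using s by (subst Vf_at) (simp_all add: cosw_sinw_rev VA_Suc B)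
        finally show "Rterm E dR dB lam f e (x, y) s
            = Val e x * cosw lam s + OD e x y * sinw lam s - self e (x, y) (Pf lam (f e) s)"
          by (simp add: v sf algebra_simps)
      qed
      moreover have ?T2 ?T3
        unfolding v sf
        by (subst transfer_inverse(1)[OF VA_Suc B], simp add: algebra_simps)
          (subst transfer_inverse(2)[OF VA_Suc B], simp add: algebra_simps)
      ultimately show ?thesis by blast
    qed
  next
    case near
    have dx: "vdist E b x = Suc (vdist E r x)" and dy: "vdist E b y = Suc (vdist E r y)"
      using near not_far[OF e] by (auto simp: r_def b_def)
    have xc: "xcoord E e (x, y) s = 1 - pdist E b (x, y) s" for s
    proof -
      have "pdist E b (x, y) s = pdist E r (x, y) s + 1" using dx dy by (simp add: pdist_def min_def)
      then show ?thesis by (simp add: xcoord_def r_def[symmetric] b_def[symmetric] Let_def)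
    qed
    have sf: "self e (x, y) z = 0" for z using near by (simp add: self_def)
    from vdist_adj[OF adj(1), of b] show ?thesis
    proof
      assume n: "vdist E b y = Suc (vdist E b x)"
      define n where "n = vdist E b x"
      have n1: "n \<ge> 1" using dx by (simp add: n_def)
      have v: "Val e x = cU e * UA n" "Val e y = cU e * UA (Suc n)" "OD e x y = cU e * UB n"
        "OD e y x = - (cU e * (of_nat (br y) * UB (Suc n)))"
        using near n by (simp_all add: Val_def OD_def n_def b_def)
      have ?T1
      proof
        fix s :: real assume s: "s \<in> {0..1}"
        then have "xcoord E e (x, y) s = 1 - (real n + s)"
          unfolding xc using pdist_near[OF n, of s] by (simp add: n_def)
        from Rterm_near[OF this] s n1
        have "Rterm E dR dB lam f e (x, y) s = cU e * U (1 - (real n + s))" by simp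
        also have "U (1 - (real n + s)) = UA n * cosw lam s + UB n * sinw lam s"
          using s by (subst Uf_at) simp_all
        finally show "Rterm E dR dB lam f e (x, y) s
            = Val e x * cosw lam s + OD e x y * sinw lam s - self e (x, y) (Pf lam (f e) s)"
          by (simp add: v sf algebra_simps)
      qed
      moreover have ?T2 by (simp add: v sf UA_Suc algebra_simps)
      moreover have ?T3
        unfolding v sf UB_step[OF e n[unfolded b_def, folded n_def[unfolded b_def]]]
        by (simp add: algebra_simps)
      ultimately show ?thesis by blast
    next
      assume n: "vdist E b x = Suc (vdist E b y)"
      define n where "n = vdist E b y"
      have n1: "n \<ge> 1" using dy by (simp add: n_def)
      define B where "B = of_nat (br x) * UB (Suc n)"
      have B: "B = UB n * cc lam - lam * UA n * ss lam"
        unfolding B_def by (rule UB_step[OF e]) (use n in \<open>simp add: n_def b_def\<close>)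
      have v: "Val e x = cU e * UA (Suc n)" "Val e y = cU e * UA n" "OD e x y = - (cU e * B)"
        "OD e y x = cU e * UB n"
        using near n by (simp_all add: Val_def OD_def n_def b_def B_def)
      have ?T1
      proof
        fix s :: real assume s: "s \<in> {0..1}"
        then have "xcoord E e (x, y) s = 1 - (real n + (1 - s))"
          unfolding xc using pdist_away[OF n, of s] by (simp add: n_def)
        from Rterm_near[OF this] s n1
        have "Rterm E dR dB lam f e (x, y) s = cU e * U (1 - (real n + (1 - s)))" by simp
        also have "U (1 - (real n + (1 - s))) = UA (Suc n) * cosw lam s - B * sinw lam s"
          using s by (subst Uf_at) (simp_all add: cosw_sinw_rev UA_Suc B)
        finally show "Rterm E dR dB lam f e (x, y) s
            = Val e x * cosw lam s + OD e x y * sinw lam s - self e (x, y) (Pf lam (f e) s)"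
          by (simp add: v sf algebra_simps)
      qed
      moreover have ?T2 ?T3
        unfolding v sf
        by (subst transfer_inverse(1)[OF UA_Suc B], simp add: algebra_simps)
          (subst transfer_inverse(2)[OF UA_Suc B], simp add: algebra_simps)
      ultimately show ?thesis by blast
    qed
  qed
  then show ?T1 ?T2 ?T3 by blast+
qed

section \<open>Pointwise bounds on the terms\<close>

lemma theta_kap: "theta * kap < 1"
  using theta_small by (simp add: kap_def)

lemma theta_le1: "theta \<le> 1"
proof -
  have "theta * 1 \<le> theta * kap" using kap_ge1 theta_pos by (intro mult_left_mono) auto
  then show ?thesis using theta_kap by linarith
qed

lemma coef_bound: "\<exists>K\<ge>0. \<forall>e\<in>Edg. cmod (cV e) \<le> K * phi e \<and> cmod (cU e) \<le> K * phi e"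
proof -
  have "bounded ((\<lambda>t. - U t / W) ` {0..1})" "bounded ((\<lambda>t. - V t / W) ` {0..1})"
    using W_nz by (intro compact_imp_bounded compact_continuous_image continuous_intros continuous_U continuous_V; simp)+
  then obtain K L where KL: "\<And>t. t \<in> {0..1} \<Longrightarrow> cmod (- U t / W) \<le> K" "\<And>t. t \<in> {0..1} \<Longrightarrow> cmod (- V t / W) \<le> L"
    unfolding bounded_iff by blast
  define M where "M = max K L"
  have M: "cmod (- U t / W) \<le> M" "cmod (- V t / W) \<le> M" if "t \<in> {0..1}" for t
    using KL[OF that] by (auto simp: M_def)
  have M0: "M \<ge> 0" using order_trans[OF norm_ge_zero M(1)[of 0]] by simp
  have "cmod (cV e) \<le> M * phi e \<and> cmod (cU e) \<le> M * phi e" if e: "e \<in> Edg" for e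
  proof -
    have i: "set_integrable lborel {0..1} (\<lambda>t. M * cmod (f e t))"
      by (rule set_integrable_mult_right) (rule f_int1[OF e])
    have "cmod (cV e) \<le> (LINT t:{0..1}|lborel. M * cmod (f e t))"
      unfolding cV_def norm_mult using M
      by (intro set_integral_norm_bound' i) (simp only: norm_mult mult_right_mono norm_ge_zero)
    moreover have "cmod (cU e) \<le> (LINT t:{0..1}|lborel. M * cmod (f e t))"
      unfolding cU_def norm_mult using M
      by (intro set_integral_norm_bound' i) (simp only: norm_mult mult_right_mono norm_ge_zero)
    moreover have "(LINT t:{0..1}|lborel. M * cmod (f e t)) \<le> M * phi e"
      using f_L1[OF e] M0 by (simp add: mult_left_mono)
    ultimately show ?thesis by linarith
  qed
  then show ?thesis using M0 by blast
qed

text \<open>Behind the red end the coefficients decay with the distance from the blue end, which is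
  larger by one; since \<open>theta \<le> 1\<close> the distance from the red end may be used
  everywhere. The factor \<gamma> absorbs the branching number in \<open>OD\<close>.\<close>

lemma Val_OD_bound:
  "\<exists>K\<ge>0. \<forall>e\<in>Edg. \<forall>v w. cmod (Val e v) \<le> K * theta ^ vdist E (fst e) v * phi e
     \<and> cmod (OD e v w) \<le> K * theta ^ vdist E (fst e) v * phi e"
proof -
  obtain K where K: "K \<ge> 0" "\<And>n. cmod (VA n) \<le> K * theta ^ n" "\<And>n. cmod (VB n) \<le> K * theta ^ n"
    "\<And>n. cmod (UA n) \<le> K * theta ^ n" "\<And>n. cmod (UB n) \<le> K * theta ^ n"
    using coef_decay by blast
  obtain L where L: "L \<ge> 0" "\<And>e. e \<in> Edg \<Longrightarrow> cmod (cV e) \<le> L * phi e" "\<And>e. e \<in> Edg \<Longrightarrow> cmod (cU e) \<le> L * phi e"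
    using coef_bound by blast
  define \<gamma> where "\<gamma> = real (dR + dB)"
  have \<gamma>: "\<gamma> \<ge> 1" using dR_pos by (simp add: \<gamma>_def)
  have gen: "cmod (c * a * z) \<le> L * K * \<gamma> * theta ^ n * phi e"
    if "cmod c \<le> L * phi e" "cmod a \<le> K * theta ^ m" "cmod z \<le> \<gamma>" "n \<le> m" for c a z m n e
  proof -
    have "theta ^ m \<le> theta ^ n" using that(4) theta_pos theta_le1 by (intro power_decreasing) auto
    then have "cmod a \<le> K * theta ^ n" using that(2) K(1) by (meson mult_left_mono order_trans)
    then have "cmod c * cmod a * cmod z \<le> (L * phi e) * (K * theta ^ n) * \<gamma>"
      using that K L phi_nonneg theta_pos \<gamma> by (intro mult_mono) auto
    then show ?thesis by (simp add: norm_mult mult_ac)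
  qed
  have z: "cmod (if P then 1 else - of_nat (br v)) \<le> \<gamma>" for P v
    using \<gamma> by (auto simp: \<gamma>_def br_def)
  have one: "cmod 1 \<le> \<gamma>" using \<gamma> by simp
  have "cmod (Val e v) \<le> L * K * \<gamma> * theta ^ vdist E (fst e) v * phi e
     \<and> cmod (OD e v w) \<le> L * K * \<gamma> * theta ^ vdist E (fst e) v * phi e" if e: "e \<in> Edg" for e v w
  proof (cases "far e v")
    case True
    show ?thesis
      using gen[OF L(2)[OF e] K(2) one order_refl, of "vdist E (fst e) v"]
        gen[OF L(2)[OF e] K(3) z order_refl, of "vdist E (fst e) v"] True
      by (simp add: Val_def OD_def)
  next
    case False
    have le: "vdist E (fst e) v \<le> vdist E (snd e) v" using not_far[OF e False] by linarith
    show ?thesis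
      using gen[OF L(3)[OF e] K(4) one le] gen[OF L(3)[OF e] K(5) z le] False
      by (simp add: Val_def OD_def)
  qed
  moreover have "L * K * \<gamma> \<ge> 0" using L K \<gamma> by simp
  ultimately show ?thesis by blast
qed

lemma Rterm_bound:
  "\<exists>K\<ge>0. \<forall>e\<in>Edg. \<forall>e'\<in>Edg. \<forall>s\<in>{0..1}.
     cmod (Rterm E dR dB lam f e e' s) \<le> K * (theta ^ vdist E (fst e') (fst e) * phi e)"
proof -
  obtain K where K: "K \<ge> 0" "\<And>e v. e \<in> Edg \<Longrightarrow> cmod (Val e v) \<le> K * theta ^ vdist E (fst e) v * phi e"
    "\<And>e v w. e \<in> Edg \<Longrightarrow> cmod (OD e v w) \<le> K * theta ^ vdist E (fst e) v * phi e"
    using Val_OD_bound by blast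
  obtain B where B: "B \<ge> 1" "\<And>x. x \<in> {-1..1} \<Longrightarrow> cmod (cosw lam x) \<le> B" "\<And>x. x \<in> {-1..1} \<Longrightarrow> cmod (sinw lam x) \<le> B"
    using cosw_sinw_bounded[of lam] by blast
  have "cmod (Rterm E dR dB lam f e e' s) \<le> (2 * K * B + B) * (theta ^ vdist E (fst e') (fst e) * phi e)"
    if e: "e \<in> Edg" and e': "e' \<in> Edg" and s: "s \<in> {0..1}" for e e' s
  proof -
    define T where "T = theta ^ vdist E (fst e) (fst e') * phi e"
    have T0: "T \<ge> 0" using theta_pos phi_nonneg by (simp add: T_def)
    obtain x y where xy: "e' = (x, y)" by (cases e')
    \<comment> \<open>On the source edge the distance is 0 and \<open>T\<close> is
      \<open>phi e\<close>, so the Duhamel part fits the same bound.\<close>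
    have self: "cmod (self e e' (Pf lam (f e) s)) \<le> B * T"
    proof (cases "e' = e")
      case True
      have "cmod (Pf lam (f e) s) \<le> B * (LINT t:{0..1}|lborel. cmod (f e t))"
        using Pf_bound[OF f_int[OF e] B(3) s] by simp
      also have "\<dots> \<le> B * phi e" using f_L1[OF e] B(1) by (intro mult_left_mono) auto
      finally show ?thesis using True by (simp add: self_def T_def)
    qed (use T0 B in \<open>simp add: self_def\<close>)
    have "cmod (Rterm E dR dB lam f e e' s) = cmod (Val e x * cosw lam s + OD e x y * sinw lam s - self e e' (Pf lam (f e) s))"
      using edge_formula(1)[OF e e'[unfolded xy]] s unfolding xy by simp
    also have "\<dots> \<le> cmod (Val e x * cosw lam s) + cmod (OD e x y * sinw lam s) + cmod (self e e' (Pf lam (f e) s))"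
      by (meson norm_triangle_ineq norm_triangle_ineq4 add_right_mono order_trans)
    also have "\<dots> \<le> K * T * B + K * T * B + B * T"
      unfolding norm_mult using K(2)[OF e, of x] K(3)[OF e, of x y] B s self K(1) T0
      by (intro add_mono mult_mono) (auto simp: T_def xy mult_ac)
    also have "\<dots> = (2 * K * B + B) * T" by (simp add: algebra_simps)
    finally show ?thesis by (simp add: T_def vdist_sym)
  qed
  moreover have "2 * K * B + B \<ge> 0" using K B by simp
  ultimately show ?thesis by blast
qed

end


section \<open>Convergence and existence\<close>

lemma has_sum_minus:
  fixes f g :: "'a \<Rightarrow> 'b::topological_ab_group_add"
  assumes "(f has_sum a) A" "(g has_sum b) A"
  shows "((\<lambda>x. f x - g x) has_sum (a - b)) A"
proof -
  have "((\<lambda>x. - g x) has_sum - b) A" using assms(2) by (subst has_sum_uminus) simp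
  from has_sum_add[OF assms(1) this] show ?thesis by simp
qed

lemma has_sum_finite_sum:
  fixes f :: "'i \<Rightarrow> 'a \<Rightarrow> 'b::topological_comm_monoid_add"
  assumes "finite I" "\<And>i. i \<in> I \<Longrightarrow> (f i has_sum s i) A"
  shows "((\<lambda>x. \<Sum>i\<in>I. f i x) has_sum (\<Sum>i\<in>I. s i)) A"
  using assms
proof (induction I rule: finite_induct)
  case empty
  show ?case by (simp add: has_sum_0)
next
  case (insert i I)
  then have "((\<lambda>x. f i x + (\<Sum>i\<in>I. f i x)) has_sum (s i + (\<Sum>i\<in>I. s i))) A"
    by (intro has_sum_add) auto
  then show ?case using insert by simp
qed

lemma has_sum_single:
  assumes "a \<in> S"
  shows "((\<lambda>x. if a = x then h x else 0) has_sum h a) S"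
proof -
  have "(h has_sum sum h {a}) {a}" by (rule has_sum_finite) simp
  moreover have "((\<lambda>x. if a = x then h x else 0) has_sum sum h {a}) S \<longleftrightarrow> (h has_sum sum h {a}) {a}"
    by (rule has_sum_cong_neutral) (use assms in auto)
  ultimately show ?thesis by simp
qed

lemma set_borel_measurable_lin:
  fixes u v :: "real \<Rightarrow> complex"
  assumes "set_borel_measurable lborel S u" "set_borel_measurable lborel S v"
  shows "set_borel_measurable lborel S (\<lambda>t. a * u t + b * v t)"
proof -
  have "(\<lambda>t. a * (indicator S t *\<^sub>R u t) + b * (indicator S t *\<^sub>R v t)) \<in> borel_measurable lborel"
    using assms unfolding set_borel_measurable_def
    by (intro borel_measurable_add borel_measurable_times borel_measurable_const)
  moreover have "(\<lambda>t. a * (indicator S t *\<^sub>R u t) + b * (indicator S t *\<^sub>R v t))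
      = (\<lambda>t. indicator S t *\<^sub>R (a * u t + b * v t))"
    by (auto simp: indicator_def)
  ultimately show ?thesis by (simp add: set_borel_measurable_def)
qed

lemma L2_density_measurable:
  fixes u :: "real \<Rightarrow> complex"
  assumes "set_borel_measurable lborel {0..1} u"
  shows "(\<lambda>t. ennreal ((cmod (u t))\<^sup>2) * indicator {0..1} t) \<in> borel_measurable lborel"
proof -
  have "(\<lambda>t. indicator {0..1} t *\<^sub>R u t) \<in> borel_measurable lborel"
    using assms by (simp add: set_borel_measurable_def)
  from measurable_compose[OF this borel_measurable_norm]
  have "(\<lambda>t. ennreal ((cmod (indicator {0..1} t *\<^sub>R u t))\<^sup>2)) \<in> borel_measurable lborel"
    by (intro measurable_compose[OF _ measurable_ennreal] borel_measurable_power)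
  moreover have "(\<lambda>t. ennreal ((cmod (indicator {0..1} t *\<^sub>R u t))\<^sup>2))
      = (\<lambda>t. ennreal ((cmod (u t))\<^sup>2) * indicator {0..1} t)"
    by (auto simp: indicator_def)
  ultimately show ?thesis by metis
qed

lemma in_L2_lin:
  assumes u: "in_L2 E red u" and v: "in_L2 E red v"
  shows "in_L2 E red (\<lambda>e t. a * u e t + b * v e t)"
proof -
  define A where "A = 2 * (cmod a)\<^sup>2"
  define B where "B = 2 * (cmod b)\<^sup>2"
  have A0: "A \<ge> 0" "B \<ge> 0" by (auto simp: A_def B_def)
  let ?N = "\<lambda>u e. \<integral>\<^sup>+ t. ennreal ((cmod (u e t))\<^sup>2) * indicator {0..1} t \<partial>lborel"
  have pw: "(cmod (a * x + b * y))\<^sup>2 \<le> A * (cmod x)\<^sup>2 + B * (cmod y)\<^sup>2" for x y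
  proof -
    have "(cmod (a * x + b * y))\<^sup>2 \<le> (cmod a * cmod x + cmod b * cmod y)\<^sup>2"
      using norm_triangle_ineq[of "a * x" "b * y"] by (intro power_mono) (auto simp: norm_mult)
    also have "\<dots> \<le> 2 * (cmod a * cmod x)\<^sup>2 + 2 * (cmod b * cmod y)\<^sup>2"
      using zero_le_power2[of "cmod a * cmod x - cmod b * cmod y"] by (simp add: power2_diff power2_sum)
    finally show ?thesis by (simp add: A_def B_def power_mult_distrib)
  qed
  have each: "?N (\<lambda>e t. a * u e t + b * v e t) e \<le> ennreal A * ?N u e + ennreal B * ?N v e"
    if "e \<in> edges E red" for e
  proof -
    have mu: "(\<lambda>t. ennreal ((cmod (u e t))\<^sup>2) * indicator {0..1} t) \<in> borel_measurable lborel"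
      and mv: "(\<lambda>t. ennreal ((cmod (v e t))\<^sup>2) * indicator {0..1} t) \<in> borel_measurable lborel"
      using u v that L2_density_measurable unfolding in_L2_def by blast+
    have "?N (\<lambda>e t. a * u e t + b * v e t) e \<le>
      (\<integral>\<^sup>+ t. ennreal A * (ennreal ((cmod (u e t))\<^sup>2) * indicator {0..1} t)
        + ennreal B * (ennreal ((cmod (v e t))\<^sup>2) * indicator {0..1} t) \<partial>lborel)"
    proof (intro nn_integral_mono)
      fix t
      have "ennreal ((cmod (a * u e t + b * v e t))\<^sup>2) \<le> ennreal (A * (cmod (u e t))\<^sup>2 + B * (cmod (v e t))\<^sup>2)"
        using pw by (rule ennreal_leI)
      also have "\<dots> = ennreal A * ennreal ((cmod (u e t))\<^sup>2) + ennreal B * ennreal ((cmod (v e t))\<^sup>2)"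
        using A0 by (simp add: ennreal_mult ennreal_plus)
      finally show "ennreal ((cmod (a * u e t + b * v e t))\<^sup>2) * indicator {0..1} t
         \<le> ennreal A * (ennreal ((cmod (u e t))\<^sup>2) * indicator {0..1} t)
           + ennreal B * (ennreal ((cmod (v e t))\<^sup>2) * indicator {0..1} t)"
        by (auto simp: indicator_def)
    qed
    also have "\<dots> = ennreal A * ?N u e + ennreal B * ?N v e"
      using mu mv by (simp add: nn_integral_add nn_integral_cmult)
    finally show ?thesis .
  qed
  have "L2sq E red (\<lambda>e t. a * u e t + b * v e t) \<le> ennreal A * L2sq E red u + ennreal B * L2sq E red v"
  proof (rule L2sq_le)
    fix F assume F: "finite F" "F \<subseteq> edges E red"
    have "(\<Sum>e\<in>F. ?N (\<lambda>e t. a * u e t + b * v e t) e) \<le> (\<Sum>e\<in>F. ennreal A * ?N u e + ennreal B * ?N v e)"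
      using each F by (intro sum_mono) auto
    also have "\<dots> = ennreal A * (\<Sum>e\<in>F. ?N u e) + ennreal B * (\<Sum>e\<in>F. ?N v e)"
      by (simp add: sum.distrib sum_distrib_left)
    also have "\<dots> \<le> ennreal A * L2sq E red u + ennreal B * L2sq E red v"
      using L2sq_ge[OF F] by (intro add_mono mult_left_mono) auto
    finally show "(\<Sum>e\<in>F. ?N (\<lambda>e t. a * u e t + b * v e t) e)
       \<le> ennreal A * L2sq E red u + ennreal B * L2sq E red v" .
  qed
  also have "\<dots> < \<infinity>"
    using u v by (simp add: in_L2_def ennreal_mult_less_top)
  finally show ?thesis
    using u v by (auto simp: in_L2_def intro!: set_borel_measurable_lin)
qed

context resolvent
begin

text \<open>Root of the Schur weight. It may be any vertex, since the constant \<open>MM\<close> is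
  independent of it.\<close>

definition base_vertex :: 'v where "base_vertex = undefined"
definition MM :: real where "MM = (real (dR + dB) + 1) ^ 3 / (1 - theta * kap)\<^sup>2"

sublocale sk: schur_kernel Edg "\<lambda>e e'. theta ^ vdist E (fst e) (fst e')" "\<lambda>e. wt base_vertex (fst e)" MM
  unfolding MM_def using theta_pos theta_kap by (intro edge_schur) auto

lemma phi_summable: "(\<lambda>e. (phi e)\<^sup>2) summable_on Edg"
proof (rule nonneg_bdd_above_summable_on)
  obtain c where c: "L2sq E red f = ennreal c" "c \<ge> 0"
    using fL2 by (cases "L2sq E red f") (auto simp: in_L2_def)
  have "(\<Sum>e\<in>F. (phi e)\<^sup>2) \<le> c" if F: "finite F" "F \<subseteq> Edg" for F
  proof -
    have "ennreal (\<Sum>e\<in>F. (phi e)\<^sup>2) = (\<Sum>e\<in>F. ennreal ((phi e)\<^sup>2))" by (simp add: sum_ennreal)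
    also have "\<dots> = (\<Sum>e\<in>F. \<integral>\<^sup>+ t. ennreal ((cmod (f e t))\<^sup>2) * indicator {0..1} t \<partial>lborel)"
      using F f_nn by (intro sum.cong) auto
    also have "\<dots> \<le> ennreal c" using L2sq_ge[OF F, of f] c by simp
    finally show ?thesis using c(2) by simp
  qed
  then show "bdd_above (sum (\<lambda>e. (phi e)\<^sup>2) ` {F. F \<subseteq> Edg \<and> finite F})"
    by (intro bdd_aboveI[of _ c]) auto
qed simp

lemma majorant_summable:
  "e' \<in> Edg \<Longrightarrow> J \<subseteq> Edg \<Longrightarrow> (\<lambda>e. theta ^ vdist E (fst e') (fst e) * phi e) summable_on J"
  using phi_summable phi_nonneg summable_on_subset_banach by (intro sk.schur_summable) blast+

lemma majorised_abs_summable: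
  assumes "e' \<in> Edg" "J \<subseteq> Edg"
    and le: "\<And>e. e \<in> Edg \<Longrightarrow> cmod (h e) \<le> K * (theta ^ vdist E (fst e') (fst e) * phi e)"
  shows "(\<lambda>e. cmod (h e)) summable_on J"
proof (rule Infinite_Sum.abs_summable_on_comparison_test)
  have "(\<lambda>e. K * (theta ^ vdist E (fst e') (fst e) * phi e)) summable_on J"
    by (rule summable_on_cmult_right) (rule majorant_summable[OF assms(1,2)])
  then show "(\<lambda>e. norm (K * (theta ^ vdist E (fst e') (fst e) * phi e))) summable_on J"
    by (rule summable_on_iff_abs_summable_on_real[THEN iffD1])
  show "cmod (h e) \<le> norm (K * (theta ^ vdist E (fst e') (fst e) * phi e))" if "e \<in> J" for e
    using le[of e] that assms(2) by (auto intro: order_trans[OF _ abs_ge_self])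
qed

text \<open>Coefficients are summed instead of functions: \<open>g\<close> and \<open>g1\<close>
  below become closed formulas, and no series is differentiated term by term.\<close>

definition SA :: "'v \<Rightarrow> complex" where "SA x = (\<Sum>\<^sub>\<infinity>e\<in>Edg. Val e x)"
definition SB :: "'v \<Rightarrow> 'v \<Rightarrow> complex" where "SB x y = (\<Sum>\<^sub>\<infinity>e\<in>Edg. OD e x y)"

lemma SA_sum: "(x, y) \<in> Edg \<Longrightarrow> ((\<lambda>e. Val e x) has_sum SA x) Edg"
  and SB_sum: "(x, y) \<in> Edg \<Longrightarrow> ((\<lambda>e. OD e x y) has_sum SB x y) Edg"
proof -
  assume xy: "(x, y) \<in> Edg"
  obtain K where K: "\<And>e v. e \<in> Edg \<Longrightarrow> cmod (Val e v) \<le> K * theta ^ vdist E (fst e) v * phi e"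
    "\<And>e v w. e \<in> Edg \<Longrightarrow> cmod (OD e v w) \<le> K * theta ^ vdist E (fst e) v * phi e"
    using Val_OD_bound by blast
  have "(\<lambda>e. Val e x) summable_on Edg"
    by (rule abs_summable_summable[OF majorised_abs_summable[OF xy order_refl, of _ K]])
      (use K(1)[of _ x] in \<open>simp add: vdist_sym[of x] mult.assoc\<close>)
  then show "((\<lambda>e. Val e x) has_sum SA x) Edg" by (simp add: SA_def)
  have "(\<lambda>e. OD e x y) summable_on Edg"
    by (rule abs_summable_summable[OF majorised_abs_summable[OF xy order_refl, of _ K]])
      (use K(2)[of _ x y] in \<open>simp add: vdist_sym[of x] mult.assoc\<close>)
  then show "((\<lambda>e. OD e x y) has_sum SB x y) Edg" by (simp add: SB_def)
qed

definition g :: "'v \<times> 'v \<Rightarrow> real \<Rightarrow> complex" where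
  "g e s = SA (fst e) * cosw lam s + SB (fst e) (snd e) * sinw lam s - Pf lam (f e) s"
definition g1 :: "'v \<times> 'v \<Rightarrow> real \<Rightarrow> complex" where
  "g1 e s = SB (fst e) (snd e) * cosw lam s - lam * SA (fst e) * sinw lam s - Qf lam (f e) s"
text \<open>Dictated by the equation; that it is the derivative of \<open>g1\<close> is left to
  \<open>g1_integral\<close>. The form of a linear combination fits
  \<open>in_L2_lin\<close>.\<close>

definition g2 :: "'v \<times> 'v \<Rightarrow> real \<Rightarrow> complex" where
  "g2 e s = - lam * g e s + (- 1) * f e s"

lemma self_sum: "e' \<in> Edg \<Longrightarrow> ((\<lambda>e. self e e' (h e)) has_sum h e') Edg"
  unfolding self_def by (rule has_sum_single)

lemma Rterm_sum:
  assumes e': "e' \<in> Edg" and s: "s \<in> {0..1}"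
  shows "((\<lambda>e. Rterm E dR dB lam f e e' s) has_sum g e' s) Edg"
proof -
  obtain x y where xy: "e' = (x, y)" by (cases e')
  have "((\<lambda>e. Val e x * cosw lam s + OD e x y * sinw lam s - self e e' (Pf lam (f e) s)) has_sum g e' s) Edg"
    unfolding g_def using e' xy
    by (auto intro!: has_sum_minus has_sum_add has_sum_cmult_left SA_sum SB_sum self_sum)
  then show ?thesis
    using edge_formula(1)[OF _ e'[unfolded xy]] s unfolding xy
    by (subst has_sum_cong[where g = "\<lambda>e. Val e x * cosw lam s + OD e x y * sinw lam s - self e (x, y) (Pf lam (f e) s)"]) auto
qed

text \<open>At the blue end the series reduce to vertex data. The value series depends on
  \<open>y\<close> alone, which gives continuity there; the derivative series feeds
  \<open>kirchhoff_vertex\<close>.\<close>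

lemma g_at_1_sum:
  assumes xy: "(x, y) \<in> Edg"
  shows "((\<lambda>e. Val e y) has_sum g (x, y) 1) Edg"
    and "((\<lambda>e. OD e y x) has_sum - g1 (x, y) 1) Edg"
proof -
  have "((\<lambda>e. Val e x * cc lam + OD e x y * ss lam - self e (x, y) (Pf lam (f e) 1)) has_sum g (x, y) 1) Edg"
    unfolding g_def cosw_1 sinw_1 using xy
    by (auto intro!: has_sum_minus has_sum_add has_sum_cmult_left SA_sum SB_sum self_sum)
  then show "((\<lambda>e. Val e y) has_sum g (x, y) 1) Edg"
    using edge_formula(2)[OF _ xy]
    by (subst has_sum_cong[where g = "\<lambda>e. Val e x * cc lam + OD e x y * ss lam - self e (x, y) (Pf lam (f e) 1)"]) auto
  have "((\<lambda>e. OD e x y * cc lam - lam * Val e x * ss lam - self e (x, y) (Qf lam (f e) 1)) has_sum g1 (x, y) 1) Edg"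
    unfolding g1_def cosw_1 sinw_1 using xy
    by (auto intro!: has_sum_minus has_sum_add has_sum_cmult_left has_sum_cmult_right SA_sum SB_sum self_sum)
  then have "((\<lambda>e. - OD e y x) has_sum g1 (x, y) 1) Edg"
    using edge_formula(3)[OF _ xy]
    by (subst has_sum_cong[where g = "\<lambda>e. OD e x y * cc lam - lam * Val e x * ss lam - self e (x, y) (Qf lam (f e) 1)"]) auto
  then show "((\<lambda>e. OD e y x) has_sum - g1 (x, y) 1) Edg" by (simp only: has_sum_uminus)
qed

lemma g_at_0: "g e 0 = SA (fst e)" and g1_at_0: "g1 e 0 = SB (fst e) (snd e)"
  by (simp_all add: g_def g1_def Pf_def Qf_def LINT_Icc_self del: atLeastAtMost_singleton)

lemma g_deriv: "e \<in> Edg \<Longrightarrow> t \<in> {0..1} \<Longrightarrow> (g e has_vector_derivative g1 e t) (at t within {0..1})"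
  unfolding g_def[abs_def] g1_def
  by (rule derivative_eq_intros refl Pf_has_derivative[OF f_int] | assumption | simp add: algebra_simps)+

lemma continuous_g1: "e \<in> Edg \<Longrightarrow> continuous_on {0..1} (g1 e)"
  unfolding g1_def[abs_def] by (intro continuous_intros continuous_on_Qf f_int)

lemma continuous_g: "e \<in> Edg \<Longrightarrow> continuous_on {0..1} (g e)"
  unfolding g_def[abs_def] by (intro continuous_intros continuous_on_Pf f_int)

lemma g1_integral:
  assumes e: "e \<in> Edg" and x: "x \<in> {0..1}"
  shows "g1 e x = g1 e 0 + (LINT t:{0..x}|lborel. g2 e t)"
proof -
  define a b where "a = SA (fst e)" and "b = SB (fst e) (snd e)"
  \<comment> \<open>\<open>g2\<close> is split into the second derivative of its trigonometric part,
    integrated by the fundamental theorem, and the Duhamel part, known from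
    \<open>Qf_eq_integral\<close>.\<close>
  define k where "k t = - lam * (a * cosw lam t + b * sinw lam t)" for t
  define m where "m t = b * cosw lam t - lam * a * sinw lam t" for t
  have ck: "continuous_on S k" for S unfolding k_def[abs_def] by (intro continuous_intros)
  have "(m has_vector_derivative k t) (at t within S)" for t S
    unfolding m_def[abs_def] k_def
    by (rule derivative_eq_intros refl | simp add: algebra_simps)+
  then have K: "(LINT t:{0..x}|lborel. k t) = m x - m 0"
    unfolding set_lebesgue_integral_def using x by (intro integral_FTC_Icc ck) auto
  have ik: "set_integrable lborel {0..x} k" by (rule borel_integrable_atLeastAtMost'[OF ck])
  have sub: "set_integrable lborel {0..x} h" if "set_integrable lborel {0..1} h" for h :: "real \<Rightarrow> complex"
    by (rule set_integrable_subset[OF that]) (use x in auto)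
  have iP: "set_integrable lborel {0..x} (Pf lam (f e))"
    by (intro sub borel_integrable_atLeastAtMost' continuous_on_Pf f_int e)
  have iq: "set_integrable lborel {0..x} (\<lambda>t. f e t - lam * Pf lam (f e) t)"
    by (intro set_integral_diff(1) sub f_int e set_integrable_mult_right iP)
  have "g2 e t = k t - (f e t - lam * Pf lam (f e) t)" for t
    by (simp add: g2_def g_def k_def a_def b_def algebra_simps)
  then have "(LINT t:{0..x}|lborel. g2 e t) = (LINT t:{0..x}|lborel. k t) - (LINT t:{0..x}|lborel. f e t - lam * Pf lam (f e) t)"
    using set_integral_diff(2)[OF ik iq] by simp
  also have "\<dots> = m x - m 0 - Qf lam (f e) x" using K Qf_eq_integral[OF f_int[OF e] x] by simp
  also have "\<dots> = g1 e x - g1 e 0"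
    unfolding g1_at_0 by (simp add: g1_def m_def a_def b_def)
  finally show ?thesis by simp
qed

text \<open>One constant serves all \<open>F\<close>: the empty set shows that \<open>g\<close> is
  in L2, large sets give convergence. The Schur test is applied to the edges outside
  \<open>F\<close>.\<close>

lemma remainder_L2:
  "\<exists>C\<ge>0. \<forall>F. finite F \<and> F \<subseteq> Edg \<longrightarrow>
     L2sq E red (\<lambda>e' t. g e' t - (\<Sum>e\<in>F. Rterm E dR dB lam f e e' t)) \<le> ennreal (C * (\<Sum>\<^sub>\<infinity>e\<in>Edg - F. (phi e)\<^sup>2))"
proof -
  obtain K where K: "K \<ge> 0" "\<And>e e' s. e \<in> Edg \<Longrightarrow> e' \<in> Edg \<Longrightarrow> s \<in> {0..1} \<Longrightarrow>
     cmod (Rterm E dR dB lam f e e' s) \<le> K * (theta ^ vdist E (fst e') (fst e) * phi e)"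
    using Rterm_bound by blast
  have "L2sq E red (\<lambda>e' t. g e' t - (\<Sum>e\<in>F. Rterm E dR dB lam f e e' t)) \<le> ennreal (K\<^sup>2 * MM\<^sup>2 * (\<Sum>\<^sub>\<infinity>e\<in>Edg - F. (phi e)\<^sup>2))"
    if F: "finite F" "F \<subseteq> Edg" for F
  proof (rule L2sq_le)
    fix H assume H: "finite H" "H \<subseteq> Edg"
    define \<tau> where "\<tau> e' = (\<Sum>\<^sub>\<infinity>e\<in>Edg - F. theta ^ vdist E (fst e') (fst e) * phi e)" for e' :: "'v \<times> 'v"
    have pw: "cmod (g e' s - (\<Sum>e\<in>F. Rterm E dR dB lam f e e' s)) \<le> K * \<tau> e'"
      if e': "e' \<in> Edg" and s: "s \<in> {0..1}" for e' s
    proof -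
      let ?R = "\<lambda>e. Rterm E dR dB lam f e e' s"
      have abs: "(\<lambda>e. cmod (?R e)) summable_on Edg - F"
        by (rule majorised_abs_summable[OF e', of _ _ K]) (use K(2) e' s in auto)
      have "g e' s = infsum ?R (F \<union> (Edg - F))"
        using infsumI[OF Rterm_sum[OF e' s]] F by (simp add: Un_absorb1)
      also have "\<dots> = infsum ?R F + infsum ?R (Edg - F)"
        using F abs_summable_summable[OF abs] by (intro infsum_Un_disjoint) auto
      finally have "g e' s - (\<Sum>e\<in>F. ?R e) = infsum ?R (Edg - F)" using F by simp
      also have "cmod \<dots> \<le> (\<Sum>\<^sub>\<infinity>e\<in>Edg - F. cmod (?R e))" by (rule norm_infsum_bound[OF abs])
      also have "\<dots> \<le> (\<Sum>\<^sub>\<infinity>e\<in>Edg - F. K * (theta ^ vdist E (fst e') (fst e) * phi e))"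
        by (rule infsum_mono) (use abs K(2) e' s majorant_summable[OF e'] in \<open>auto intro!: summable_on_cmult_right\<close>)
      also have "\<dots> = K * \<tau> e'" unfolding \<tau>_def by (rule infsum_cmult_right')
      finally show ?thesis .
    qed
    have "(\<Sum>e'\<in>H. \<integral>\<^sup>+ t. ennreal ((cmod (g e' t - (\<Sum>e\<in>F. Rterm E dR dB lam f e e' t)))\<^sup>2) * indicator {0..1} t \<partial>lborel)
      \<le> (\<Sum>e'\<in>H. ennreal (K\<^sup>2 * (\<tau> e')\<^sup>2))"
    proof (intro sum_mono)
      fix e' assume "e' \<in> H"
      then have e': "e' \<in> Edg" using H by auto
      have "(\<integral>\<^sup>+ t. ennreal ((cmod (g e' t - (\<Sum>e\<in>F. Rterm E dR dB lam f e e' t)))\<^sup>2) * indicator {0..1} t \<partial>lborel)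
        \<le> (\<integral>\<^sup>+ t. ennreal (K\<^sup>2 * (\<tau> e')\<^sup>2) * indicator {0..1::real} t \<partial>lborel)"
      proof (intro nn_integral_mono)
        fix t :: real
        have "(cmod (g e' t - (\<Sum>e\<in>F. Rterm E dR dB lam f e e' t)))\<^sup>2 \<le> K\<^sup>2 * (\<tau> e')\<^sup>2" if "t \<in> {0..1}"
          using power_mono[OF pw[OF e' that] norm_ge_zero, of 2] by (simp add: power_mult_distrib)
        then show "ennreal ((cmod (g e' t - (\<Sum>e\<in>F. Rterm E dR dB lam f e e' t)))\<^sup>2) * indicator {0..1} t
           \<le> ennreal (K\<^sup>2 * (\<tau> e')\<^sup>2) * indicator {0..1::real} t"
          by (auto simp: indicator_def intro!: ennreal_leI)
      qed
      also have "\<dots> = ennreal (K\<^sup>2 * (\<tau> e')\<^sup>2)" by (simp add: nn_integral_cmult)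
      finally show "(\<integral>\<^sup>+ t. ennreal ((cmod (g e' t - (\<Sum>e\<in>F. Rterm E dR dB lam f e e' t)))\<^sup>2) * indicator {0..1} t \<partial>lborel)
        \<le> ennreal (K\<^sup>2 * (\<tau> e')\<^sup>2)" .
    qed
    also have "\<dots> = ennreal (K\<^sup>2 * (\<Sum>e'\<in>H. (\<tau> e')\<^sup>2))"
      by (simp add: sum_ennreal sum_distrib_left)
    also have "\<dots> \<le> ennreal (K\<^sup>2 * (MM\<^sup>2 * (\<Sum>\<^sub>\<infinity>e\<in>Edg - F. (phi e)\<^sup>2)))"
      unfolding \<tau>_def using H phi_nonneg summable_on_subset_banach[OF phi_summable, of "Edg - F"]
      by (intro ennreal_leI mult_left_mono sk.schur_infinite) auto
    finally show "(\<Sum>e'\<in>H. \<integral>\<^sup>+ t. ennreal ((cmod (g e' t - (\<Sum>e\<in>F. Rterm E dR dB lam f e e' t)))\<^sup>2) * indicator {0..1} t \<partial>lborel)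
      \<le> ennreal (K\<^sup>2 * MM\<^sup>2 * (\<Sum>\<^sub>\<infinity>e\<in>Edg - F. (phi e)\<^sup>2))" by (simp add: mult.assoc)
  qed
  then show ?thesis by (intro exI[of _ "K\<^sup>2 * MM\<^sup>2"]) auto
qed

lemma in_L2_g: "in_L2 E red g"
proof -
  obtain C where C: "L2sq E red (\<lambda>e' t. g e' t - (\<Sum>e\<in>{}. Rterm E dR dB lam f e e' t)) \<le> ennreal (C * (\<Sum>\<^sub>\<infinity>e\<in>Edg - {}. (phi e)\<^sup>2))"
    using remainder_L2 by blast
  then have "L2sq E red g < \<infinity>" by (simp add: le_less_trans)
  then show ?thesis unfolding in_L2_def by (auto intro!: set_borel_measurable_Icc continuous_g)
qed

lemma in_domL_g: "in_domL E red g g1 g2"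
proof -
  have c0: "g e 0 = g e' 0" if "fst e = fst e'" for e e' using that by (simp add: g_at_0)
  have c1: "g e 1 = g e' 1" if "e \<in> Edg" "e' \<in> Edg" "snd e = snd e'" for e e'
  proof -
    have "((\<lambda>e0. Val e0 (snd e)) has_sum g e 1) Edg" "((\<lambda>e0. Val e0 (snd e')) has_sum g e' 1) Edg"
      using g_at_1_sum(1)[of "fst e" "snd e"] g_at_1_sum(1)[of "fst e'" "snd e'"] that(1,2)
      by (metis prod.collapse)+
    then show ?thesis using that(3) has_sum_unique by metis
  qed
  have L2: "in_L2 E red g2" unfolding g2_def[abs_def] by (rule in_L2_lin[OF in_L2_g fL2])
  have int: "set_integrable lborel {0..1} (g2 e)" if e: "e \<in> Edg" for e
  proof (rule L2_imp_L1(1))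
    show "set_borel_measurable lborel {0..1} (g2 e)" using L2 e by (simp add: in_L2_def)
    have "(\<Sum>e\<in>{e}. \<integral>\<^sup>+ t. ennreal ((cmod (g2 e t))\<^sup>2) * indicator {0..1} t \<partial>lborel) \<le> L2sq E red g2"
      using e by (intro L2sq_ge) auto
    also have "\<dots> < \<infinity>" using L2 by (simp add: in_L2_def)
    finally show "(\<integral>\<^sup>+ t. ennreal ((cmod (g2 e t))\<^sup>2) * indicator {0..1} t \<partial>lborel) < \<infinity>" by simp
  qed
  have k0: "(\<Sum>b\<in>{b. E v b}. g1 (v, b) 0) = 0" if v: "red v" for v
  proof -
    have "((\<lambda>e. \<Sum>b\<in>{b. E v b}. OD e v b) has_sum (\<Sum>b\<in>{b. E v b}. SB v b)) Edg"
      using v by (intro has_sum_finite_sum SB_sum) (auto simp: edges_def)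
    moreover have "((\<lambda>e. \<Sum>b\<in>{b. E v b}. OD e v b) has_sum 0) Edg"
      by (rule has_sum_0) (rule kirchhoff_vertex)
    ultimately show ?thesis using has_sum_unique by (simp add: g1_at_0) blast
  qed
  have k1: "(\<Sum>r\<in>{r. E v r}. - g1 (r, v) 1) = 0" if v: "\<not> red v" for v
  proof -
    have "((\<lambda>e. \<Sum>r\<in>{r. E v r}. OD e v r) has_sum (\<Sum>r\<in>{r. E v r}. - g1 (r, v) 1)) Edg"
    proof (intro has_sum_finite_sum g_at_1_sum(2))
      show "(r, v) \<in> Edg" if "r \<in> {r. E v r}" for r
        using that v adj_sym adj_colour[of v r] by (auto simp: edges_def)
    qed simp
    moreover have "((\<lambda>e. \<Sum>r\<in>{r. E v r}. OD e v r) has_sum 0) Edg"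
      by (rule has_sum_0) (rule kirchhoff_vertex)
    ultimately show ?thesis using has_sum_unique by blast
  qed
  show ?thesis unfolding in_domL_def
    using c0 c1 g_deriv continuous_g1 int g1_integral in_L2_g L2 k0 k1 by blast
qed

lemma solves_g: "solves_res E red lam f g"
  unfolding solves_res_def using in_domL_g by (intro exI[of _ g1] exI[of _ g2]) (auto simp: g2_def)

lemma L2_has_sum_g: "L2_has_sum E red (Rterm E dR dB lam f) g"
  unfolding L2_has_sum_def
proof (intro allI impI)
  fix \<epsilon> :: real assume \<epsilon>: "\<epsilon> > 0"
  obtain C where C: "C \<ge> 0" "\<And>F. finite F \<Longrightarrow> F \<subseteq> Edg \<Longrightarrow>
     L2sq E red (\<lambda>e' t. g e' t - (\<Sum>e\<in>F. Rterm E dR dB lam f e e' t)) \<le> ennreal (C * (\<Sum>\<^sub>\<infinity>e\<in>Edg - F. (phi e)\<^sup>2))"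
    using remainder_L2 by blast
  let ?S = "\<Sum>\<^sub>\<infinity>e\<in>Edg. (phi e)\<^sup>2"
  \<comment> \<open>Adding 1 covers \<open>C = 0\<close> and makes the final inequality
    strict.\<close>
  define \<delta> where "\<delta> = \<epsilon> / (C + 1)"
  have \<delta>: "\<delta> > 0" "C * \<delta> < \<epsilon>" using \<epsilon> C(1) by (auto simp: \<delta>_def field_simps)
  have "\<forall>\<^sub>F F in finite_subsets_at_top Edg. dist (\<Sum>e\<in>F. (phi e)\<^sup>2) ?S < \<delta>"
    using tendstoD[OF infsum_tendsto[OF phi_summable] \<delta>(1)] .
  then obtain F0 where F0: "finite F0" "F0 \<subseteq> Edg"
    "\<And>F. finite F \<Longrightarrow> F0 \<subseteq> F \<Longrightarrow> F \<subseteq> Edg \<Longrightarrow> dist (\<Sum>e\<in>F. (phi e)\<^sup>2) ?S < \<delta>"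
    unfolding eventually_finite_subsets_at_top by metis
  show "\<exists>F0. finite F0 \<and> F0 \<subseteq> Edg \<and> (\<forall>F. finite F \<and> F0 \<subseteq> F \<and> F \<subseteq> Edg \<longrightarrow>
      L2sq E red (\<lambda>e' t. g e' t - (\<Sum>e\<in>F. Rterm E dR dB lam f e e' t)) < ennreal \<epsilon>)"
  proof (intro exI[of _ F0] conjI allI impI)
    fix F assume F: "finite F \<and> F0 \<subseteq> F \<and> F \<subseteq> Edg"
    have "?S = infsum (\<lambda>e. (phi e)\<^sup>2) (F \<union> (Edg - F))" using F by (simp add: Un_absorb1)
    also have "\<dots> = infsum (\<lambda>e. (phi e)\<^sup>2) F + infsum (\<lambda>e. (phi e)\<^sup>2) (Edg - F)"
      using F summable_on_subset_banach[OF phi_summable, of "Edg - F"] by (intro infsum_Un_disjoint) auto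
    finally have "infsum (\<lambda>e. (phi e)\<^sup>2) (Edg - F) = ?S - (\<Sum>e\<in>F. (phi e)\<^sup>2)" using F by simp
    also have "\<dots> \<le> \<delta>" using F0(3)[of F] F by (auto simp: dist_real_def abs_less_iff)
    finally have "C * infsum (\<lambda>e. (phi e)\<^sup>2) (Edg - F) \<le> C * \<delta>" using C(1) by (rule mult_left_mono)
    then have "C * infsum (\<lambda>e. (phi e)\<^sup>2) (Edg - F) < \<epsilon>" using \<delta>(2) by linarith
    then have "ennreal (C * infsum (\<lambda>e. (phi e)\<^sup>2) (Edg - F)) < ennreal \<epsilon>"
      using \<epsilon> by (simp add: ennreal_lessI)
    then show "L2sq E red (\<lambda>e' t. g e' t - (\<Sum>e\<in>F. Rterm E dR dB lam f e e' t)) < ennreal \<epsilon>"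
      using C(2)[of F] F by (meson le_less_trans)
  qed (use F0 in auto)
qed

end


section \<open>Uniqueness\<close>

text \<open>From any even index two steps act by the same matrix T. Its first row is the first
  claim; Cayley-Hamilton gives the scalar recursions for values and derivatives.\<close>

lemma two_step:
  fixes a b :: "nat \<Rightarrow> complex"
  assumes a: "\<And>n. a (Suc n) = a n * cc lam + b n * ss lam"
    and b: "\<And>n. b (Suc n) = (b n * cc lam - lam * a n * ss lam) / of_nat (if odd (Suc n) then d1 else d2)"
    and n: "even n"
  shows "a (n + 2) = ((cc lam)\<^sup>2 + ss lam * cc' lam / of_nat d1) * a n + ss lam * cc lam * (1 + 1 / of_nat d1) * b n"
    and "a (n + 4) = T0_trace d1 d2 lam * a (n + 2) - a n / (of_nat d1 * of_nat d2)"
    and "b (n + 4) = T0_trace d1 d2 lam * b (n + 2) - b n / (of_nat d1 * of_nat d2)"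
proof -
  define c s p q where "c = cc lam" and "s = ss lam"
    and "p = 1 / (of_nat d1 :: complex)" and "q = 1 / (of_nat d2 :: complex)"
  define T11 T12 T21 T22 where "T11 = c * c - lam * s * s * p" and "T12 = s * c * (1 + p)"
    and "T21 = - lam * s * c * (1 + p) * q" and "T22 = (c * c * p - lam * s * s) * q"
  have det: "c * c + lam * s * s = 1" using cc_ss[of lam] by (simp add: c_def s_def)
  have a': "a (m + 2) = T11 * a m + T12 * b m" and b': "b (m + 2) = T21 * a m + T22 * b m" if "even m" for m
  proof -
    have b1: "b (Suc m) = (b m * c - lam * a m * s) * p" using b[of m] that by (simp add: c_def s_def p_def)
    have b2: "b (Suc (Suc m)) = (b (Suc m) * c - lam * a (Suc m) * s) * q"
      using b[of "Suc m"] that by (simp add: c_def s_def q_def)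
    have a1: "a (Suc m) = a m * c + b m * s" and a2: "a (Suc (Suc m)) = a (Suc m) * c + b (Suc m) * s"
      using a by (auto simp: c_def s_def)
    have m2: "m + 2 = Suc (Suc m)" by simp
    show "a (m + 2) = T11 * a m + T12 * b m" "b (m + 2) = T21 * a m + T22 * b m"
      unfolding m2 a2 b2 a1 b1 by (simp_all add: T11_def T12_def T21_def T22_def algebra_simps)
  qed
  have tr: "T0_trace d1 d2 lam = T11 + T22"
    by (simp add: T0_trace_def T11_def T22_def c_def s_def p_def q_def cc'_eq power2_eq_square algebra_simps)
  have dt: "T11 * T22 - T12 * T21 = 1 / (of_nat d1 * of_nat d2)"
  proof -
    have "T11 * T22 - T12 * T21 = p * q * (c * c + lam * s * s)\<^sup>2"
      by (simp add: T11_def T12_def T21_def T22_def algebra_simps power2_eq_square)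
    then show ?thesis by (simp add: det) (simp add: p_def q_def)
  qed
  show "a (n + 2) = ((cc lam)\<^sup>2 + ss lam * cc' lam / of_nat d1) * a n + ss lam * cc lam * (1 + 1 / of_nat d1) * b n"
    unfolding a'[OF n] by (simp add: T11_def T12_def c_def s_def p_def cc'_eq power2_eq_square algebra_simps)
  have n2: "even (n + 2)" and n4: "n + 2 + 2 = n + 4" using n by auto
  have "a (n + 4) = (T11 + T22) * a (n + 2) - (T11 * T22 - T12 * T21) * a n"
    using a'[OF n2] unfolding n4 a'[OF n] b'[OF n] by (simp add: algebra_simps)
  then show "a (n + 4) = T0_trace d1 d2 lam * a (n + 2) - a n / (of_nat d1 * of_nat d2)"
    unfolding dt tr by simp
  have "b (n + 4) = (T11 + T22) * b (n + 2) - (T11 * T22 - T12 * T21) * b n"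
    using b'[OF n2] unfolding n4 a'[OF n] b'[OF n] by (simp add: algebra_simps)
  then show "b (n + 4) = T0_trace d1 d2 lam * b (n + 2) - b n / (of_nat d1 * of_nat d2)"
    unfolding dt tr by simp
qed

section \<open>The energy of a solution on one edge\<close>

definition wav :: "complex \<Rightarrow> complex \<Rightarrow> complex \<Rightarrow> real \<Rightarrow> complex" where
  "wav lam a b t = a * cosw lam t + b * sinw lam t"

definition J :: "(real \<Rightarrow> complex) \<Rightarrow> real" where
  "J w = integral {0..1} (\<lambda>t. (cmod (w t))\<^sup>2)"

lemma continuous_wav: "continuous_on S (wav lam a b)"
  unfolding wav_def[abs_def] by (intro continuous_intros)

lemma continuous_wav_sq: "continuous_on S (\<lambda>t. (cmod (wav lam a b t))\<^sup>2)"
  by (intro continuous_intros continuous_wav)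

text \<open>Holds for every \<open>w\<close>, as \<open>integral\<close> returns 0 on functions that
  are not integrable.\<close>

lemma J_nonneg: "J w \<ge> 0"
  unfolding J_def by (cases "(\<lambda>t. (cmod (w t))\<^sup>2) integrable_on {0..1}")
    (auto intro: integral_nonneg simp: not_integrable_integral)

text \<open>Zero energy makes the continuous function vanish on the edge; its value and one-sided
  derivative at 0 are the two coefficients.\<close>

lemma wav_zero:
  assumes "J (wav lam a b) = 0"
  shows "a = 0 \<and> b = 0"
proof -
  have z: "wav lam a b t = 0" if "t \<in> {0..1}" for t
    using assms that integral_eq_0_iff[OF continuous_wav_sq[of "{0..1}"]] by (simp add: J_def)
  have "((\<lambda>t. 0) has_vector_derivative 0) (at (0::real) within {0..1})" by simp
  then have "(wav lam a b has_vector_derivative 0) (at 0 within {0..1})"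
    by (rule has_vector_derivative_transform[rotated 2]) (auto simp: z)
  moreover have "(wav lam a b has_vector_derivative b) (at 0 within {0..1})"
    unfolding wav_def[abs_def] by (rule derivative_eq_intros refl | simp)+
  ultimately have "b = 0"
    using vector_derivative_unique_within[of "0::real" "{0..1}"] by (auto simp: at_within_Icc_at_right)
  then show ?thesis using z[of 0] by (simp add: wav_def)
qed

text \<open>Lets the energy bound pass from the averages to their combination with the decaying mode
  removed.\<close>

lemma wav_diff_J:
  "J (wav lam (a' - m * a) (b' - m * b)) \<le> 2 * J (wav lam a' b') + 2 * (cmod m)\<^sup>2 * J (wav lam a b)"
proof -
  let ?f = "\<lambda>t. 2 * (cmod (wav lam a' b' t))\<^sup>2 + 2 * (cmod m)\<^sup>2 * (cmod (wav lam a b t))\<^sup>2"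
  have i: "(\<lambda>t. (cmod (wav lam a b t))\<^sup>2) integrable_on {0..1}" for a b
    by (rule integrable_continuous_real[OF continuous_wav_sq])
  have "J (wav lam (a' - m * a) (b' - m * b)) \<le> integral {0..1} ?f"
    unfolding J_def
  proof (rule integral_le[OF i])
    show "?f integrable_on {0..1}"
      by (intro integrable_continuous_real continuous_intros continuous_wav_sq)
    fix t
    define x y where "x = cmod (wav lam a' b' t)" and "y = cmod (m * wav lam a b t)"
    have "wav lam (a' - m * a) (b' - m * b) t = wav lam a' b' t - m * wav lam a b t"
      by (simp add: wav_def algebra_simps)
    then have "cmod (wav lam (a' - m * a) (b' - m * b) t) \<le> x + y"
      unfolding x_def y_def by (metis norm_triangle_ineq4)
    then have "(cmod (wav lam (a' - m * a) (b' - m * b) t))\<^sup>2 \<le> (x + y)\<^sup>2" by (intro power_mono) auto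
    also have "\<dots> \<le> 2 * x\<^sup>2 + 2 * y\<^sup>2"
      using zero_le_power2[of "x - y"] by (simp add: power2_diff power2_sum)
    finally show "(cmod (wav lam (a' - m * a) (b' - m * b) t))\<^sup>2 \<le> ?f t"
      by (simp add: x_def y_def norm_mult power_mult_distrib)
  qed
  also have "\<dots> = 2 * J (wav lam a' b') + 2 * (cmod m)\<^sup>2 * J (wav lam a b)"
    unfolding J_def using i by (subst integral_add) (auto intro: integrable_on_mult_right)
  finally show ?thesis .
qed

lemma J_nn:
  assumes "continuous_on {0..1} w"
  shows "(\<integral>\<^sup>+ t. ennreal ((cmod (w t))\<^sup>2) * indicator {0..1} t \<partial>lborel) = ennreal (J w)"
proof -
  have c: "continuous_on {0..1} (\<lambda>t. (cmod (w t))\<^sup>2)" using assms by (intro continuous_intros)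
  have i: "set_integrable lborel {0..1} (\<lambda>t. (cmod (w t))\<^sup>2)" by (rule borel_integrable_atLeastAtMost'[OF c])
  have "(\<integral>\<^sup>+ t. ennreal ((cmod (w t))\<^sup>2) * indicator {0..1} t \<partial>lborel)
      = (\<integral>\<^sup>+ t. ennreal (indicator {0..1} t *\<^sub>R (cmod (w t))\<^sup>2) \<partial>lborel)"
    by (intro nn_integral_cong) (auto simp: indicator_def)
  also have "\<dots> = ennreal (LINT t:{0..1}|lborel. (cmod (w t))\<^sup>2)"
    unfolding set_lebesgue_integral_def
    using i unfolding set_integrable_def by (intro nn_integral_eq_integral) auto
  also have "\<dots> = ennreal (J w)" unfolding J_def set_borel_integral_eq_integral(2)[OF i] ..
  finally show ?thesis .
qed

lemma J_reflect:
  assumes c: "continuous_on {0..1} w"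
  shows "J (\<lambda>t. w (1 - t)) = J w"
proof -
  have c': "continuous_on {0..1} (\<lambda>t. w (1 - t))"
    by (rule continuous_on_compose2[OF c]) (auto intro: continuous_intros)
  have "(\<lambda>t. ennreal ((cmod (w t))\<^sup>2) * indicator {0..1} t) \<in> borel_measurable borel"
    using L2_density_measurable[OF set_borel_measurable_Icc[OF c]] by simp
  from nn_integral_real_affine[OF this, of "-1" 1]
  have "ennreal (J w) = (\<integral>\<^sup>+ t. ennreal ((cmod (w (1 - t)))\<^sup>2) * indicator {0..1} (1 - t) \<partial>lborel)"
    using J_nn[OF c] by simp
  also have "\<dots> = (\<integral>\<^sup>+ t. ennreal ((cmod (w (1 - t)))\<^sup>2) * indicator {0..1} t \<partial>lborel)"
    by (intro nn_integral_cong) (auto simp: indicator_def)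
  also have "\<dots> = ennreal (J (\<lambda>t. w (1 - t)))" by (rule J_nn[OF c'])
  finally show ?thesis using J_nonneg by simp
qed

text \<open>Meant for the difference of two solutions, with the differential equation already
  integrated on each edge; \<open>u1\<close> occurs only through its values at the two ends.\<close>

locale homogeneous = biregular E red dR dB
  for E :: "'v \<Rightarrow> 'v \<Rightarrow> bool" and red dR dB +
  fixes lam :: complex and u u1 :: "'v \<times> 'v \<Rightarrow> real \<Rightarrow> complex"
  assumes cont0: "\<And>e e'. e \<in> edges E red \<Longrightarrow> e' \<in> edges E red \<Longrightarrow> fst e = fst e' \<Longrightarrow> u e 0 = u e' 0"
    and cont1: "\<And>e e'. e \<in> edges E red \<Longrightarrow> e' \<in> edges E red \<Longrightarrow> snd e = snd e' \<Longrightarrow> u e 1 = u e' 1"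
    and form: "\<And>e t. e \<in> edges E red \<Longrightarrow> t \<in> {0..1} \<Longrightarrow> u e t = wav lam (u e 0) (u1 e 0) t"
    and form1: "\<And>e. e \<in> edges E red \<Longrightarrow> u1 e 1 = u1 e 0 * cc lam - lam * u e 0 * ss lam"
    and kir0: "\<And>v. red v \<Longrightarrow> (\<Sum>b\<in>{b. E v b}. u1 (v, b) 0) = 0"
    and kir1: "\<And>v. \<not> red v \<Longrightarrow> (\<Sum>r\<in>{r. E v r}. - u1 (r, v) 1) = 0"
    and uL2: "L2sq E red u < \<infinity>"
begin

text \<open>Value, and with \<open>dd\<close> the derivative, at \<open>x\<close> along the edge
  oriented from \<open>x\<close> to \<open>y\<close>. Oriented edges allow the averaging to start in
  either direction of the given edge, whatever the colours.\<close>

definition dv :: "'v \<Rightarrow> 'v \<Rightarrow> complex" where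
  "dv x y = (if red x then u (x, y) 0 else u (y, x) 1)"
definition dd :: "'v \<Rightarrow> 'v \<Rightarrow> complex" where
  "dd x y = (if red x then u1 (x, y) 0 else - u1 (y, x) 1)"
definition edg :: "'v \<Rightarrow> 'v \<Rightarrow> 'v \<times> 'v" where
  "edg x y = (if red x then (x, y) else (y, x))"

lemma edg_in: "E x y \<Longrightarrow> edg x y \<in> edges E red"
  using adj_colour[of x y] adj_sym[of x y] by (auto simp: edg_def edges_def)

lemma dv_cong: "E x y \<Longrightarrow> E x z \<Longrightarrow> dv x y = dv x z"
  using edg_in[of x y] edg_in[of x z] cont0[of "(x, y)" "(x, z)"] cont1[of "(y, x)" "(z, x)"]
  by (auto simp: dv_def edg_def split: if_splits)

lemma dd_sum: "(\<Sum>y\<in>{y. E x y}. dd x y) = 0"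
  using kir0[of x] kir1[of x] by (cases "red x") (simp_all add: dd_def)

lemma dart_step:
  assumes "E x y"
  shows "dv y x = dv x y * cc lam + dd x y * ss lam"
    and "- dd y x = dd x y * cc lam - lam * dv x y * ss lam"
proof -
  have u1e: "u e 1 = u e 0 * cc lam + u1 e 0 * ss lam" if "e \<in> edges E red" for e
    using form[OF that, of 1] by (simp add: wav_def cosw_1 sinw_1)
  have "dv y x = dv x y * cc lam + dd x y * ss lam \<and> - dd y x = dd x y * cc lam - lam * dv x y * ss lam"
  proof (cases "red x")
    case True
    then have "(x, y) \<in> edges E red" "\<not> red y" using assms adj_colour by (auto simp: edges_def)
    then show ?thesis using True u1e form1 by (simp add: dv_def dd_def)
  next
    case False
    then have e: "(y, x) \<in> edges E red" "red y" using assms adj_colour adj_sym by (auto simp: edges_def)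
    from transfer_inverse[OF u1e[OF e(1)] form1[OF e(1)]] show ?thesis
      using False e by (simp add: dv_def dd_def)
  qed
  then show "dv y x = dv x y * cc lam + dd x y * ss lam" "- dd y x = dd x y * cc lam - lam * dv x y * ss lam"
    by blast+
qed

lemma J_dart:
  assumes "E x y"
  shows "ennreal (J (wav lam (dv x y) (dd x y)))
    = (\<integral>\<^sup>+ t. ennreal ((cmod (u (edg x y) t))\<^sup>2) * indicator {0..1} t \<partial>lborel)"
proof -
  define e where "e = edg x y"
  have e: "e \<in> edges E red" using edg_in assms by (simp add: e_def)
  have "(\<integral>\<^sup>+ t. ennreal ((cmod (u e t))\<^sup>2) * indicator {0..1} t \<partial>lborel)
      = (\<integral>\<^sup>+ t. ennreal ((cmod (wav lam (u e 0) (u1 e 0) t))\<^sup>2) * indicator {0..1} t \<partial>lborel)"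
  proof (intro nn_integral_cong)
    fix t :: real
    show "ennreal ((cmod (u e t))\<^sup>2) * indicator {0..1} t
        = ennreal ((cmod (wav lam (u e 0) (u1 e 0) t))\<^sup>2) * indicator {0..1} t"
      by (cases "t \<in> {0..1}") (simp only: form[OF e, of t], simp)
  qed
  also have "\<dots> = ennreal (J (wav lam (u e 0) (u1 e 0)))" by (rule J_nn[OF continuous_wav])
  also have "J (wav lam (u e 0) (u1 e 0)) = J (wav lam (dv x y) (dd x y))"
  proof (cases "red x")
    case True
    then show ?thesis by (simp add: e_def edg_def dv_def dd_def)
  next
    case False
    then have ry: "red y" and eyx: "e = (y, x)" using assms adj_colour by (auto simp: e_def edg_def)
    have "wav lam (dv x y) (dd x y) t = wav lam (u e 0) (u1 e 0) (1 - t)" for t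
      using dart_step[OF adj_sym[OF assms]] ry eyx False
      unfolding wav_def cosw_sinw_rev by (simp add: dv_def dd_def left_diff_distrib)
    then have "wav lam (dv x y) (dd x y) = (\<lambda>t. wav lam (u e 0) (u1 e 0) (1 - t))" by blast
    then show ?thesis using J_reflect[OF continuous_wav] by simp
  qed
  finally show ?thesis by (simp add: e_def)
qed

section \<open>Averages over the levels of a half tree\<close>

definition par :: "'v \<Rightarrow> 'v \<Rightarrow> 'v" where
  "par p v = (SOME w. E v w \<and> vdist E p v = Suc (vdist E p w))"

lemma par: "v \<noteq> p \<Longrightarrow> E v (par p v) \<and> vdist E p v = Suc (vdist E p (par p v))"
  unfolding par_def by (rule someI_ex) (rule parent_exists)

lemma par_eq: "E v w \<Longrightarrow> vdist E p v = Suc (vdist E p w) \<Longrightarrow> par p v = w"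
  using par[of v p] parent_unique[of v "par p v" p w] by fastforce

text \<open>Depth \<open>n\<close> in the half behind \<open>q\<close>. Each vertex stands for the
  oriented edge that enters it from its parent.\<close>

definition lev :: "'v \<Rightarrow> 'v \<Rightarrow> nat \<Rightarrow> 'v set" where
  "lev p q n = {v. vdist E p v = Suc n \<and> vdist E q v = n}"

definition ch :: "'v \<Rightarrow> 'v \<Rightarrow> 'v set" where
  "ch p v = {y. E v y \<and> vdist E p y = Suc (vdist E p v)}"

context
  fixes p q :: 'v
  assumes pq: "E p q"
begin

lemma finite_lev: "finite (lev p q n)"
  by (rule finite_subset[OF _ finite_sphere[of q n]]) (auto simp: lev_def)

lemma lev_ne: "v \<in> lev p q n \<Longrightarrow> v \<noteq> p"
  by (auto simp: lev_def)

lemma lev_0: "lev p q 0 = {q}"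
  using vdist_0D[of q] adj_vdist[OF pq] by (auto simp: lev_def)

lemma ch_subset:
  assumes v: "v \<in> lev p q n"
  shows "ch p v \<subseteq> lev p q (Suc n)"
proof
  fix y assume y: "y \<in> ch p v"
  have "vdist E p y = Suc (Suc n)" using v y by (simp add: lev_def ch_def)
  moreover have "E v y" "vdist E q v = n" using v y by (auto simp: lev_def ch_def)
  ultimately have "vdist E p y = Suc (Suc n)" "vdist E q y = Suc n"
    using vdist_adj'[OF pq, of y] vdist_adj[of v y q] by linarith+
  then show "y \<in> lev p q (Suc n)" by (simp add: lev_def)
qed

text \<open>The parent stays in the half behind \<open>q\<close>, because by
  \<open>side_cross\<close> only \<open>q\<close> itself has a neighbour in the other half.\<close>

lemma par_lev:
  assumes y: "y \<in> lev p q (Suc n)"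
  shows "par p y \<in> lev p q n"
proof -
  have w: "E y (par p y)" "vdist E p y = Suc (vdist E p (par p y))" using par[of y p] lev_ne[OF y] by auto
  have "vdist E q (par p y) \<noteq> Suc (vdist E p (par p y))"
  proof
    assume "vdist E q (par p y) = Suc (vdist E p (par p y))"
    then have "y = q" using side_cross[OF pq w(1)] y by (simp add: lev_def)
    then show False using y by (simp add: lev_def)
  qed
  then have "vdist E p (par p y) = Suc (vdist E q (par p y))" using vdist_adj'[OF pq] by blast
  then show ?thesis using w y by (simp add: lev_def)
qed

lemma fibre:
  assumes v: "v \<in> lev p q n"
  shows "{y \<in> lev p q (Suc n). par p y = v} = ch p v"
proof (intro subset_antisym subsetI)
  fix y assume "y \<in> {y \<in> lev p q (Suc n). par p y = v}"
  then show "y \<in> ch p v" using par[of y p] lev_ne[of y "Suc n"] adj_sym by (auto simp: ch_def)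
next
  fix y assume y: "y \<in> ch p v"
  then show "y \<in> {y \<in> lev p q (Suc n). par p y = v}"
    using ch_subset[OF v] par_eq[of y v p] adj_sym by (auto simp: ch_def)
qed

lemma lev_sum:
  "(\<Sum>y\<in>lev p q (Suc n). F (par p y) y) = (\<Sum>v\<in>lev p q n. \<Sum>y\<in>ch p v. (F v y :: 'c::comm_monoid_add))"
proof -
  have "(\<Sum>y\<in>lev p q (Suc n). F (par p y) y)
      = (\<Sum>v\<in>lev p q n. \<Sum>y\<in>{y \<in> lev p q (Suc n). par p y = v}. F (par p y) y)"
    using finite_lev par_lev by (intro sum.group[symmetric]) auto
  also have "\<dots> = (\<Sum>v\<in>lev p q n. \<Sum>y\<in>ch p v. F v y)"
  proof (rule sum.cong[OF refl])
    fix v assume v: "v \<in> lev p q n"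
    show "(\<Sum>y\<in>{y \<in> lev p q (Suc n). par p y = v}. F (par p y) y) = (\<Sum>y\<in>ch p v. F v y)"
      by (rule sum.cong[OF fibre[OF v]]) (use fibre[OF v] in auto)
  qed
  finally show ?thesis .
qed

text \<open>Vertices of level \<open>n\<close> branch into \<open>bn (Suc n)\<close> children; the
  shift matches the parity test in \<open>solcoef\<close> and \<open>two_step\<close>.\<close>

definition bn :: "nat \<Rightarrow> nat" where "bn n = (if odd n then br q else br p)"

lemma bn_pos: "bn n \<ge> 1" using br_pos by (simp add: bn_def)

lemma br_lev: "v \<in> lev p q n \<Longrightarrow> br v = bn (Suc n)"
  using red_iff_even[of v p] adj_colour[OF pq] by (auto simp: lev_def bn_def br_def)

lemma card_ch: "v \<in> lev p q n \<Longrightarrow> card (ch p v) = bn (Suc n)"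
  using card_children[OF lev_ne] br_lev by (simp add: ch_def)

lemma card_lev_Suc: "card (lev p q (Suc n)) = bn (Suc n) * card (lev p q n)"
  using lev_sum[of "\<lambda>_ _. 1::nat" n] card_ch by simp

lemma card_lev_pos: "card (lev p q n) > 0"
  by (induction n) (use bn_pos in \<open>auto simp: lev_0 card_lev_Suc Suc_le_eq\<close>)

lemma card_lev_even: "card (lev p q (2 * k)) = (dR * dB) ^ k"
proof (induction k)
  case 0
  then show ?case by (simp add: lev_0)
next
  case (Suc k)
  have "br p * br q = dR * dB" using adj_colour[OF pq] by (auto simp: br_def)
  then show ?case using Suc card_lev_Suc[of "2 * k"] card_lev_Suc[of "Suc (2 * k)"]
    by (simp add: bn_def mult_ac)
qed

definition SV :: "nat \<Rightarrow> complex" where "SV n = (\<Sum>v\<in>lev p q n. dv (par p v) v)"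
definition SD :: "nat \<Rightarrow> complex" where "SD n = (\<Sum>v\<in>lev p q n. dd (par p v) v)"
definition av :: "nat \<Rightarrow> complex" where "av n = SV n / of_nat (card (lev p q n))"
definition ad :: "nat \<Rightarrow> complex" where "ad n = SD n / of_nat (card (lev p q n))"

lemma av_0: "av 0 = dv p q" and ad_0: "ad 0 = dd p q"
proof -
  have "par p q = p" using pq adj_sym adj_vdist by (intro par_eq) auto
  then show "av 0 = dv p q" "ad 0 = dd p q" by (simp_all add: av_def ad_def SV_def SD_def lev_0)
qed

text \<open>Continuity: every edge leaving \<open>v\<close> starts with the value with which the
  edge entering \<open>v\<close> ends.\<close>

lemma SV_Suc: "SV (Suc n) = of_nat (bn (Suc n)) * (SV n * cc lam + SD n * ss lam)"
proof -
  have "SV (Suc n) = (\<Sum>v\<in>lev p q n. \<Sum>y\<in>ch p v. dv v y)" unfolding SV_def by (rule lev_sum)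
  also have "\<dots> = (\<Sum>v\<in>lev p q n. of_nat (bn (Suc n)) * (dv (par p v) v * cc lam + dd (par p v) v * ss lam))"
  proof (intro sum.cong refl)
    fix v assume v: "v \<in> lev p q n"
    have w: "E v (par p v)" using par[OF lev_ne[OF v]] by blast
    have "(\<Sum>y\<in>ch p v. dv v y) = (\<Sum>y\<in>ch p v. dv v (par p v))"
      using w by (intro sum.cong refl dv_cong) (auto simp: ch_def)
    then show "(\<Sum>y\<in>ch p v. dv v y) = of_nat (bn (Suc n)) * (dv (par p v) v * cc lam + dd (par p v) v * ss lam)"
      using dart_step(1)[OF adj_sym[OF w]] card_ch[OF v] by simp
  qed
  finally show ?thesis
    by (simp add: SV_def SD_def sum.distrib flip: sum_distrib_left sum_distrib_right)
qed

text \<open>Kirchhoff: the derivatives towards the children add up to the incoming one, so no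
  branching factor appears. It returns as a divisor in \<open>ad_Suc\<close>, where the sum is
  averaged over the larger level.\<close>

lemma SD_Suc: "SD (Suc n) = SD n * cc lam - lam * SV n * ss lam"
proof -
  have "SD (Suc n) = (\<Sum>v\<in>lev p q n. \<Sum>y\<in>ch p v. dd v y)" unfolding SD_def by (rule lev_sum)
  also have "\<dots> = (\<Sum>v\<in>lev p q n. dd (par p v) v * cc lam - lam * dv (par p v) v * ss lam)"
  proof (intro sum.cong refl)
    fix v assume v: "v \<in> lev p q n"
    have w: "E v (par p v)" "vdist E p v = Suc (vdist E p (par p v))" using par[OF lev_ne[OF v]] by blast+
    have nin: "par p v \<notin> ch p v" using w(2) by (simp add: ch_def)
    have "y = par p v \<or> y \<in> ch p v" if "E v y" for y
      using that vdist_adj[OF that, of p] par_eq[OF that, of p] by (auto simp: ch_def)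
    then have nb: "{y. E v y} = insert (par p v) (ch p v)" using w(1) by (auto simp: ch_def)
    have "0 = dd v (par p v) + (\<Sum>y\<in>ch p v. dd v y)"
      using dd_sum[of v] nin unfolding nb by (subst (asm) sum.insert) (auto simp: ch_def)
    then have "(\<Sum>y\<in>ch p v. dd v y) = - dd v (par p v)"
      by (metis add.inverse_inverse add_eq_0_iff)
    then show "(\<Sum>y\<in>ch p v. dd v y) = dd (par p v) v * cc lam - lam * dv (par p v) v * ss lam"
      using dart_step(2)[OF adj_sym[OF w(1)]] by simp
  qed
  finally show ?thesis by (simp add: SV_def SD_def sum_distrib_left sum_distrib_right sum_subtractf)
qed

lemma av_Suc: "av (Suc n) = av n * cc lam + ad n * ss lam"
  and ad_Suc: "ad (Suc n) = (ad n * cc lam - lam * av n * ss lam) / of_nat (if odd (Suc n) then br q else br p)"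
proof -
  have "of_nat (bn (Suc n)) \<noteq> (0::complex)" "of_nat (card (lev p q n)) \<noteq> (0::complex)"
    using bn_pos[of "Suc n"] card_lev_pos[of n] by auto
  then show "av (Suc n) = av n * cc lam + ad n * ss lam"
    "ad (Suc n) = (ad n * cc lam - lam * av n * ss lam) / of_nat (if odd (Suc n) then br q else br p)"
    unfolding bn_def[symmetric] av_def ad_def SV_Suc SD_Suc card_lev_Suc
    by (simp_all add: field_simps)
qed

text \<open>By Cauchy-Schwarz the energy of the average times the size of the level is at most the
  sum of the energies on its edges, and these edges are distinct.\<close>

lemma level_energy: "ennreal (real (card (lev p q n)) * J (wav lam (av n) (ad n))) \<le> L2sq E red u"
proof -
  define c where "c = real (card (lev p q n))"
  have c: "c > 0" using card_lev_pos[of n] by (simp add: c_def)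
  define w where "w v = wav lam (dv (par p v) v) (dd (par p v) v)" for v
  have i: "(\<lambda>t. (cmod (w v t))\<^sup>2) integrable_on {0..1}" for v
    unfolding w_def by (rule integrable_continuous_real[OF continuous_wav_sq])
  have avg: "wav lam (av n) (ad n) t = (\<Sum>v\<in>lev p q n. w v t) / of_real c" for t
    by (simp add: wav_def w_def av_def ad_def SV_def SD_def c_def sum.distrib sum_distrib_right add_divide_distrib)
  have pw: "c * (cmod (wav lam (av n) (ad n) t))\<^sup>2 \<le> (\<Sum>v\<in>lev p q n. (cmod (w v t))\<^sup>2)" for t
  proof -
    have "(cmod (\<Sum>v\<in>lev p q n. w v t))\<^sup>2 \<le> (\<Sum>v\<in>lev p q n. cmod (w v t))\<^sup>2"
      by (intro power_mono norm_sum) auto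
    also have "\<dots> \<le> (\<Sum>v\<in>lev p q n. (cmod (w v t))\<^sup>2) * c"
      unfolding c_def by (rule sum_squared_le_sum_of_squares)
    finally show ?thesis using c unfolding avg
      by (simp add: norm_divide power_divide field_simps power2_eq_square)
  qed
  have "c * J (wav lam (av n) (ad n)) = integral {0..1} (\<lambda>t. c * (cmod (wav lam (av n) (ad n) t))\<^sup>2)"
    by (simp add: J_def)
  also have "\<dots> \<le> integral {0..1} (\<lambda>t. \<Sum>v\<in>lev p q n. (cmod (w v t))\<^sup>2)"
  proof (rule integral_le)
    show "(\<lambda>t. c * (cmod (wav lam (av n) (ad n) t))\<^sup>2) integrable_on {0..1}"
      by (intro integrable_continuous_real continuous_intros continuous_wav)
    show "(\<lambda>t. \<Sum>v\<in>lev p q n. (cmod (w v t))\<^sup>2) integrable_on {0..1}"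
      using finite_lev i by (intro integrable_sum) auto
  qed (rule pw)
  also have "\<dots> = (\<Sum>v\<in>lev p q n. J (w v))"
    unfolding J_def using i finite_lev by (intro integral_sum) auto
  finally have "ennreal (c * J (wav lam (av n) (ad n))) \<le> ennreal (\<Sum>v\<in>lev p q n. J (w v))"
    by (rule ennreal_leI)
  also have "\<dots> = (\<Sum>v\<in>lev p q n. ennreal (J (w v)))" using J_nonneg by (simp add: sum_ennreal)
  also have "\<dots> = (\<Sum>v\<in>lev p q n. \<integral>\<^sup>+ t. ennreal ((cmod (u (edg (par p v) v) t))\<^sup>2) * indicator {0..1} t \<partial>lborel)"
  proof (intro sum.cong refl)
    fix v assume "v \<in> lev p q n"
    then have "E (par p v) v" using par[OF lev_ne] adj_sym by blast
    then show "ennreal (J (w v)) = (\<integral>\<^sup>+ t. ennreal ((cmod (u (edg (par p v) v) t))\<^sup>2) * indicator {0..1} t \<partial>lborel)"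
      unfolding w_def by (rule J_dart)
  qed
  also have "\<dots> = (\<Sum>e\<in>(\<lambda>v. edg (par p v) v) ` lev p q n. \<integral>\<^sup>+ t. ennreal ((cmod (u e t))\<^sup>2) * indicator {0..1} t \<partial>lborel)"
  proof (subst sum.reindex)
    \<comment> \<open>An edge shared by two vertices of the level would make one of them the parent
      of the other.\<close>
    show "inj_on (\<lambda>v. edg (par p v) v) (lev p q n)"
    proof (rule inj_onI, rule ccontr)
      fix v v' assume v: "v \<in> lev p q n" "v' \<in> lev p q n" "edg (par p v) v = edg (par p v') v'" "v \<noteq> v'"
      then have "v = par p v'" by (auto simp: edg_def split: if_splits)
      then have "vdist E p v' = Suc (vdist E p v)" using par[OF lev_ne[OF v(2)]] by simp
      then show False using v by (simp add: lev_def)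
    qed
  qed simp
  also have "\<dots> \<le> L2sq E red u"
  proof (rule L2sq_ge)
    show "(\<lambda>v. edg (par p v) v) ` lev p q n \<subseteq> edges E red"
      using par lev_ne adj_sym edg_in by blast
  qed (use finite_lev in simp)
  finally show ?thesis by (simp add: c_def)
qed

text \<open>The sequences \<open>za\<close>, \<open>zd\<close> below have the decaying mode removed, so they are geometric with
  ratio \<open>\<nu>\<close>, the other eigenvalue of the transfer matrix; unless they vanish they violate
  the energy bound.\<close>

lemma decaying_mode:
  assumes \<mu>: "\<mu>\<^sup>2 - T0_trace (br q) (br p) lam * \<mu> + 1 / (of_nat (br q) * of_nat (br p)) = 0"
    and small: "cmod \<mu> < 1 / sqrt (real (dB * dR))"
  shows "ss lam * cc lam * (1 + 1 / of_nat (br q)) * dd p q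
    = (\<mu> - (cc lam)\<^sup>2 - ss lam * cc' lam / of_nat (br q)) * dv p q"
proof -
  define N where "N = real (dR * dB)"
  have "dR * dB \<ge> 1" using dR_pos dB_pos by simp
  then have N: "N \<ge> 1" unfolding N_def by linarith
  define \<nu> where "\<nu> = T0_trace (br q) (br p) lam - \<mu>"
  define \<delta> where "\<delta> = 1 / (of_nat (br q) * of_nat (br p) :: complex)"
  have \<mu>\<nu>: "\<mu> * \<nu> = \<delta>" using \<mu> by (simp add: \<nu>_def \<delta>_def power2_eq_square algebra_simps)
  have cd: "cmod \<delta> = 1 / N"
    using adj_colour[OF pq] by (auto simp: \<delta>_def N_def br_def norm_divide norm_mult mult.commute)
  have \<mu>0: "\<mu> \<noteq> 0" using \<mu>\<nu> cd N by auto
  have \<mu>N: "(cmod \<mu>)\<^sup>2 * N < 1"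
  proof -
    have "cmod \<mu> * sqrt N < 1"
      using small N by (simp add: N_def field_simps mult.commute)
    then have "(cmod \<mu> * sqrt N)\<^sup>2 < 1\<^sup>2" using N by (intro power_strict_mono) auto
    then show ?thesis using N by (simp add: power_mult_distrib)
  qed
  \<comment> \<open>Level \<open>2 * k\<close> has \<open>N ^ k\<close> edges, so the mode of \<nu>
    gains energy from level to level even if it decays pointwise.\<close>
  have \<nu>N: "N * (cmod \<nu>)\<^sup>2 > 1"
  proof -
    have xy: "cmod \<mu> * cmod \<nu> = 1 / N" using \<mu>\<nu> cd by (metis norm_mult)
    have "((cmod \<mu>)\<^sup>2 * N) * (N * (cmod \<nu>)\<^sup>2) = (cmod \<mu> * cmod \<nu> * N)\<^sup>2"
      by (simp add: power2_eq_square mult_ac)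
    then have one: "((cmod \<mu>)\<^sup>2 * N) * (N * (cmod \<nu>)\<^sup>2) = 1" unfolding xy using N by simp
    show ?thesis
    proof (rule ccontr)
      assume "\<not> N * (cmod \<nu>)\<^sup>2 > 1"
      then have "((cmod \<mu>)\<^sup>2 * N) * (N * (cmod \<nu>)\<^sup>2) \<le> ((cmod \<mu>)\<^sup>2 * N) * 1"
        using N by (intro mult_left_mono) auto
      then show False using one \<mu>N by linarith
    qed
  qed
  define za where "za k = av (2 * k + 2) - \<mu> * av (2 * k)" for k
  define zd where "zd k = ad (2 * k + 2) - \<mu> * ad (2 * k)" for k
  have four: "2 * Suc k + 2 = 2 * k + 4" "2 * Suc k = 2 * k + 2" for k :: nat by auto
  have geo: "za (Suc k) = \<nu> * za k \<and> zd (Suc k) = \<nu> * zd k" for k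
  proof -
    have lin: "x - \<mu> * y = \<nu> * (y - \<mu> * z)" if "x = (\<mu> + \<nu>) * y - \<mu> * \<nu> * z" for x y z
      using that by (simp add: algebra_simps)
    have "av (2 * k + 4) = (\<mu> + \<nu>) * av (2 * k + 2) - \<mu> * \<nu> * av (2 * k)"
      "ad (2 * k + 4) = (\<mu> + \<nu>) * ad (2 * k + 2) - \<mu> * \<nu> * ad (2 * k)"
      using two_step(2,3)[of av lam ad "br q" "br p" "2 * k", OF av_Suc ad_Suc]
      by (simp_all add: \<mu>\<nu> \<delta>_def) (simp_all add: \<nu>_def)
    from lin[OF this(1)] lin[OF this(2)] show ?thesis unfolding za_def zd_def unfolding four(1) unfolding four(2) by blast
  qed
  have geo': "za k = \<nu> ^ k * za 0 \<and> zd k = \<nu> ^ k * zd 0" for k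
    by (induction k) (simp_all add: geo mult.assoc)
  obtain S where S: "L2sq E red u = ennreal S" "S \<ge> 0" using uL2 by (cases "L2sq E red u") auto
  have bound: "N ^ k * J (wav lam (av (2 * k)) (ad (2 * k))) \<le> S" for k
    using level_energy[of "2 * k"] S(2) unfolding S(1) card_lev_even N_def by (simp add: ennreal_le_iff)
  have "(N * (cmod \<nu>)\<^sup>2) ^ k * J (wav lam (za 0) (zd 0)) \<le> 2 * S + 2 * (cmod \<mu>)\<^sup>2 * S" for k
  proof -
    have "J (wav lam (za k) (zd k)) = (cmod \<nu>)\<^sup>2 ^ k * J (wav lam (za 0) (zd 0))"
    proof -
      have "wav lam (za k) (zd k) t = \<nu> ^ k * wav lam (za 0) (zd 0) t" for t
        using geo'[of k] by (simp add: wav_def distrib_left mult.assoc)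
      moreover have "(cmod (\<nu> ^ k * z))\<^sup>2 = (cmod \<nu>)\<^sup>2 ^ k * (cmod z)\<^sup>2" for z
        by (simp add: norm_mult norm_power power_mult_distrib mult.commute[of k] flip: power_mult)
      ultimately show ?thesis by (simp add: J_def)
    qed
    then have "(N * (cmod \<nu>)\<^sup>2) ^ k * J (wav lam (za 0) (zd 0)) = N ^ k * J (wav lam (za k) (zd k))"
      by (simp add: power_mult_distrib)
    also have "\<dots> \<le> N ^ k * (2 * J (wav lam (av (2 * k + 2)) (ad (2 * k + 2)))
        + 2 * (cmod \<mu>)\<^sup>2 * J (wav lam (av (2 * k)) (ad (2 * k))))"
      unfolding za_def zd_def using N by (intro mult_left_mono wav_diff_J) auto
    also have "\<dots> = 2 * (N ^ k * J (wav lam (av (2 * k + 2)) (ad (2 * k + 2))))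
        + 2 * (cmod \<mu>)\<^sup>2 * (N ^ k * J (wav lam (av (2 * k)) (ad (2 * k))))"
      by (simp add: algebra_simps)
    also have "\<dots> \<le> 2 * S + 2 * (cmod \<mu>)\<^sup>2 * S"
    proof (intro add_mono mult_left_mono bound)
      have "N ^ k * J (wav lam (av (2 * Suc k)) (ad (2 * Suc k))) \<le> N ^ Suc k * J (wav lam (av (2 * Suc k)) (ad (2 * Suc k)))"
        using N J_nonneg by (intro mult_right_mono power_increasing) auto
      also have "\<dots> \<le> S" by (rule bound)
      finally show "N ^ k * J (wav lam (av (2 * k + 2)) (ad (2 * k + 2))) \<le> S" by simp
    qed auto
    finally show ?thesis .
  qed
  note bnd = this
  have "J (wav lam (za 0) (zd 0)) = 0"
  proof (rule ccontr)
    assume "J (wav lam (za 0) (zd 0)) \<noteq> 0"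
    then have J: "J (wav lam (za 0) (zd 0)) > 0" using J_nonneg[of "wav lam (za 0) (zd 0)"] by linarith
    obtain k where "(2 * S + 2 * (cmod \<mu>)\<^sup>2 * S) / J (wav lam (za 0) (zd 0)) < (N * (cmod \<nu>)\<^sup>2) ^ k"
      using real_arch_pow[OF \<nu>N] by blast
    then show False using bnd[of k] J by (simp add: field_simps)
  qed
  then have "za 0 = 0" using wav_zero by blast
  \<comment> \<open>Set against the first row of the two-step matrix, this is the eigenvector
    equation for the Cauchy data on the starting edge.\<close>
  then have "av 2 = \<mu> * av 0" by (simp add: za_def numeral_2_eq_2)
  moreover have "av 2 = ((cc lam)\<^sup>2 + ss lam * cc' lam / of_nat (br q)) * av 0
      + ss lam * cc lam * (1 + 1 / of_nat (br q)) * ad 0"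
    using two_step(1)[of av lam ad "br q" "br p" 0, OF av_Suc ad_Suc] by (simp add: numeral_2_eq_2)
  moreover have "c * y = (m - a - b) * x" if "z = m * x" "z = (a + b) * x + c * y" for a b c m x y z :: complex
    using that by (simp add: algebra_simps)
  ultimately show ?thesis unfolding av_0 ad_0 by blast
qed

end

end


section \<open>From the difference of two solutions to a homogeneous one\<close>

lemma rotation_inverse:
  fixes c s l v w x y :: complex
  assumes "c * c + l * s * s = 1" "w * c - v * s = x" "l * w * s + v * c = y"
  shows "w = x * c + y * s" "v = y * c - l * x * s"
proof -
  have "x * c + y * s = w * (c * c + l * s * s)" "y * c - l * x * s = v * (c * c + l * s * s)"
    unfolding assms(2,3)[symmetric] by (simp_all add: algebra_simps)
  then show "w = x * c + y * s" "v = y * c - l * x * s" using assms(1) by simp_all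
qed

lemma homogeneous_ode:
  assumes d: "\<And>t. t \<in> {0..1} \<Longrightarrow> (w has_vector_derivative w1 t) (at t within {0..1})"
    and i: "\<And>x. x \<in> {0..1} \<Longrightarrow> w1 x = w1 0 - lam * (LINT t:{0..x}|lborel. w t)"
  shows "\<And>t. t \<in> {0..1} \<Longrightarrow> w t = wav lam (w 0) (w1 0) t"
    and "w1 1 = w1 0 * cc lam - lam * w 0 * ss lam"
proof -
  have c: "continuous_on {0..1} w" using d by (rule continuous_on_vector_derivative)
  have d1: "(w1 has_vector_derivative - lam * w t) (at t within {0..1})" if t: "t \<in> {0..1}" for t
  proof -
    have "((\<lambda>x. integral {0..x} w) has_vector_derivative w t) (at t within {0..1})"
      using c t by (rule integral_has_vector_derivative)
    then have "((\<lambda>x. w1 0 - lam * integral {0..x} w) has_vector_derivative 0 - lam * w t) (at t within {0..1})"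
      by (rule has_vector_derivative_diff[OF has_vector_derivative_const has_vector_derivative_mult_right])
    moreover have "w1 x = w1 0 - lam * integral {0..x} w" if x: "x \<in> {0..1}" for x
    proof -
      have "continuous_on {0..x} w" by (rule continuous_on_subset[OF c]) (use x in auto)
      then have s: "set_integrable lborel {0..x} w" by (rule borel_integrable_atLeastAtMost')
      show ?thesis by (rule i[OF x, unfolded set_borel_integral_eq_integral(2)[OF s]])
    qed
    ultimately have "(w1 has_vector_derivative 0 - lam * w t) (at t within {0..1})"
      by (rule has_vector_derivative_transform[OF t, rotated])
    then show ?thesis by simp
  qed
  \<comment> \<open>\<open>X\<close> and \<open>Y\<close> are the Cauchy data at \<open>t\<close>
    transported back to 0 along the equation; their constancy solves the initial value
    problem.\<close>
  define X where "X t = w t * cosw lam t - w1 t * sinw lam t" for t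
  define Y where "Y t = lam * w t * sinw lam t + w1 t * cosw lam t" for t
  have "(X has_vector_derivative 0) (at t within {0..1})" if "t \<in> {0..1}" for t
  proof -
    have "((\<lambda>t. w t * cosw lam t - w1 t * sinw lam t) has_vector_derivative
      (w t * (- lam * sinw lam t) + w1 t * cosw lam t) - (w1 t * cosw lam t + (- lam * w t) * sinw lam t)) (at t within {0..1})"
      by (rule has_vector_derivative_diff[OF has_vector_derivative_mult[OF d[OF that] has_vector_derivative_cosw]
            has_vector_derivative_mult[OF d1[OF that] has_vector_derivative_sinw]])
    then show ?thesis by (simp add: X_def[abs_def] algebra_simps)
  qed
  then obtain x where x: "\<And>t. t \<in> {0..1} \<Longrightarrow> X t = x"
    using has_vector_derivative_zero_constant[of "{0..1::real}" X] by (auto simp: convex_real_interval)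
  have "(Y has_vector_derivative 0) (at t within {0..1})" if "t \<in> {0..1}" for t
  proof -
    have "((\<lambda>t. lam * w t * sinw lam t + w1 t * cosw lam t) has_vector_derivative
      (lam * w t * cosw lam t + lam * w1 t * sinw lam t) + (w1 t * (- lam * sinw lam t) + (- lam * w t) * cosw lam t)) (at t within {0..1})"
      by (rule has_vector_derivative_add[OF has_vector_derivative_mult[OF
              has_vector_derivative_mult_right[OF d[OF that]] has_vector_derivative_sinw]
            has_vector_derivative_mult[OF d1[OF that] has_vector_derivative_cosw]])
    then show ?thesis by (simp add: Y_def[abs_def] algebra_simps)
  qed
  then obtain y where y: "\<And>t. t \<in> {0..1} \<Longrightarrow> Y t = y"
    using has_vector_derivative_zero_constant[of "{0..1::real}" Y] by (auto simp: convex_real_interval)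
  have xy: "x = w 0" "y = w1 0" using x[of 0] y[of 0] by (auto simp: X_def Y_def)
  show "w t = wav lam (w 0) (w1 0) t" if t: "t \<in> {0..1}" for t
    unfolding wav_def
    by (rule rotation_inverse(1)[OF cosw_sinw_sq x[OF t, unfolded X_def xy] y[OF t, unfolded Y_def xy]])
  show "w1 1 = w1 0 * cc lam - lam * w 0 * ss lam"
  proof -
    have "X 1 = w 0" "Y 1 = w1 0" using x[of 1] y[of 1] xy by auto
    from rotation_inverse(2)[OF cosw_sinw_sq this[unfolded X_def Y_def]]
    show ?thesis by (simp add: cosw_1 sinw_1)
  qed
qed

text \<open>\<open>f\<close> cancels in the difference. The equations hold only almost everywhere,
  so the second derivatives are compared under the integral; the integrand that remains is
  continuous, as \<open>homogeneous_ode\<close> needs.\<close>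

lemma domL_difference_integral:
  assumes h: "in_domL E red h h1 h2" and g: "in_domL E red g g1 g2" and e: "e \<in> edges E red"
    and fh: "AE t in lborel. t \<in> {0..1} \<longrightarrow> - h2 e t - lam * h e t = f e t"
    and fg: "AE t in lborel. t \<in> {0..1} \<longrightarrow> - g2 e t - lam * g e t = f e t"
    and x: "x \<in> {0..1}"
  shows "h1 e x - g1 e x = h1 e 0 - g1 e 0 - lam * (LINT t:{0..x}|lborel. h e t - g e t)"
proof -
  have sub: "set_integrable lborel {0..x} k" if "set_integrable lborel {0..1} k" for k :: "real \<Rightarrow> complex"
    by (rule set_integrable_subset[OF that]) (use x in auto)
  have ih: "set_integrable lborel {0..x} (h2 e)" and ig: "set_integrable lborel {0..x} (g2 e)"
  proof -
    have "set_integrable lborel {0..1} (h2 e)" using h e unfolding in_domL_def by blast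
    then show "set_integrable lborel {0..x} (h2 e)" by (rule sub)
    have "set_integrable lborel {0..1} (g2 e)" using g e unfolding in_domL_def by blast
    then show "set_integrable lborel {0..x} (g2 e)" by (rule sub)
  qed
  have "continuous_on {0..1} (k e)" if "in_domL E red k k1 k2" for k k1 k2
  proof (rule continuous_on_vector_derivative)
    show "(k e has_vector_derivative k1 e t) (at t within {0..1})" if "t \<in> {0..1}" for t
      using \<open>in_domL E red k k1 k2\<close> e that unfolding in_domL_def by blast
  qed
  from this[OF h] this[OF g] have ic: "set_integrable lborel {0..x} (\<lambda>t. - lam * (h e t - g e t))"
    by (intro sub borel_integrable_atLeastAtMost' continuous_intros)
  have eqh: "h1 e x = h1 e 0 + (LINT t:{0..x}|lborel. h2 e t)"
    and eqg: "g1 e x = g1 e 0 + (LINT t:{0..x}|lborel. g2 e t)"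
  proof -
    show "h1 e x = h1 e 0 + (LINT t:{0..x}|lborel. h2 e t)" using h e x unfolding in_domL_def by blast
    show "g1 e x = g1 e 0 + (LINT t:{0..x}|lborel. g2 e t)" using g e x unfolding in_domL_def by blast
  qed
  have "(LINT t:{0..x}|lborel. h2 e t - g2 e t) = (LINT t:{0..x}|lborel. - lam * (h e t - g e t))"
    unfolding set_lebesgue_integral_def
  proof (rule integral_cong_AE)
    show "(\<lambda>t. indicator {0..x} t *\<^sub>R (h2 e t - g2 e t)) \<in> borel_measurable lborel"
      using set_integral_diff(1)[OF ih ig] by (simp only: set_integrable_def borel_measurable_integrable)
    show "(\<lambda>t. indicator {0..x} t *\<^sub>R (- lam * (h e t - g e t))) \<in> borel_measurable lborel"
      using ic by (simp only: set_integrable_def borel_measurable_integrable)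
    show "AE t in lborel. indicator {0..x} t *\<^sub>R (h2 e t - g2 e t) = indicator {0..x} t *\<^sub>R (- lam * (h e t - g e t))"
      using fh fg
    proof eventually_elim
      case (elim t)
      show ?case
      proof (cases "t \<in> {0..x}")
        case True
        then have "- h2 e t - lam * h e t = - g2 e t - lam * g e t" using elim x by auto
        then have "h2 e t - g2 e t = - lam * (h e t - g e t)" by (simp add: algebra_simps)
        then show ?thesis by simp
      qed simp
    qed
  qed
  then have "(LINT t:{0..x}|lborel. h2 e t) - (LINT t:{0..x}|lborel. g2 e t) = - lam * (LINT t:{0..x}|lborel. h e t - g e t)"
    using set_integral_diff(2)[OF ih ig] by (simp only: set_integral_mult_right)
  then show ?thesis unfolding eqh eqg by (simp add: algebra_simps)
qed

context resolvent
begin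

lemma homogeneous_zero:
  assumes "homogeneous E red dR dB lam u u1" and e: "e \<in> Edg" and t: "t \<in> {0..1}"
  shows "u e t = 0"
proof -
  interpret hom: homogeneous E red dR dB lam u u1 by fact
  obtain r b where rb: "e = (r, b)" by (cases e)
  have adj: "E r b" "E b r" "red r" "\<not> red b"
    using edge_adj[OF e] edge_red[OF e] edge_blue[OF e] adj_sym rb by auto
  have br: "br r = dR" "br b = dB" using adj by (auto simp: br_def)
  define a0 b0 where "a0 = u e 0" and "b0 = u1 e 0"
  have "hom.dv r b = a0" "hom.dd r b = b0" using adj by (auto simp: hom.dv_def hom.dd_def a0_def b0_def rb)
  \<comment> \<open>Averaging over the half behind the blue end relates the Cauchy data at the red
    end to those of \<open>V\<close>.\<close>
  then have V: "aV * b0 = bV * a0"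
    using hom.decaying_mode[OF adj(1), of mu] mu_char' mu_less by (simp add: br aV_def bV_def)
  have dbr: "hom.dv b r = a0 * cc lam + b0 * ss lam" "hom.dd b r = - (b0 * cc lam - lam * a0 * ss lam)"
    using hom.dart_step[OF adj(1)] \<open>hom.dv r b = a0\<close> \<open>hom.dd r b = b0\<close>
    by (metis minus_minus)+
  \<comment> \<open>The same over the half behind the red end, now with the data at the blue end and
    the reversed derivative.\<close>
  have U: "aU * - (b0 * cc lam - lam * a0 * ss lam) = bU * (a0 * cc lam + b0 * ss lam)"
  proof -
    have "(ss lam * cc lam * (1 + 1 / of_nat dR)) * hom.dd b r = (mu - (cc lam)\<^sup>2 - ss lam * cc' lam / of_nat dR) * hom.dv b r"
      using hom.decaying_mode[OF adj(2), of mu] mu_char mu_less by (simp add: br)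
    then have "aU * hom.dd b r = bU * hom.dv b r" by (simp only: aU_def bU_def mult_minus_left)
    then show ?thesis unfolding dbr .
  qed
  have "a0 * U0d = b0 * U0v" using U by (simp add: U0v_def U0d_def algebra_simps)
  \<comment> \<open>\<open>W\<close> is the determinant of the two linear relations for
    (\<open>a0\<close>, \<open>b0\<close>).\<close>
  then have "W * a0 = 0" "W * b0 = 0" using V unfolding W_eq by algebra+
  then have "a0 = 0" "b0 = 0" using W_nz by auto
  then show ?thesis using hom.form[OF e t] by (simp add: a0_def b0_def wav_def)
qed

lemma solution_unique:
  assumes "solves_res E red lam f h" and e: "e \<in> Edg" and t: "t \<in> {0..1}"
  shows "h e t = g e t"
proof -
  obtain h1 h2 where h: "in_domL E red h h1 h2"
    and fh: "\<And>e. e \<in> Edg \<Longrightarrow> AE t in lborel. t \<in> {0..1} \<longrightarrow> - h2 e t - lam * h e t = f e t"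
    using assms(1) by (auto simp: solves_res_def)
  have fg: "AE t in lborel. t \<in> {0..1} \<longrightarrow> - g2 e t - lam * g e t = f e t" for e
    by (simp add: g2_def)
  define u where "u e t = h e t - g e t" for e t
  define u1 where "u1 e t = h1 e t - g1 e t" for e t
  have ode: "(\<forall>t\<in>{0..1}. u e t = wav lam (u e 0) (u1 e 0) t) \<and> u1 e 1 = u1 e 0 * cc lam - lam * u e 0 * ss lam"
    if e: "e \<in> Edg" for e
  proof -
    have d: "(u e has_vector_derivative u1 e t) (at t within {0..1})" if "t \<in> {0..1}" for t
    proof -
      have "(h e has_vector_derivative h1 e t) (at t within {0..1})"
        using h e that unfolding in_domL_def by blast
      from has_vector_derivative_diff[OF this g_deriv[OF e that]] show ?thesis
        by (simp add: u_def[abs_def] u1_def)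
    qed
    have i: "u1 e x = u1 e 0 - lam * (LINT t:{0..x}|lborel. u e t)" if "x \<in> {0..1}" for x
      unfolding u_def u1_def by (rule domL_difference_integral[where f = f and lam = lam, OF h in_domL_g e fh[OF e] fg[of e] that])
    show ?thesis using homogeneous_ode[OF d i] by blast
  qed
  have "in_L2 E red (\<lambda>e t. 1 * h e t + (- 1) * g e t)"
    using h unfolding in_domL_def by (intro in_L2_lin in_L2_g) blast
  then have L2: "L2sq E red u < \<infinity>" by (simp add: in_L2_def u_def[abs_def])
  have hd: "\<And>e e'. e \<in> Edg \<Longrightarrow> e' \<in> Edg \<Longrightarrow> fst e = fst e' \<Longrightarrow> k e 0 = k e' 0"
      "\<And>e e'. e \<in> Edg \<Longrightarrow> e' \<in> Edg \<Longrightarrow> snd e = snd e' \<Longrightarrow> k e 1 = k e' 1"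
      "\<And>v. red v \<Longrightarrow> (\<Sum>b\<in>{b. E v b}. k1 (v, b) 0) = 0"
      "\<And>v. \<not> red v \<Longrightarrow> (\<Sum>r\<in>{r. E v r}. - k1 (r, v) 1) = 0"
    if "in_domL E red k k1 k2" for k k1 k2
    using that unfolding in_domL_def by blast+
  have "homogeneous E red dR dB lam u u1"
  proof
    fix e e' assume "e \<in> Edg" "e' \<in> Edg" "fst e = fst e'"
    then show "u e 0 = u e' 0" unfolding u_def using hd(1)[OF h] hd(1)[OF in_domL_g] by metis
  next
    fix e e' assume "e \<in> Edg" "e' \<in> Edg" "snd e = snd e'"
    then show "u e 1 = u e' 1" unfolding u_def using hd(2)[OF h] hd(2)[OF in_domL_g] by metis
  next
    fix v assume v: "red v"
    show "(\<Sum>b\<in>{b. E v b}. u1 (v, b) 0) = 0"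
      unfolding u1_def sum_subtractf using hd(3)[OF h v] hd(3)[OF in_domL_g v] by simp
  next
    fix v assume v: "\<not> red v"
    have "(\<Sum>r\<in>{r. E v r}. - u1 (r, v) 1) = (\<Sum>r\<in>{r. E v r}. - h1 (r, v) 1) - (\<Sum>r\<in>{r. E v r}. - g1 (r, v) 1)"
      unfolding u1_def by (simp add: sum_negf sum_subtractf)
    then show "(\<Sum>r\<in>{r. E v r}. - u1 (r, v) 1) = 0"
      using hd(4)[OF h v] hd(4)[OF in_domL_g v] by simp
  qed (use ode L2 in blast)+
  from homogeneous_zero[OF this e t] show ?thesis by (simp add: u_def)
qed

end

theorem theorem4p6:
  fixes E :: "'v \<Rightarrow> 'v \<Rightarrow> bool" and red :: "'v \<Rightarrow> bool" and dR dB :: nat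
    and lam :: complex and f :: "'v \<times> 'v \<Rightarrow> real \<Rightarrow> complex"
  assumes "biregular_tree E red dR dB"
    and "lam \<notin> sigma1 dR dB \<union> sigma2 dR dB"
    and "in_L2 E red f"
  shows "\<exists>g. solves_res E red lam f g
           \<and> (\<forall>h. solves_res E red lam f h \<longrightarrow> (\<forall>e\<in>edges E red. \<forall>t\<in>{0..1}. h e t = g e t))
           \<and> L2_has_sum E red (Rterm E dR dB lam f) g"
proof -
  interpret resolvent E red dR dB lam f
    using assms by unfold_locales (auto simp: biregular_tree_def)
  show ?thesis using solves_g solution_unique L2_has_sum_g by blast
qed

end
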